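(* Let $\Omega$, $s$, $\Sigma_h$, $U_h$, $T_{F1}$, $T_{F1,h}$ and the eigenvalues and eigenfunctions $\lambda_k,u_k,\lambda_{k,h}$ be as in the context. Let $\lambda=\lambda_i=\lambda_{i+1}=\dots=\lambda_{i+m-1}$ be an eigenvalue of multiplicity $m$ with eigenspace $E=\mathrm{span}\{u_i,\dots,u_{i+m-1}\}$, and set $$\epsilon_\lambda(h)=\sup_{\substack{u\in E\\ \|u\|_{L^2(\Omega)}=1}}\ \inf_{\substack{\boldsymbol{\tau}\in\Sigma_h\\ v\in U_h}}\big(\|\nabla u-\boldsymbol{\tau}\|_{\mathbf{H}(\mathrm{div};\Omega)}+\|u-v\|_{H^1(\Omega)}\big).$$ Then there is a constant $C$ independent of $h$ such that, for $h$ small enough, $$|\lambda-\lambda_{j,h}|\le C\,\epsilon_\lambda(h)^2\qquad\forall j=i,\dots,i+m-1.$$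
   Context: $(\cdot,\cdot)$ is the $L^2(\Omega)$ (or $L^2(\Omega)^d$) inner product; $\mathbf{H}(\mathrm{div};\Omega)=\{\boldsymbol{\tau}\in L^2(\Omega)^d:\mathrm{div}\,\boldsymbol{\tau}\in L^2(\Omega)\}$ with the graph norm; $\mathbf{H}^s(\Omega)=H^s(\Omega)^d$. Assumptions: $\Omega\subset\mathbb{R}^d$ ($d=2,3$) is a Lipschitz polygon/polyhedron and $s\in(1/2,1]$ is such that for every $f\in L^2(\Omega)$ the solution $u\in H^1_0(\Omega)$ of $-\Delta u=f$ belongs to $H^{1+s}(\Omega)$. $\Sigma_h\subset\mathbf{H}(\mathrm{div};\Omega)$ and $U_h\subset H^1_0(\Omega)$ are families of finite dimensional (finite element) spaces indexed by $h>0$ such that, with $C$ independent of $h$, $\inf_{\boldsymbol{\tau}\in\Sigma_h}\|\boldsymbol{\chi}-\boldsymbol{\tau}\|_{\mathbf{H}(\mathrm{div};\Omega)}\le Ch^s(\|\boldsymbol{\chi}\|_{\mathbf{H}^s(\Omega)}+\|\mathrm{div}\,\boldsymbol{\chi}\|_{H^{1+s}(\Omega)})$ and $\inf_{v\in U_h}\|p-v\|_{H^1(\Omega)}\le Ch^s\|p\|_{H^{1+s}(\Omega)}$ for all $\boldsymbol{\chi}\in\mathbf{H}^s(\Omega)$ with $\mathrm{div}\,\boldsymbol{\chi}\in H^{1+s}(\Omega)$ and all $p\in H^{1+s}(\Omega)\cap H^1_0(\Omega)$. Operators: $T_{F1}:L^2(\Omega)\to L^2(\Omega)$ maps $f$ to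 the component $u\in H^1_0(\Omega)$ of the solution $(\boldsymbol{\sigma},u)\in\mathbf{H}(\mathrm{div};\Omega)\times H^1_0(\Omega)$ of $$\begin{cases}(\boldsymbol{\sigma},\boldsymbol{\tau})+(\mathrm{div}\,\boldsymbol{\sigma},\mathrm{div}\,\boldsymbol{\tau})-(\nabla u,\boldsymbol{\tau})=-(f,\mathrm{div}\,\boldsymbol{\tau})&\forall\boldsymbol{\tau}\in\mathbf{H}(\mathrm{div};\Omega)\\ -(\boldsymbol{\sigma},\nabla v)+(\nabla u,\nabla v)=0&\forall v\in H^1_0(\Omega).\end{cases}$$ $T_{F1,h}:L^2(\Omega)\to L^2(\Omega)$ maps $f$ to the component $u_h\in U_h$ of the solution $(\boldsymbol{\sigma}_h,u_h)\in\Sigma_h\times U_h$ of the same equations with test functions $\boldsymbol{\tau}\in\Sigma_h$, $v\in U_h$. Eigenvalues: $0<\lambda_1\le\lambda_2\le\dots$ are the reciprocals of the nonzero eigenvalues of $T_{F1}$ (i.e. the Dirichlet Laplace eigenvalues), repeated according to multiplicity, with $L^2(\Omega)$-normalized eigenfunctions $u_k$; $0<\lambda_{1,h}\le\dots\le\lambda_{N(h),h}$ are the reciprocals of the nonzero eigenvalues of $T_{F1,h}$ (all real and positive), repeated according to multiplicity. *)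

theory Defs
  imports "HOL-Analysis.Analysis"
begin

text \<open>
  Elements of the function spaces below are functions on the whole of \<open>real^'d\<close>, of which only
  the restriction to \<open>\<Omega>\<close> matters, and only up to null sets: the spaces are closed under a.e.
  equality on \<open>\<Omega>\<close> (except \<open>test_fun\<close> and \<open>fun_span\<close>), and equality of two elements is a.e. equality on \<open>\<Omega>\<close>. A chosen value
  (\<open>wgrad\<close>, \<open>wdiv\<close>, \<open>galerkin_op\<close>) is a representative of an a.e. class.
\<close>

subsection \<open>Domains\<close>

text \<open>
  Near each boundary point, in coordinates \<open>y = y' + t *\<^sub>R n\<close> with \<open>y'\<close> orthogonal to the unit
  vector \<open>n\<close>, the set is the strict epigraph of a Lipschitz function.
\<close>
definition lipschitz_boundary :: "(real^'d) set \<Rightarrow> bool" where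
  "lipschitz_boundary \<Omega> \<longleftrightarrow>
     (\<forall>x\<in>frontier \<Omega>. \<exists>n r \<phi> L. norm n = 1 \<and> 0 < r \<and> L-lipschitz_on {z. z \<bullet> n = 0} \<phi> \<and>
        (\<forall>y\<in>ball x r. y \<in> \<Omega> \<longleftrightarrow> \<phi> (y - (y \<bullet> n) *\<^sub>R n) < y \<bullet> n))"

definition lipschitz_polyhedron :: "(real^'d) set \<Rightarrow> bool" where
  "lipschitz_polyhedron \<Omega> \<longleftrightarrow>
     open \<Omega> \<and> connected \<Omega> \<and> bounded \<Omega> \<and> \<Omega> \<noteq> {} \<and> lipschitz_boundary \<Omega> \<and>
     (\<exists>P. finite P \<and> (\<forall>p\<in>P. polytope p) \<and> closure \<Omega> = \<Union>P)"

subsection \<open>Square integrable functions\<close>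

definition L2 :: "(real^'d) set \<Rightarrow> (real^'d \<Rightarrow> 'b::euclidean_space) set" where
  "L2 \<Omega> = {f. f \<in> borel_measurable (lebesgue_on \<Omega>) \<and>
              integrable (lebesgue_on \<Omega>) (\<lambda>x. (norm (f x))\<^sup>2)}"

definition L2_inner ::
  "(real^'d) set \<Rightarrow> (real^'d \<Rightarrow> 'b::euclidean_space) \<Rightarrow> (real^'d \<Rightarrow> 'b) \<Rightarrow> real" where
  "L2_inner \<Omega> f g = (\<integral>x. f x \<bullet> g x \<partial>lebesgue_on \<Omega>)"

definition L2_norm :: "(real^'d) set \<Rightarrow> (real^'d \<Rightarrow> 'b::euclidean_space) \<Rightarrow> real" where
  "L2_norm \<Omega> f = sqrt (L2_inner \<Omega> f f)"

subsection \<open>Weak derivatives\<close>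

definition cgrad :: "(real^'d \<Rightarrow> real) \<Rightarrow> real^'d \<Rightarrow> real^'d" where
  "cgrad \<phi> x = (\<chi> i. frechet_derivative \<phi> (at x) (axis i 1))"

fun k_times_cont_diff :: "nat \<Rightarrow> (real^'d \<Rightarrow> real) \<Rightarrow> bool" where
  "k_times_cont_diff 0 \<phi> \<longleftrightarrow> continuous_on UNIV \<phi>"
| "k_times_cont_diff (Suc k) \<phi> \<longleftrightarrow>
     (\<forall>x. \<phi> differentiable (at x)) \<and> (\<forall>i. k_times_cont_diff k (\<lambda>x. cgrad \<phi> x $ i))"

definition test_fun :: "(real^'d) set \<Rightarrow> (real^'d \<Rightarrow> real) set" where
  "test_fun \<Omega> = {\<phi>. (\<forall>k. k_times_cont_diff k \<phi>) \<and>
     compact (closure {x. \<phi> x \<noteq> 0}) \<and> closure {x. \<phi> x \<noteq> 0} \<subseteq> \<Omega>}"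

definition has_wgrad ::
  "(real^'d) set \<Rightarrow> (real^'d \<Rightarrow> real) \<Rightarrow> (real^'d \<Rightarrow> real^'d) \<Rightarrow> bool" where
  "has_wgrad \<Omega> u g \<longleftrightarrow> g \<in> L2 \<Omega> \<and>
     (\<forall>\<phi>\<in>test_fun \<Omega>. \<forall>i. L2_inner \<Omega> u (\<lambda>x. cgrad \<phi> x $ i) = - L2_inner \<Omega> (\<lambda>x. g x $ i) \<phi>)"

definition wgrad :: "(real^'d) set \<Rightarrow> (real^'d \<Rightarrow> real) \<Rightarrow> real^'d \<Rightarrow> real^'d" where
  "wgrad \<Omega> u = (SOME g. has_wgrad \<Omega> u g)"

definition has_wdiv ::
  "(real^'d) set \<Rightarrow> (real^'d \<Rightarrow> real^'d) \<Rightarrow> (real^'d \<Rightarrow> real) \<Rightarrow> bool" where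
  "has_wdiv \<Omega> \<tau> q \<longleftrightarrow> q \<in> L2 \<Omega> \<and>
     (\<forall>\<phi>\<in>test_fun \<Omega>. L2_inner \<Omega> \<tau> (cgrad \<phi>) = - L2_inner \<Omega> q \<phi>)"

definition wdiv :: "(real^'d) set \<Rightarrow> (real^'d \<Rightarrow> real^'d) \<Rightarrow> real^'d \<Rightarrow> real" where
  "wdiv \<Omega> \<tau> = (SOME q. has_wdiv \<Omega> \<tau> q)"

subsection \<open>Sobolev spaces\<close>

definition Hdiv :: "(real^'d) set \<Rightarrow> (real^'d \<Rightarrow> real^'d) set" where
  "Hdiv \<Omega> = {\<tau> \<in> L2 \<Omega>. \<exists>q. has_wdiv \<Omega> \<tau> q}"

definition Hdiv_norm :: "(real^'d) set \<Rightarrow> (real^'d \<Rightarrow> real^'d) \<Rightarrow> real" where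
  "Hdiv_norm \<Omega> \<tau> = sqrt ((L2_norm \<Omega> \<tau>)\<^sup>2 + (L2_norm \<Omega> (wdiv \<Omega> \<tau>))\<^sup>2)"

definition H1 :: "(real^'d) set \<Rightarrow> (real^'d \<Rightarrow> real) set" where
  "H1 \<Omega> = {u \<in> L2 \<Omega>. \<exists>g. has_wgrad \<Omega> u g}"

definition H1_norm :: "(real^'d) set \<Rightarrow> (real^'d \<Rightarrow> real) \<Rightarrow> real" where
  "H1_norm \<Omega> u = sqrt ((L2_norm \<Omega> u)\<^sup>2 + (L2_norm \<Omega> (wgrad \<Omega> u))\<^sup>2)"

text \<open>The closure of the test functions in \<open>H1 \<Omega>\<close>.\<close>
definition H10 :: "(real^'d) set \<Rightarrow> (real^'d \<Rightarrow> real) set" where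
  "H10 \<Omega> = {u \<in> H1 \<Omega>. \<forall>e>0. \<exists>\<phi>\<in>test_fun \<Omega>. H1_norm \<Omega> (\<lambda>x. u x - \<phi> x) < e}"

text \<open>The square of the Sobolev--Slobodeckij seminorm of order \<open>s\<close>.\<close>
definition slobodeckij :: "(real^'d) set \<Rightarrow> real \<Rightarrow> (real^'d \<Rightarrow> real) \<Rightarrow> ennreal" where
  "slobodeckij \<Omega> s u = (\<integral>\<^sup>+x. \<integral>\<^sup>+y. ennreal ((u x - u y)\<^sup>2 / norm (x - y) powr (real CARD('d) + 2 * s))
     \<partial>lebesgue_on \<Omega> \<partial>lebesgue_on \<Omega>)"

text \<open>\<open>Hs\<close> and \<open>Hs_norm\<close> are meant for order \<open>0 < s \<le> 1\<close>, with \<open>Hs \<Omega> 1 = H1 \<Omega>\<close>.\<close>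
definition Hs :: "(real^'d) set \<Rightarrow> real \<Rightarrow> (real^'d \<Rightarrow> real) set" where
  "Hs \<Omega> s = (if s = 1 then H1 \<Omega> else {u \<in> L2 \<Omega>. slobodeckij \<Omega> s u < \<infinity>})"

definition Hs_norm :: "(real^'d) set \<Rightarrow> real \<Rightarrow> (real^'d \<Rightarrow> real) \<Rightarrow> real" where
  "Hs_norm \<Omega> s u = (if s = 1 then H1_norm \<Omega> u
     else sqrt ((L2_norm \<Omega> u)\<^sup>2 + enn2real (slobodeckij \<Omega> s u)))"

definition Hs_vec :: "(real^'d) set \<Rightarrow> real \<Rightarrow> (real^'d \<Rightarrow> real^'d) set" where
  "Hs_vec \<Omega> s = {\<tau>. \<forall>i. (\<lambda>x. \<tau> x $ i) \<in> Hs \<Omega> s}"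

definition Hs_vec_norm :: "(real^'d) set \<Rightarrow> real \<Rightarrow> (real^'d \<Rightarrow> real^'d) \<Rightarrow> real" where
  "Hs_vec_norm \<Omega> s \<tau> = sqrt (\<Sum>i\<in>UNIV. (Hs_norm \<Omega> s (\<lambda>x. \<tau> x $ i))\<^sup>2)"

text \<open>The space of order \<open>1 + s\<close>.\<close>
definition H1s :: "(real^'d) set \<Rightarrow> real \<Rightarrow> (real^'d \<Rightarrow> real) set" where
  "H1s \<Omega> s = {u \<in> H1 \<Omega>. wgrad \<Omega> u \<in> Hs_vec \<Omega> s}"

definition H1s_norm :: "(real^'d) set \<Rightarrow> real \<Rightarrow> (real^'d \<Rightarrow> real) \<Rightarrow> real" where
  "H1s_norm \<Omega> s u = sqrt ((L2_norm \<Omega> u)\<^sup>2 + (Hs_vec_norm \<Omega> s (wgrad \<Omega> u))\<^sup>2)"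

definition poisson_sol ::
  "(real^'d) set \<Rightarrow> (real^'d \<Rightarrow> real) \<Rightarrow> (real^'d \<Rightarrow> real) \<Rightarrow> bool" where
  "poisson_sol \<Omega> f u \<longleftrightarrow> u \<in> H10 \<Omega> \<and>
     (\<forall>v\<in>H10 \<Omega>. L2_inner \<Omega> (wgrad \<Omega> u) (wgrad \<Omega> v) = L2_inner \<Omega> f v)"

subsection \<open>The discrete and continuous solution operators\<close>

text \<open>\<open>W\<close> is the linear span, up to a.e. equality, of a finite subset of \<open>V\<close>.\<close>
definition fin_dim_subspace ::
  "(real^'d) set \<Rightarrow> (real^'d \<Rightarrow> 'b::euclidean_space) set \<Rightarrow> (real^'d \<Rightarrow> 'b) set \<Rightarrow> bool" where
  "fin_dim_subspace \<Omega> W V \<longleftrightarrow> (\<exists>B. finite B \<and> B \<subseteq> V \<and>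
     W = {w \<in> V. \<exists>c. AE x in lebesgue_on \<Omega>. w x = (\<Sum>b\<in>B. c b *\<^sub>R b x)})"

definition galerkin_sol ::
  "(real^'d) set \<Rightarrow> (real^'d \<Rightarrow> real^'d) set \<Rightarrow> (real^'d \<Rightarrow> real) set \<Rightarrow>
   (real^'d \<Rightarrow> real) \<Rightarrow> (real^'d \<Rightarrow> real^'d) \<Rightarrow> (real^'d \<Rightarrow> real) \<Rightarrow> bool" where
  "galerkin_sol \<Omega> S U f \<sigma> u \<longleftrightarrow> \<sigma> \<in> S \<and> u \<in> U \<and>
     (\<forall>\<tau>\<in>S. L2_inner \<Omega> \<sigma> \<tau> + L2_inner \<Omega> (wdiv \<Omega> \<sigma>) (wdiv \<Omega> \<tau>) - L2_inner \<Omega> (wgrad \<Omega> u) \<tau>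
        = - L2_inner \<Omega> f (wdiv \<Omega> \<tau>)) \<and>
     (\<forall>v\<in>U. - L2_inner \<Omega> \<sigma> (wgrad \<Omega> v) + L2_inner \<Omega> (wgrad \<Omega> u) (wgrad \<Omega> v) = 0)"

text \<open>
  The continuous operator is obtained for \<open>S = Hdiv \<Omega>\<close>, \<open>U = H10 \<Omega>\<close>, the discrete one for
  finite dimensional subspaces; in both cases the solution is unique up to a.e. equality.
\<close>
definition galerkin_op ::
  "(real^'d) set \<Rightarrow> (real^'d \<Rightarrow> real^'d) set \<Rightarrow> (real^'d \<Rightarrow> real) set \<Rightarrow>
   (real^'d \<Rightarrow> real) \<Rightarrow> real^'d \<Rightarrow> real" where
  "galerkin_op \<Omega> S U f = (SOME u. \<exists>\<sigma>. galerkin_sol \<Omega> S U f \<sigma> u)"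

definition T_F1 :: "(real^'d) set \<Rightarrow> (real^'d \<Rightarrow> real) \<Rightarrow> real^'d \<Rightarrow> real" where
  "T_F1 \<Omega> = galerkin_op \<Omega> (Hdiv \<Omega>) (H10 \<Omega>)"

subsection \<open>Eigenvalues\<close>

definition eigenspace ::
  "(real^'d) set \<Rightarrow> ((real^'d \<Rightarrow> real) \<Rightarrow> real^'d \<Rightarrow> real) \<Rightarrow> real \<Rightarrow> (real^'d \<Rightarrow> real) set" where
  "eigenspace \<Omega> T \<mu> = {w \<in> L2 \<Omega>. AE x in lebesgue_on \<Omega>. T w x = \<mu> * w x}"

text \<open>The functions \<open>w k\<close>, \<open>k \<in> I\<close>, form a finite basis of \<open>V\<close>, modulo a.e. equality.\<close>
definition ae_basis ::
  "(real^'d) set \<Rightarrow> nat set \<Rightarrow> (nat \<Rightarrow> real^'d \<Rightarrow> real) \<Rightarrow> (real^'d \<Rightarrow> real) set \<Rightarrow> bool" where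
  "ae_basis \<Omega> I w V \<longleftrightarrow> finite I \<and> w ` I \<subseteq> V \<and>
     (\<forall>c. (AE x in lebesgue_on \<Omega>. (\<Sum>k\<in>I. c k * w k x) = 0) \<longrightarrow> (\<forall>k\<in>I. c k = 0)) \<and>
     (\<forall>v\<in>V. \<exists>c. AE x in lebesgue_on \<Omega>. v x = (\<Sum>k\<in>I. c k * w k x))"

text \<open>
  \<open>l k\<close>, \<open>k \<in> K\<close>, lists in nondecreasing order the reciprocals of the nonzero eigenvalues of
  \<open>T\<close>, all of them positive, with multiplicities: each value \<open>1 / \<mu>\<close> occurs \<open>dim (eigenspace \<mu>)\<close>
  times (never, if \<open>\<mu>\<close> is not an eigenvalue), and \<open>w k\<close> are corresponding eigenfunctions.
\<close>
definition eigen_enum ::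
  "(real^'d) set \<Rightarrow> ((real^'d \<Rightarrow> real) \<Rightarrow> real^'d \<Rightarrow> real) \<Rightarrow> nat set \<Rightarrow>
   (nat \<Rightarrow> real) \<Rightarrow> (nat \<Rightarrow> real^'d \<Rightarrow> real) \<Rightarrow> bool" where
  "eigen_enum \<Omega> T K l w \<longleftrightarrow> (\<forall>k\<in>K. 0 < l k) \<and> (\<forall>j\<in>K. \<forall>k\<in>K. j \<le> k \<longrightarrow> l j \<le> l k) \<and>
     (\<forall>\<mu>. \<mu> \<noteq> 0 \<longrightarrow> ae_basis \<Omega> {k \<in> K. 1 / l k = \<mu>} w (eigenspace \<Omega> T \<mu>))"

definition fun_span :: "nat set \<Rightarrow> (nat \<Rightarrow> real^'d \<Rightarrow> real) \<Rightarrow> (real^'d \<Rightarrow> real) set" where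
  "fun_span I w = {u. \<exists>c. u = (\<lambda>x. \<Sum>k\<in>I. c k * w k x)}"

definition approx_err ::
  "(real^'d) set \<Rightarrow> (real^'d \<Rightarrow> real^'d) set \<Rightarrow> (real^'d \<Rightarrow> real) set \<Rightarrow>
   (real^'d \<Rightarrow> real) set \<Rightarrow> real" where
  "approx_err \<Omega> S U E = (SUP u \<in> {u \<in> E. L2_norm \<Omega> u = 1}. INF (\<tau>, v) \<in> S \<times> U.
     Hdiv_norm \<Omega> (\<lambda>x. wgrad \<Omega> u x - \<tau> x) + H1_norm \<Omega> (\<lambda>x. u x - v x))"

end

theory Submission
  imports Defs
begin

text \<open>
  The discrete eigenvalue problem is a symmetric one in disguise. Since \<open>u\<close> vanishes on the boundary,
  \<open>- (u, div \<tau>) = (grad u, \<tau>)\<close>, so an eigenpair satisfies \<open>\<sigma> = (1 + \<lambda>) K u\<close>, where \<open>K u\<close> is the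
  orthogonal projection of \<open>(grad u, 0)\<close> onto the pairs \<open>(\<tau>, div \<tau>)\<close> with \<open>\<tau>\<close> in the discrete flux
  space, and the second equation becomes \<open>(1 + \<lambda>) (K u, K v) = (grad u, grad v)\<close>. Hence
  \<open>\<nu> = 1 / (1 + \<lambda>)\<close> are the eigenvalues of the quadratic form of \<open>K\<close>, whose values on the
  discrete space are bounded by those of the continuous problem; by the min-max principle discrete
  eigenvalues approximate the exact ones from above. For an exact eigenfunction \<open>u\<close> with Ritz projection
  \<open>p\<close>, the Rayleigh quotient of \<open>p\<close> is \<open>\<nu>\<close> up to the square of the approximation error, by
  stationarity, and the components of \<open>p\<close> along the discrete eigenfunctions of smaller eigenvalues are of
  first order, by the spectral gap; choosing \<open>u\<close> in the eigenspace orthogonal to all but one discrete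
  eigenfunction of the cluster gives the estimate. The gap for small \<open>h\<close> follows by induction over the
  clusters. The compactness behind the min-max principle is a consequence of the approximation
  property of the spaces and the regularity assumption, through the Baire category theorem.
\<close>

text \<open>The unknown is the gradient of u rather than u itself. In the energy inner product both
  eigenvalue problems then have one form, \<open>A x \<bullet> A y = \<nu> * (x \<bullet> y)\<close>
  on a complete subspace, with \<open>A = potential\<close> and \<nu> = 1 / \<lambda>, or
  \<open>A = flux S\<close> and \<nu> = 1 / (1 + \<lambda>). The exact flux of an eigenvector x is
  the pair of its field and its divergence, \<open>(x, - ev *\<^sub>R L x)\<close>. The abstract
  estimate uses only the distance of this pair from the discrete fluxes and the distance of x from
  the discrete gradients; \<epsilon> bounds both. Stationarity is concrete here: the discrete flux
  of x is a multiple of the projection of that pair, so every error term in the Rayleigh quotient is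
  a product of two projection residuals. The number of discrete eigenvalues is not given in advance.
  That there are enough of them comes out of the same estimate, with 0 in place of a missing value.
  Baire enters because the regularity assumption only places each Poisson solution in
  \<open>H1s\<close>, with no bound of its norm by the data. The factor in front of h to the power s
  thus depends on f in an uncontrolled way.\<close>

lemma quadratic_nonneg_linear_zero:
  fixes a b :: real
  assumes "\<And>t. 0 \<le> 2 * t * a + t\<^sup>2 * b"
  shows "a = 0"
proof (rule ccontr)
  assume "a \<noteq> 0"
  \<comment> \<open>For positive b the minimiser would be - a / b. The denominator |b| + 1 is
    positive for every b and still leaves a negative value.\<close>
  define t where "t = - a / (\<bar>b\<bar> + 1)"
  have "2 * t * a + t\<^sup>2 * b \<le> 2 * t * a + t\<^sup>2 * (\<bar>b\<bar> + 1)"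
    by (intro add_left_mono mult_left_mono) auto
  also have "\<dots> = - (a\<^sup>2 / (\<bar>b\<bar> + 1))"
  proof -
    have "\<bar>b\<bar> + 1 \<noteq> 0" by linarith
    then have "t * (\<bar>b\<bar> + 1) = - a" by (simp add: t_def)
    then have "t\<^sup>2 * (\<bar>b\<bar> + 1) = - t * a" by (simp add: power2_eq_square mult.assoc)
    then show ?thesis by (simp add: t_def power2_eq_square)
  qed
  also have "\<dots> < 0" using \<open>a \<noteq> 0\<close> by simp
  finally show False using assms[of t] by simp
qed

lemma power2_norm_add: "(norm (x + y :: 'a::real_inner))\<^sup>2 = (norm x)\<^sup>2 + 2 * (x \<bullet> y) + (norm y)\<^sup>2"
  by (simp add: power2_norm_eq_inner inner_add inner_commute)

lemma power2_norm_diff: "(norm (x - y :: 'a::real_inner))\<^sup>2 = (norm x)\<^sup>2 - 2 * (x \<bullet> y) + (norm y)\<^sup>2"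
  by (simp add: power2_norm_eq_inner inner_diff inner_commute)

subsection \<open>Orthogonal projections\<close>

lemma parallelogram_law:
  "(norm (x - y :: 'a::real_inner))\<^sup>2 = 2 * (norm x)\<^sup>2 + 2 * (norm y)\<^sup>2 - (norm (x + y))\<^sup>2"
  by (simp add: power2_norm_add power2_norm_diff)

text \<open>The midpoint of two terms of a minimising sequence lies in \<open>Z\<close> and is no
  closer to x than d, so the parallelogram law makes the sequence Cauchy. Completeness is asked of
  \<open>Z\<close> alone, as the ambient space may be incomplete.\<close>

lemma projection_exists:
  fixes Z :: "'a::real_inner set"
  assumes Z: "subspace Z" and c: "complete Z"
  shows "\<exists>p\<in>Z. \<forall>y\<in>Z. (x - p) \<bullet> y = 0"
proof -
  have ne: "Z \<noteq> {}" using subspace_0[OF Z] by auto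
  define d where "d = infdist x Z"
  have d0: "0 \<le> d" by (simp add: d_def infdist_nonneg)
  have "\<exists>p\<in>Z. dist x p < d + inverse (real (Suc n))" for n
  proof -
    have "infdist x Z < d + inverse (real (Suc n))" by (simp add: d_def)
    then show ?thesis unfolding infdist_notempty[OF ne]
      by (subst (asm) cINF_less_iff[OF ne]) (auto intro: bdd_belowI2[where m=0])
  qed
  then obtain p where p: "\<And>n. p n \<in> Z" "\<And>n. dist x (p n) < d + inverse (real (Suc n))"
    by metis
  define e where "e n = (d + inverse (real (Suc n)))\<^sup>2 - d\<^sup>2" for n
  have "(\<lambda>n. (d + inverse (real (Suc n)))\<^sup>2 - d\<^sup>2) \<longlonglongrightarrow> (d + 0)\<^sup>2 - d\<^sup>2"
    by (intro tendsto_intros LIMSEQ_inverse_real_of_nat)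
  moreover have "e = (\<lambda>n. (d + inverse (real (Suc n)))\<^sup>2 - d\<^sup>2)" by (simp add: e_def fun_eq_iff)
  ultimately have e: "e \<longlonglongrightarrow> 0" by simp
  have px: "(norm (x - p n))\<^sup>2 \<le> d\<^sup>2 + e n" for n
    unfolding e_def using p(2)[of n] by (simp add: dist_norm power_mono)
  have le: "d \<le> norm (x - y)" if "y \<in> Z" for y
    unfolding d_def using infdist_le[OF that, of x] by (simp add: dist_norm)
  have key: "(norm (p n - p m))\<^sup>2 \<le> 2 * e n + 2 * e m" for n m
  proof -
    have "(1/2) *\<^sub>R (p n + p m) \<in> Z" using p Z by (simp add: subspace_add subspace_scale)
    from le[OF this] have "d\<^sup>2 \<le> (norm (x - (1/2) *\<^sub>R (p n + p m)))\<^sup>2"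
      using d0 by (simp add: power_mono)
    moreover have "(x - p m) + (x - p n) = 2 *\<^sub>R (x - (1/2) *\<^sub>R (p n + p m))"
      by (simp add: algebra_simps scaleR_2)
    then have "(norm ((x - p m) + (x - p n)))\<^sup>2 = 4 * (norm (x - (1/2) *\<^sub>R (p n + p m)))\<^sup>2"
      by (simp add: power_mult_distrib)
    moreover have "p n - p m = (x - p m) - (x - p n)" by simp
    ultimately show ?thesis
      using parallelogram_law[of "x - p m" "x - p n"] px[of n] px[of m] by simp
  qed
  have "Cauchy p"
  proof (rule CauchyI)
    fix \<epsilon> :: real assume \<epsilon>: "0 < \<epsilon>"
    then have "0 < \<epsilon>\<^sup>2 / 4" by simp
    from order_tendstoD(2)[OF e this] obtain M where M: "\<And>n. n \<ge> M \<Longrightarrow> e n < \<epsilon>\<^sup>2 / 4"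
      by (auto simp: eventually_sequentially)
    have "norm (p m - p n) < \<epsilon>" if "m \<ge> M" "n \<ge> M" for m n
    proof -
      have "(norm (p m - p n))\<^sup>2 < \<epsilon>\<^sup>2" using key[of m n] M[OF that(1)] M[OF that(2)] by simp
      then show ?thesis using \<epsilon> by (simp add: power_less_imp_less_base)
    qed
    then show "\<exists>M. \<forall>m\<ge>M. \<forall>n\<ge>M. norm (p m - p n) < \<epsilon>" by blast
  qed
  then obtain q where q: "q \<in> Z" "p \<longlonglongrightarrow> q" using c p(1) by (auto simp: complete_def)
  have "(\<lambda>n. (norm (x - p n))\<^sup>2) \<longlonglongrightarrow> (norm (x - q))\<^sup>2" by (intro tendsto_intros q)
  moreover have "(\<lambda>n. d\<^sup>2 + e n) \<longlonglongrightarrow> d\<^sup>2 + 0" by (intro tendsto_intros e)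
  ultimately have qd: "(norm (x - q))\<^sup>2 \<le> d\<^sup>2 + 0" by (rule LIMSEQ_le) (use px in blast)
  \<comment> \<open>First-order condition: moving q along y inside \<open>Z\<close> cannot decrease
    the distance to x.\<close>
  have "(x - q) \<bullet> y = 0" if y: "y \<in> Z" for y
  proof (rule quadratic_nonneg_linear_zero)
    fix t :: real
    have "q - t *\<^sub>R y \<in> Z" using q y Z by (simp add: subspace_diff subspace_scale)
    from le[OF this] have "d\<^sup>2 \<le> (norm ((x - q) + t *\<^sub>R y))\<^sup>2"
      using d0 by (simp add: power_mono algebra_simps)
    then show "0 \<le> 2 * t * ((x - q) \<bullet> y) + t\<^sup>2 * (norm y)\<^sup>2"
      using qd by (simp add: power2_norm_add power_mult_distrib)
  qed
  then show ?thesis using q by blast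
qed

definition proj :: "'a::real_inner set \<Rightarrow> 'a \<Rightarrow> 'a" where
  "proj Z x = (SOME p. p \<in> Z \<and> (\<forall>y\<in>Z. (x - p) \<bullet> y = 0))"

context
  fixes Z :: "'a::real_inner set"
  assumes Z: "subspace Z" "complete Z"
begin

lemma proj_in: "proj Z x \<in> Z" and proj_orth: "y \<in> Z \<Longrightarrow> (x - proj Z x) \<bullet> y = 0"
  using someI_ex[of "\<lambda>p. p \<in> Z \<and> (\<forall>y\<in>Z. (x - p) \<bullet> y = 0)"] projection_exists[OF Z, of x]
  unfolding proj_def by auto

lemma proj_inner: "y \<in> Z \<Longrightarrow> proj Z x \<bullet> y = x \<bullet> y"
  using proj_orth[of y x] by (simp add: inner_diff)

lemma proj_unique: "p \<in> Z \<Longrightarrow> (\<And>y. y \<in> Z \<Longrightarrow> p \<bullet> y = x \<bullet> y) \<Longrightarrow> proj Z x = p"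
proof -
  assume p: "p \<in> Z" "\<And>y. y \<in> Z \<Longrightarrow> p \<bullet> y = x \<bullet> y"
  have "proj Z x - p \<in> Z" using p(1) proj_in Z(1) by (simp add: subspace_diff)
  from p(2)[OF this] proj_inner[OF this, of x]
  have "(proj Z x - p) \<bullet> (proj Z x - p) = 0" by (simp add: inner_diff_left)
  then show ?thesis by simp
qed

lemma proj_add: "proj Z (x + y) = proj Z x + proj Z y"
  by (rule proj_unique) (auto simp: proj_in proj_inner Z subspace_add inner_add_left)

lemma proj_scaleR: "proj Z (c *\<^sub>R x) = c *\<^sub>R proj Z x"
  by (rule proj_unique) (auto simp: proj_in proj_inner Z subspace_scale)

lemma linear_proj: "linear (proj Z)"
  by (intro linearI proj_add proj_scaleR)

lemma proj_norm2: "(norm x)\<^sup>2 = (norm (proj Z x))\<^sup>2 + (norm (x - proj Z x))\<^sup>2"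
  using power2_norm_add[of "proj Z x" "x - proj Z x"] proj_orth[OF proj_in, of x x]
  by (simp add: inner_commute)

lemma norm_proj_le: "norm (proj Z x) \<le> norm x"
  by (rule power2_le_imp_le) (use proj_norm2[of x] in auto)

text \<open>Approximation errors are stated with \<open>infdist\<close>, which refers to no choice,
  and used as norms of projection residuals.\<close>

lemma proj_infdist: "norm (x - proj Z x) = infdist x Z"
proof (rule antisym)
  show "infdist x Z \<le> norm (x - proj Z x)" using infdist_le[OF proj_in] by (simp add: dist_norm)
  have ne: "Z \<noteq> {}" using subspace_0[OF Z(1)] by auto
  show "norm (x - proj Z x) \<le> infdist x Z"
    unfolding infdist_notempty[OF ne]
  proof (rule cINF_greatest[OF ne])
    fix y assume y: "y \<in> Z"
    then have "proj Z x - y \<in> Z" using proj_in Z(1) by (simp add: subspace_diff)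
    from proj_orth[OF this, of x]
    have "(norm ((x - proj Z x) + (proj Z x - y)))\<^sup>2 = (norm (x - proj Z x))\<^sup>2 + (norm (proj Z x - y))\<^sup>2"
      unfolding power2_norm_add by linarith
    then have "(norm (x - y))\<^sup>2 = (norm (x - proj Z x))\<^sup>2 + (norm (proj Z x - y))\<^sup>2" by simp
    then show "norm (x - proj Z x) \<le> dist x y" using power2_le_imp_le[of "norm (x - proj Z x)" "norm (x - y)"] by (simp add: dist_norm)
  qed
qed

end

text \<open>Bolzano-Weierstrass for finite-dimensional subspaces of an arbitrary inner product
  space. The induction splits off the component q of the new vector orthogonal to the earlier ones,
  so that the scalar coefficient and the remainder are bounded separately. The projection that
  defines q requires the smaller span to be complete, which the induction hypothesis
  provides.\<close>

lemma bounded_seq_subseq_span: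
  fixes B :: "'a::real_inner set" and X :: "nat \<Rightarrow> 'a"
  assumes "finite B" "\<And>n. X n \<in> span B" "bounded (range X)"
  shows "\<exists>l\<in>span B. \<exists>r. strict_mono r \<and> (X \<circ> r) \<longlonglongrightarrow> l"
  using assms
proof (induction B arbitrary: X rule: finite_induct)
  case empty
  then have "X = (\<lambda>n. 0)" by auto
  then have "strict_mono (id :: nat \<Rightarrow> nat) \<and> (X \<circ> id) \<longlonglongrightarrow> 0" by (simp add: strict_mono_def)
  then show ?case by (metis span_zero)
next
  case (insert b B)
  have comp: "complete (span B)"
  proof (rule completeI)
    fix f :: "nat \<Rightarrow> 'a" assume f: "\<forall>n. f n \<in> span B" "Cauchy f"
    then have "bounded (range f)" by (simp add: cauchy_imp_bounded)
    with insert.IH[of f] f obtain l r where "l \<in> span B" "strict_mono r" "(f \<circ> r) \<longlonglongrightarrow> l" by blast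
    with f(2) show "\<exists>l\<in>span B. f \<longlonglongrightarrow> l" using Cauchy_converges_subseq[of f] by blast
  qed
  define q where "q = b - proj (span B) b"
  have sp: "span (insert b B) = span (insert q B)"
  proof -
    have "proj (span B) b \<in> span B" by (rule proj_in) (auto simp: comp)
    then show ?thesis unfolding q_def by (intro eq_span_insert_eq) simp
  qed
  have qo: "q \<bullet> y = 0" if "y \<in> span B" for y
    unfolding q_def by (rule proj_orth) (use comp that in auto)
  show ?case
  proof (cases "q = 0")
    case True
    then have "span (insert b B) = span B" using sp by simp
    then show ?thesis using insert by auto
  next
    case False
    have "\<exists>k. X n - k *\<^sub>R q \<in> span B" for n
      using insert.prems(1)[of n] unfolding sp by (simp add: span_breakdown_eq)
    then obtain c where c: "\<And>n. X n - c n *\<^sub>R q \<in> span B" by metis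
    define Y where "Y n = X n - c n *\<^sub>R q" for n
    have X: "X n = Y n + c n *\<^sub>R q" for n by (simp add: Y_def)
    have XN: "(norm (X n))\<^sup>2 = (norm (Y n))\<^sup>2 + (c n)\<^sup>2 * (norm q)\<^sup>2" for n
      using qo[OF c[of n]] unfolding X
      by (simp add: power2_norm_add power_mult_distrib Y_def[symmetric] inner_commute)
    obtain M where M: "\<And>n. norm (X n) \<le> M" using insert.prems(2) by (auto simp: bounded_iff)
    have "norm (Y n) \<le> M" for n
      by (rule order_trans[OF power2_le_imp_le M[of n]]) (use XN[of n] in auto)
    then have bY: "bounded (range (Y \<circ> r))" for r by (auto simp: bounded_iff)
    have "\<bar>c n\<bar> \<le> M / norm q" for n
    proof -
      have "\<bar>c n\<bar> * norm q \<le> norm (X n)"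
        by (rule power2_le_imp_le) (use XN[of n] in \<open>auto simp: power_mult_distrib\<close>)
      then show ?thesis using M[of n] False by (simp add: field_simps)
    qed
    then have "bounded (range c)" by (auto simp: bounded_iff)
    then obtain k r where r: "strict_mono r" "(c \<circ> r) \<longlonglongrightarrow> k"
      using bounded_imp_convergent_subsequence by blast
    obtain l r' where r': "l \<in> span B" "strict_mono r'" "(Y \<circ> r \<circ> r') \<longlonglongrightarrow> l"
      using insert.IH[OF _ bY[of r]] c unfolding Y_def o_apply by blast
    have "(X \<circ> (r \<circ> r')) \<longlonglongrightarrow> l + k *\<^sub>R q"
    proof -
      have "(c \<circ> r \<circ> r') \<longlonglongrightarrow> k" using r(2) r'(2) by (rule LIMSEQ_subseq_LIMSEQ)
      then have "(\<lambda>n. Y (r (r' n)) + c (r (r' n)) *\<^sub>R q) \<longlonglongrightarrow> l + k *\<^sub>R q"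
        using r'(3) by (intro tendsto_intros) (auto simp: o_def)
      then show ?thesis by (simp add: X[symmetric] o_def)
    qed
    moreover have "l + k *\<^sub>R q \<in> span (insert b B)"
      unfolding sp using r'(1) by (auto simp: span_breakdown_eq intro!: exI[of _ k])
    moreover have "strict_mono (r \<circ> r')" using r r' by (simp add: strict_mono_o)
    ultimately show ?thesis by blast
  qed
qed

lemma complete_span_finite:
  fixes B :: "'a::real_inner set"
  assumes "finite B" shows "complete (span B)"
proof (rule completeI)
  fix f :: "nat \<Rightarrow> 'a" assume f: "\<forall>n. f n \<in> span B" "Cauchy f"
  then have "bounded (range f)" by (simp add: cauchy_imp_bounded)
  with bounded_seq_subseq_span[OF assms, of f] f
  obtain l r where "l \<in> span B" "strict_mono r" "(f \<circ> r) \<longlonglongrightarrow> l" by blast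
  with f(2) show "\<exists>l\<in>span B. f \<longlonglongrightarrow> l" using Cauchy_converges_subseq[of f] by blast
qed

subsection \<open>Compact quadratic forms\<close>

text \<open>All clauses are relative to \<open>Z\<close>: the instance \<open>potential\<close> is
  an arbitrary choice outside the gradients.\<close>

definition compact_on :: "'a::real_inner set \<Rightarrow> ('a \<Rightarrow> 'b::real_inner) \<Rightarrow> bool" where
  "compact_on Z A \<longleftrightarrow>
     (\<forall>x\<in>Z. \<forall>y\<in>Z. A (x + y) = A x + A y) \<and> (\<forall>c. \<forall>x\<in>Z. A (c *\<^sub>R x) = c *\<^sub>R A x) \<and>
     (\<exists>C. \<forall>x\<in>Z. norm (A x) \<le> C * norm x) \<and>
     (\<forall>X :: nat \<Rightarrow> 'a. (\<forall>n. X n \<in> Z) \<and> bounded (range X) \<longrightarrow>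
        (\<exists>r l. strict_mono r \<and> (\<lambda>n. A (X (r n))) \<longlonglongrightarrow> l))"

lemma compact_on_add: "compact_on Z A \<Longrightarrow> x \<in> Z \<Longrightarrow> y \<in> Z \<Longrightarrow> A (x + y) = A x + A y"
  and compact_on_scaleR: "compact_on Z A \<Longrightarrow> x \<in> Z \<Longrightarrow> A (c *\<^sub>R x) = c *\<^sub>R A x"
  by (auto simp: compact_on_def)

lemma compact_on_bound:
  assumes "compact_on Z A" obtains C where "0 < C" "\<And>x. x \<in> Z \<Longrightarrow> norm (A x) \<le> C * norm x"
proof -
  obtain C where C: "\<And>x. x \<in> Z \<Longrightarrow> norm (A x) \<le> C * norm x"
    using assms unfolding compact_on_def by blast
  show ?thesis
  proof (rule that[of "\<bar>C\<bar> + 1"])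
    fix x assume "x \<in> Z"
    then have "norm (A x) \<le> C * norm x" by (rule C)
    also have "\<dots> \<le> (\<bar>C\<bar> + 1) * norm x" by (intro mult_right_mono) auto
    finally show "norm (A x) \<le> (\<bar>C\<bar> + 1) * norm x" .
  qed simp
qed

lemma compact_on_subseq:
  assumes "compact_on Z A" "\<And>n. X n \<in> Z" "bounded (range X)"
  obtains r :: "nat \<Rightarrow> nat" and l where "strict_mono r" "(\<lambda>n. A (X (r n))) \<longlonglongrightarrow> l"
  using assms unfolding compact_on_def by blast

lemma compact_on_subset: "compact_on Z A \<Longrightarrow> Y \<subseteq> Z \<Longrightarrow> compact_on Y A"
  unfolding compact_on_def by (meson subsetD)

lemma compact_on_diff:
  assumes "compact_on Z A" "subspace Z" "x \<in> Z" "y \<in> Z" shows "A (x - y) = A x - A y"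
proof -
  have "A (x + (-1) *\<^sub>R y) = A x + A ((-1) *\<^sub>R y)"
    using assms by (intro compact_on_add[of Z]) (simp_all only: subspace_scale)
  also have "A ((-1) *\<^sub>R y) = (-1) *\<^sub>R A y" using assms by (intro compact_on_scaleR[of Z])
  finally show ?thesis by simp
qed

lemma compact_on_sum:
  assumes A: "compact_on Z A" and Z: "subspace Z" and "\<And>k. k \<in> I \<Longrightarrow> g k \<in> Z"
  shows "A (\<Sum>k\<in>I. c k *\<^sub>R g k) = (\<Sum>k\<in>I. c k *\<^sub>R A (g k))"
  using assms(3)
proof (induction I rule: infinite_finite_induct)
  case (insert k I)
  have "(\<Sum>k\<in>I. c k *\<^sub>R g k) \<in> Z" using insert.prems Z by (intro subspace_sum subspace_scale) auto
  then show ?case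
    using insert Z by (simp add: compact_on_add[OF A] compact_on_scaleR[OF A] subspace_scale)
next
  case (infinite I)
  have "A (0 *\<^sub>R 0) = 0 *\<^sub>R A 0" by (rule compact_on_scaleR[OF A subspace_0[OF Z]])
  then show ?case using infinite by simp
next
  case empty
  have "A (0 *\<^sub>R 0) = 0 *\<^sub>R A 0" by (rule compact_on_scaleR[OF A subspace_0[OF Z]])
  then show ?case by simp
qed

text \<open>A maximizing sequence for the Rayleigh quotient is Cauchy as soon as its image under \<open>A\<close>
  converges, by the parallelogram law; so no adjoint of \<open>A\<close> is needed.\<close>
lemma max_eigenvector:
  fixes A :: "'a::real_inner \<Rightarrow> 'b::real_inner"
  assumes Z: "subspace Z" "complete Z" and A: "compact_on Z A"
    and x0: "x0 \<in> Z" "\<beta> * (norm x0)\<^sup>2 < (norm (A x0))\<^sup>2" and \<beta>: "0 \<le> \<beta>"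
  shows "\<exists>\<gamma>>\<beta>. \<exists>x\<in>Z. x \<noteq> 0 \<and> (\<forall>y\<in>Z. A x \<bullet> A y = \<gamma> * (x \<bullet> y))"
proof -
  note Ascale = compact_on_scaleR[OF A]
  obtain C where C: "0 < C" "\<And>x. x \<in> Z \<Longrightarrow> norm (A x) \<le> C * norm x"
    using compact_on_bound[OF A] by blast
  define Q where "Q = (\<lambda>x. (norm (A x))\<^sup>2) ` {x \<in> Z. norm x = 1}"
  define \<gamma> where "\<gamma> = Sup Q"
  have bdd: "bdd_above Q"
  proof (rule bdd_aboveI[of _ "C\<^sup>2"])
    fix q assume "q \<in> Q"
    then obtain x where x: "x \<in> Z" "norm x = 1" "q = (norm (A x))\<^sup>2" by (auto simp: Q_def)
    then have "norm (A x) \<le> C" using C(2)[of x] by simp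
    then show "q \<le> C\<^sup>2" using x by (simp add: power_mono)
  qed
  have le: "(norm (A x))\<^sup>2 \<le> \<gamma> * (norm x)\<^sup>2" if x: "x \<in> Z" for x
  proof (cases "x = 0")
    case True
    then show ?thesis using C(2)[OF x] by simp
  next
    case False
    define e where "e = (1 / norm x) *\<^sub>R x"
    have e: "e \<in> Z" "norm e = 1" using x Z False by (auto simp: e_def subspace_scale)
    have "(norm (A e))\<^sup>2 \<le> \<gamma>" unfolding \<gamma>_def
      by (rule cSup_upper[OF _ bdd]) (use e in \<open>auto simp: Q_def\<close>)
    moreover have "(norm (A e))\<^sup>2 = (norm (A x))\<^sup>2 / (norm x)\<^sup>2"
      unfolding e_def Ascale[OF x] by (simp add: power_divide)
    ultimately show ?thesis using False by (simp add: field_simps)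
  qed
  have x0n: "x0 \<noteq> 0" using x0 C(2)[of x0] by auto
  have \<gamma>\<beta>: "\<beta> < \<gamma>"
  proof -
    have "\<beta> * (norm x0)\<^sup>2 < \<gamma> * (norm x0)\<^sup>2" using x0 le[OF x0(1)] by linarith
    then show ?thesis using x0n by (simp add: mult_less_cancel_right)
  qed
  then have \<gamma>0: "0 < \<gamma>" using \<beta> by simp
  have ne: "Q \<noteq> {}"
    using x0(1) x0n Z by (auto simp: Q_def intro!: exI[of _ "(1 / norm x0) *\<^sub>R x0"] subspace_scale)
  have "\<exists>x. x \<in> Z \<and> norm x = 1 \<and> \<gamma> - inverse (real (Suc n)) < (norm (A x))\<^sup>2" for n
  proof -
    have "\<gamma> - inverse (real (Suc n)) < Sup Q" by (simp add: \<gamma>_def)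
    then show ?thesis using less_cSup_iff[OF ne bdd] by (auto simp: Q_def)
  qed
  then obtain X where X: "\<And>n. X n \<in> Z" "\<And>n. norm (X n) = 1"
    "\<And>n. \<gamma> - inverse (real (Suc n)) < (norm (A (X n)))\<^sup>2"
    by metis
  have "bounded (range X)" using X(2) by (auto simp: bounded_iff)
  then obtain r l where r: "strict_mono (r :: nat \<Rightarrow> nat)" "(\<lambda>n. A (X (r n))) \<longlonglongrightarrow> l"
    using compact_on_subseq[OF A, of X] X(1) by blast
  define W where "W n = X (r n)" for n
  have W: "W n \<in> Z" "norm (W n) = 1" for n using X by (auto simp: W_def)
  have AW: "\<gamma> - inverse (real (Suc n)) < (norm (A (W n)))\<^sup>2" for n
  proof -
    have "inverse (real (Suc (r n))) \<le> inverse (real (Suc n))"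
      using seq_suble[OF r(1), of n] by (intro le_imp_inverse_le) auto
    then show ?thesis using X(3)[of "r n"] unfolding W_def by linarith
  qed
  have key: "(norm (W n - W m))\<^sup>2 \<le>
      (2 * inverse (real (Suc n)) + 2 * inverse (real (Suc m)) + (norm (A (W n) - A (W m)))\<^sup>2) / \<gamma>" for n m
  proof -
    have "(norm (A (W n) + A (W m)))\<^sup>2 \<le> \<gamma> * (norm (W n + W m))\<^sup>2"
      using le[of "W n + W m"] W Z compact_on_add[OF A, of "W n" "W m"] by (simp add: subspace_add)
    moreover have "(norm (W n - W m))\<^sup>2 = 4 - (norm (W n + W m))\<^sup>2"
      using parallelogram_law[of "W n" "W m"] by (simp only: W) simp
    then have "\<gamma> * (norm (W n - W m))\<^sup>2 = \<gamma> * 4 - \<gamma> * (norm (W n + W m))\<^sup>2"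
      by (simp add: right_diff_distrib)
    ultimately have "\<gamma> * (norm (W n - W m))\<^sup>2 \<le> \<gamma> * 4 - (norm (A (W n) + A (W m)))\<^sup>2"
      by linarith
    also have "\<dots> \<le> 2 * inverse (real (Suc n)) + 2 * inverse (real (Suc m)) + (norm (A (W n) - A (W m)))\<^sup>2"
      using parallelogram_law[of "A (W n)" "A (W m)"] AW[of n] AW[of m] by linarith
    finally show ?thesis using \<gamma>0 by (simp add: field_simps)
  qed
  have "Cauchy W"
  proof (rule CauchyI)
    fix \<epsilon> :: real assume \<epsilon>: "0 < \<epsilon>"
    \<comment> \<open>The numerator in \<open>key\<close> will be below 2\<delta> + 2\<delta> +
      \<delta>, hence below 8\<delta>, which is \<epsilon> squared times \<gamma>.\<close>
    define \<delta> where "\<delta> = \<epsilon>\<^sup>2 * \<gamma> / 8"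
    have \<delta>: "0 < \<delta>" using \<epsilon> \<gamma>0 by (simp add: \<delta>_def)
    have "Cauchy (\<lambda>n. A (W n))" using r(2) by (simp add: W_def LIMSEQ_imp_Cauchy)
    from CauchyD[OF this, of "sqrt \<delta>"] \<delta> obtain M1
      where M1: "\<And>m n. m \<ge> M1 \<Longrightarrow> n \<ge> M1 \<Longrightarrow> norm (A (W m) - A (W n)) < sqrt \<delta>" by auto
    obtain M2 where M2: "inverse (real (Suc M2)) < \<delta>" using reals_Archimedean[OF \<delta>] by blast
    have "norm (W m - W n) < \<epsilon>" if "m \<ge> max M1 M2" "n \<ge> max M1 M2" for m n
    proof -
      have "inverse (real (Suc k)) < \<delta>" if "k \<ge> M2" for k
        by (rule order.strict_trans1[OF le_imp_inverse_le M2]) (use that in auto)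
      then have "inverse (real (Suc m)) < \<delta>" "inverse (real (Suc n)) < \<delta>" using that by auto
      moreover have "(norm (A (W m) - A (W n)))\<^sup>2 < \<delta>"
      proof -
        have "norm (A (W m) - A (W n)) < sqrt \<delta>" using M1 that by simp
        then have "(norm (A (W m) - A (W n)))\<^sup>2 < (sqrt \<delta>)\<^sup>2" by (intro power_strict_mono) auto
        then show ?thesis using \<delta> by simp
      qed
      ultimately have "2 * inverse (real (Suc m)) + 2 * inverse (real (Suc n)) + (norm (A (W m) - A (W n)))\<^sup>2
          < \<epsilon>\<^sup>2 * \<gamma>"
        using \<delta> by (simp add: \<delta>_def)
      then have "(2 * inverse (real (Suc m)) + 2 * inverse (real (Suc n)) + (norm (A (W m) - A (W n)))\<^sup>2) / \<gamma>
          < \<epsilon>\<^sup>2"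
        using \<gamma>0 by (simp add: pos_divide_less_eq)
      then have "(norm (W m - W n))\<^sup>2 < \<epsilon>\<^sup>2" using key[of m n] by linarith
      then show ?thesis using \<epsilon> by (simp add: power_less_imp_less_base)
    qed
    then show "\<exists>M. \<forall>m\<ge>M. \<forall>n\<ge>M. norm (W m - W n) < \<epsilon>" by blast
  qed
  then obtain x where x: "x \<in> Z" "W \<longlonglongrightarrow> x" using Z(2) W(1) by (auto simp: complete_def)
  have nx: "norm x = 1"
    using tendsto_norm[OF x(2)] W(2) by (simp add: LIMSEQ_const_iff)
  have "(\<lambda>n. A (W n)) \<longlonglongrightarrow> A x"
  proof (rule Lim_null[THEN iffD2], rule Lim_null_comparison)
    have "norm (A (W n) - A x) \<le> C * norm (W n - x)" for n
      using C(2)[of "W n - x"] W(1)[of n] x(1) Z(1) compact_on_diff[OF A Z(1), of "W n" x]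
      by (simp add: subspace_diff)
    then show "\<forall>\<^sub>F n in sequentially. norm (A (W n) - A x) \<le> C * norm (W n - x)" by simp
    have "(\<lambda>n. C * norm (W n - x)) \<longlonglongrightarrow> C * norm (x - x)" by (intro tendsto_intros x)
    then show "(\<lambda>n. C * norm (W n - x)) \<longlonglongrightarrow> 0" by simp
  qed
  then have "(\<lambda>n. (norm (A (W n)))\<^sup>2) \<longlonglongrightarrow> (norm (A x))\<^sup>2" by (intro tendsto_intros)
  moreover have "(\<lambda>n. \<gamma> - inverse (real (Suc n))) \<longlonglongrightarrow> \<gamma> - 0"
    by (intro tendsto_intros LIMSEQ_inverse_real_of_nat)
  ultimately have "\<gamma> - 0 \<le> (norm (A x))\<^sup>2"
    by (intro LIMSEQ_le[of "\<lambda>n. \<gamma> - inverse (real (Suc n))"]) (use AW less_imp_le in blast)+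
  then have Ax: "(norm (A x))\<^sup>2 = \<gamma>" using le[OF x(1)] nx by simp
  have "A x \<bullet> A y = \<gamma> * (x \<bullet> y)" if y: "y \<in> Z" for y
  proof -
    have "\<gamma> * (x \<bullet> y) - A x \<bullet> A y = 0"
    proof (rule quadratic_nonneg_linear_zero)
      fix t :: real
      have ty: "t *\<^sub>R y \<in> Z" using y Z by (simp add: subspace_scale)
      have "(norm (A x + t *\<^sub>R A y))\<^sup>2 \<le> \<gamma> * (norm (x + t *\<^sub>R y))\<^sup>2"
        using le[of "x + t *\<^sub>R y"] compact_on_add[OF A x(1) ty] Ascale[OF y] x(1) ty Z
        by (simp add: subspace_add)
      then show "0 \<le> 2 * t * (\<gamma> * (x \<bullet> y) - A x \<bullet> A y) + t\<^sup>2 * (\<gamma> * (norm y)\<^sup>2 - (norm (A y))\<^sup>2)"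
        unfolding power2_norm_add by (simp add: Ax nx power_mult_distrib algebra_simps)
    qed
    then show ?thesis by simp
  qed
  moreover have "x \<noteq> 0" using nx by auto
  ultimately show ?thesis using \<gamma>\<beta> x(1) by blast
qed

text \<open>A violation at x would produce a maximal eigenvector z on the orthogonal complement
  \<open>Z\<close> of the given eigenvectors, with value above \<beta>. Since the form couples the
  given eigenvectors to \<open>Z\<close> by multiples of inner products that vanish, z is an
  eigenvector on all of \<open>H\<close>. By \<open>sp\<close> it then lies in the span to which it
  is orthogonal.\<close>

lemma max_min_bound:
  fixes A :: "'a::real_inner \<Rightarrow> 'b::real_inner"
  assumes H: "subspace H" "complete H" and A: "compact_on H A"
    and I: "finite I" "\<And>k. k \<in> I \<Longrightarrow> g k \<in> H"
    and eig: "\<And>k y. k \<in> I \<Longrightarrow> y \<in> H \<Longrightarrow> A (g k) \<bullet> A y = \<nu> k * (g k \<bullet> y)"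
    and \<beta>: "0 \<le> \<beta>"
    and sp: "\<And>\<gamma> x. \<beta> < \<gamma> \<Longrightarrow> x \<in> H \<Longrightarrow> \<forall>y\<in>H. A x \<bullet> A y = \<gamma> * (x \<bullet> y) \<Longrightarrow> x \<in> span (g ` I)"
    and x: "x \<in> H" "\<And>k. k \<in> I \<Longrightarrow> x \<bullet> g k = 0"
  shows "(norm (A x))\<^sup>2 \<le> \<beta> * (norm x)\<^sup>2"
proof (rule ccontr)
  assume neg: "\<not> ?thesis"
  define Z where "Z = H \<inter> (\<Inter>k\<in>I. {y. y \<bullet> g k = 0})"
  have Zs: "subspace Z"
  proof (rule subspaceI)
    show "0 \<in> Z" using subspace_0[OF H(1)] by (simp add: Z_def)
    show "x + y \<in> Z" if "x \<in> Z" "y \<in> Z" for x y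
      using that subspace_add[OF H(1)] by (simp add: Z_def inner_add_left)
    show "c *\<^sub>R x \<in> Z" if "x \<in> Z" for c x
      using that subspace_scale[OF H(1)] by (simp add: Z_def)
  qed
  have "closed {y. y \<bullet> g k = 0}" for k by (intro closed_Collect_eq continuous_intros)
  then have Zc: "complete Z" unfolding Z_def by (intro complete_Int_closed closed_INT ballI H) auto
  have ZH: "Z \<subseteq> H" by (auto simp: Z_def)
  have "x \<in> Z" using x by (auto simp: Z_def)
  with max_eigenvector[OF Zs Zc compact_on_subset[OF A ZH], of x \<beta>] neg \<beta>
  obtain \<gamma> z where z: "\<gamma> > \<beta>" "z \<in> Z" "z \<noteq> 0" "\<And>y. y \<in> Z \<Longrightarrow> A z \<bullet> A y = \<gamma> * (z \<bullet> y)"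
    by (auto simp: not_le)
  have zH: "z \<in> H" using z ZH by auto
  have spH: "span (g ` I) \<subseteq> H" using I by (intro span_minimal H) auto
  have zs: "z \<bullet> f = 0" if "f \<in> span (g ` I)" for f
    using that by (induction rule: span_induct_alt) (use z(2) in \<open>auto simp: Z_def inner_add_right\<close>)
  have Az: "A z \<bullet> A f = 0" if "f \<in> span (g ` I)" for f
  proof -
    have A0: "A 0 = 0" using compact_on_scaleR[OF A subspace_0[OF H(1)], of 0] by simp
    have gk: "A z \<bullet> A (g k) = 0" if "k \<in> I" for k
      using eig[OF that zH] z(2) that by (simp add: Z_def inner_commute)
    have "f \<in> H \<and> A z \<bullet> A f = 0" using that
    proof (induction rule: span_induct_alt)
      case (step c b y)
      then obtain k where k: "k \<in> I" "b = g k" by auto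
      with step I H(1) gk[OF k(1)] show ?case
        by (simp add: subspace_add subspace_scale compact_on_add[OF A] compact_on_scaleR[OF A] inner_add_right)
    qed (simp add: A0 subspace_0[OF H(1)])
    then show ?thesis ..
  qed
  \<comment> \<open>Split y into its projection f on the span, where both sides vanish, and a
    remainder in \<open>Z\<close>.\<close>
  have "A z \<bullet> A y = \<gamma> * (z \<bullet> y)" if y: "y \<in> H" for y
  proof -
    have c: "complete (span (g ` I))" using I by (intro complete_span_finite) auto
    define f where "f = proj (span (g ` I)) y"
    have f: "f \<in> span (g ` I)" unfolding f_def by (rule proj_in) (auto simp: c)
    then have fH: "f \<in> H" using spH by auto
    have "(y - f) \<bullet> g k = 0" if "k \<in> I" for k
      unfolding f_def by (rule proj_orth) (use c that in \<open>auto intro: span_base\<close>)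
    then have "y - f \<in> Z" using y fH H by (auto simp: Z_def subspace_diff)
    from z(4)[OF this] show ?thesis
      using Az[OF f] zs[OF f] compact_on_diff[OF A H(1) y fH] by (simp add: inner_diff_right)
  qed
  then have "z \<in> span (g ` I)" using sp[OF z(1) zH] by blast
  then show False using zs[of z] z(3) by simp
qed

text \<open>Gaussian elimination: equation j is solved for an unknown p with nonzero coefficient and
  substituted into the others. This is the dimension count behind both min-max arguments
  below.\<close>

lemma exists_nontrivial_solution:
  fixes a :: "'j \<Rightarrow> 'i \<Rightarrow> real"
  assumes "finite J" "finite I" "card J < card I"
  shows "\<exists>c. (\<exists>i\<in>I. c i \<noteq> 0) \<and> (\<forall>j\<in>J. (\<Sum>i\<in>I. c i * a j i) = 0)"
  using assms
proof (induction J arbitrary: I a rule: finite_induct)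
  case empty
  then have "I \<noteq> {}" by auto
  then show ?case by (auto intro!: exI[of _ "\<lambda>_. 1"])
next
  case (insert j J)
  show ?case
  proof (cases "\<forall>i\<in>I. a j i = 0")
    case True
    have "card J < card I" using insert by simp
    from insert.IH[OF insert.prems(1) this, of a] True show ?thesis by auto
  next
    case False
    then obtain p where p: "p \<in> I" "a j p \<noteq> 0" by auto
    have "card J < card (I - {p})" using insert p by simp
    from insert.IH[OF _ this, of "\<lambda>j' i. a j' i - a j i / a j p * a j' p"] insert.prems(1)
    obtain c where c: "\<exists>i\<in>I - {p}. c i \<noteq> 0"
      "\<And>j'. j' \<in> J \<Longrightarrow> (\<Sum>i\<in>I - {p}. c i * (a j' i - a j i / a j p * a j' p)) = 0" by auto
    define s where "s = (\<Sum>i\<in>I - {p}. c i * a j i)"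
    \<comment> \<open>The value at p is the one that makes equation j hold.\<close>
    define c' where "c' = c(p := - s / a j p)"
    have split: "(\<Sum>i\<in>I. c' i * f i) = - s / a j p * f p + (\<Sum>i\<in>I - {p}. c i * f i)" for f
    proof -
      have "(\<Sum>i\<in>I. c' i * f i) = c' p * f p + (\<Sum>i\<in>I - {p}. c' i * f i)"
        using p insert.prems by (simp add: sum.remove)
      also have "(\<Sum>i\<in>I - {p}. c' i * f i) = (\<Sum>i\<in>I - {p}. c i * f i)"
        by (intro sum.cong) (auto simp: c'_def)
      finally show ?thesis by (simp add: c'_def)
    qed
    have "(\<Sum>i\<in>I. c' i * a j i) = 0" using p unfolding split by (simp add: s_def)
    moreover have "(\<Sum>i\<in>I. c' i * a j' i) = 0" if "j' \<in> J" for j'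
    proof -
      have "(\<Sum>i\<in>I - {p}. c i * a j' i) - s / a j p * a j' p = 0"
        using c(2)[OF that] by (simp add: s_def algebra_simps sum_subtractf sum_distrib_left sum_divide_distrib)
      then show ?thesis unfolding split by simp
    qed
    moreover have "\<exists>i\<in>I. c' i \<noteq> 0" using c(1) by (auto simp: c'_def)
    ultimately show ?thesis by (intro exI[of _ c']) auto
  qed
qed

text \<open>Boundedness of \<phi> makes its kernel N complete, so a vector outside N has a component
  n orthogonal to N. Every y differs from a multiple of n by an element of N. It later solves the
  weak Poisson problem.\<close>

lemma riesz_representation:
  fixes \<phi> :: "'a::real_inner \<Rightarrow> real"
  assumes H: "subspace H" "complete H"
    and add: "\<And>x y. x \<in> H \<Longrightarrow> y \<in> H \<Longrightarrow> \<phi> (x + y) = \<phi> x + \<phi> y"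
    and scale: "\<And>c x. x \<in> H \<Longrightarrow> \<phi> (c *\<^sub>R x) = c * \<phi> x"
    and bd: "\<And>x. x \<in> H \<Longrightarrow> \<bar>\<phi> x\<bar> \<le> C * norm x"
  shows "\<exists>z\<in>H. \<forall>y\<in>H. \<phi> y = z \<bullet> y"
proof (cases "\<forall>x\<in>H. \<phi> x = 0")
  case True
  then show ?thesis using subspace_0[OF H(1)] by (intro bexI[of _ 0]) auto
next
  case False
  then obtain x0 where x0: "x0 \<in> H" "\<phi> x0 \<noteq> 0" by auto
  define N where "N = {x \<in> H. \<phi> x = 0}"
  have diff: "\<phi> (x - y) = \<phi> x - \<phi> y" if "x \<in> H" "y \<in> H" for x y
    using add[of x "(-1) *\<^sub>R y"] scale[of y "-1"] that H(1) subspace_neg[OF H(1) that(2)] by simp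
  have \<phi>0: "\<phi> 0 = 0" using scale[OF subspace_0[OF H(1)], of 0] by simp
  have Ns: "subspace N"
    using H(1) by (auto simp: N_def subspace_def add scale \<phi>0)
  have Nc: "complete N"
  proof (rule completeI)
    fix f :: "nat \<Rightarrow> 'a" assume f: "\<forall>n. f n \<in> N" "Cauchy f"
    then obtain l where l: "l \<in> H" "f \<longlonglongrightarrow> l" using H(2) by (auto simp: complete_def N_def)
    have "\<bar>\<phi> l\<bar> \<le> C * norm (l - f n)" for n
      using bd[of "l - f n"] diff[of l "f n"] f(1) l(1) H(1) by (auto simp: N_def subspace_diff)
    moreover have "(\<lambda>n. C * norm (l - f n)) \<longlonglongrightarrow> C * norm (l - l)" by (intro tendsto_intros l)
    ultimately have "\<bar>\<phi> l\<bar> \<le> C * norm (l - l)" by (intro LIMSEQ_le_const) auto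
    then have "\<phi> l = 0" by simp
    then show "\<exists>l\<in>N. f \<longlonglongrightarrow> l" using l by (auto simp: N_def)
  qed
  define n where "n = x0 - proj N x0"
  have pN: "proj N x0 \<in> N" by (rule proj_in[OF Ns Nc])
  have nH: "n \<in> H" using pN x0 H(1) by (simp add: n_def N_def subspace_diff)
  have \<phi>n: "\<phi> n \<noteq> 0" using diff[of x0 "proj N x0"] pN x0 by (auto simp: n_def N_def)
  have n0: "n \<bullet> n \<noteq> 0" using \<phi>n \<phi>0 by auto
  have "\<phi> y = ((\<phi> n / (n \<bullet> n)) *\<^sub>R n) \<bullet> y" if y: "y \<in> H" for y
  proof -
    define v where "v = y - (\<phi> y / \<phi> n) *\<^sub>R n"
    have "v \<in> N" using y nH H(1) diff[of y "(\<phi> y / \<phi> n) *\<^sub>R n"] scale[OF nH] \<phi>n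
      by (simp add: v_def N_def subspace_diff subspace_scale)
    then have "n \<bullet> v = 0" unfolding n_def by (rule proj_orth[OF Ns Nc])
    then have "n \<bullet> y = \<phi> y / \<phi> n * (n \<bullet> n)" by (simp add: v_def inner_diff_right)
    then show ?thesis using n0 \<phi>n by simp
  qed
  moreover have "(\<phi> n / (n \<bullet> n)) *\<^sub>R n \<in> H" using nH H(1) by (simp add: subspace_scale)
  ultimately show ?thesis by blast
qed

text \<open>Coefficients belong to indices and not to vectors, so that g may repeat values.\<close>

lemma span_image_coeffs:
  fixes g :: "'i \<Rightarrow> 'a::real_vector"
  assumes "finite I" "x \<in> span (g ` I)"
  shows "\<exists>c. x = (\<Sum>k\<in>I. c k *\<^sub>R g k)"
  using assms(2)
proof (induction rule: span_induct_alt)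
  case base
  then show ?case by (intro exI[of _ "\<lambda>_. 0"]) simp
next
  case (step a b y)
  then obtain k d where k: "k \<in> I" "b = g k" and y: "y = (\<Sum>k\<in>I. d k *\<^sub>R g k)" by auto
  have "(\<Sum>l\<in>I. (d(k := d k + a)) l *\<^sub>R g l) = (\<Sum>l\<in>I. d l *\<^sub>R g l + (if l = k then a *\<^sub>R b else 0))"
    by (intro sum.cong) (auto simp: k scaleR_add_left)
  also have "\<dots> = a *\<^sub>R b + y" using assms(1) k(1) by (simp add: sum.distrib y)
  finally show ?case by metis
qed

lemma power2_norm_sum:
  fixes v :: "'i \<Rightarrow> 'a::real_inner"
  shows "(norm (\<Sum>k\<in>I. c k *\<^sub>R v k))\<^sup>2 = (\<Sum>k\<in>I. \<Sum>l\<in>I. c k * c l * (v k \<bullet> v l))"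
  unfolding power2_norm_eq_inner inner_sum_left
  by (intro sum.cong refl) (simp add: inner_sum_right sum_distrib_left mult_ac)

lemma sum_in_span_image: "(\<Sum>k\<in>I. c k *\<^sub>R g k) \<in> span (g ` I)"
  by (intro span_sum span_scale span_base) auto

text \<open>Pairing a combination with the part q of \<open>g k\<close> orthogonal to the other
  vectors isolates the coefficient \<open>c k\<close>. It turns convergence on a basis of an
  eigenspace into uniform convergence on the eigenspace.\<close>

lemma coeff_bound:
  fixes g :: "'i \<Rightarrow> 'a::real_inner"
  assumes I: "finite I" and ind: "\<And>c. (\<Sum>k\<in>I. c k *\<^sub>R g k) = 0 \<Longrightarrow> \<forall>k\<in>I. c k = 0"
  shows "\<exists>M. \<forall>c. \<forall>k\<in>I. \<bar>c k\<bar> \<le> M k * norm (\<Sum>k\<in>I. c k *\<^sub>R g k)"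
proof -
  have "\<exists>M. \<forall>c. \<bar>c k\<bar> \<le> M * norm (\<Sum>k\<in>I. c k *\<^sub>R g k)" if k: "k \<in> I" for k
  proof -
    define V where "V = span (g ` (I - {k}))"
    have V: "subspace V" "complete V" unfolding V_def using I by (auto intro: complete_span_finite)
    define q where "q = g k - proj V (g k)"
    have qV: "q \<bullet> y = 0" if "y \<in> V" for y unfolding q_def by (rule proj_orth[OF V that])
    have pV: "proj V (g k) \<in> V" by (rule proj_in[OF V])
    have q0: "q \<noteq> 0"
    proof
      assume "q = 0"
      then have "g k \<in> span (g ` (I - {k}))" using pV by (simp add: q_def V_def)
      then obtain d where d: "g k = (\<Sum>l\<in>I - {k}. d l *\<^sub>R g l)" using span_image_coeffs I by blast
      have "(\<Sum>l\<in>I. (d(k := -1)) l *\<^sub>R g l) = (d(k := -1)) k *\<^sub>R g k + (\<Sum>l\<in>I - {k}. (d(k := -1)) l *\<^sub>R g l)"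
        using I k by (simp only: sum.remove)
      also have "(\<Sum>l\<in>I - {k}. (d(k := -1)) l *\<^sub>R g l) = g k"
        unfolding d by (intro sum.cong) auto
      finally have "(\<Sum>l\<in>I. (d(k := -1)) l *\<^sub>R g l) = 0" by simp
      from ind[OF this] k show False by auto
    qed
    have "\<bar>c k\<bar> \<le> 1 / norm q * norm (\<Sum>k\<in>I. c k *\<^sub>R g k)" for c
    proof -
      let ?x = "\<Sum>k\<in>I. c k *\<^sub>R g k"
      have "?x = c k *\<^sub>R g k + (\<Sum>l\<in>I - {k}. c l *\<^sub>R g l)" using I k by (simp add: sum.remove)
      moreover have "(\<Sum>l\<in>I - {k}. c l *\<^sub>R g l) \<in> V" unfolding V_def by (rule sum_in_span_image)
      ultimately have "q \<bullet> ?x = c k * (q \<bullet> g k)" using qV by (simp add: inner_add_right)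
      also have "q \<bullet> g k = (norm q)\<^sup>2"
      proof -
        have "g k = q + proj V (g k)" by (simp add: q_def)
        then have "q \<bullet> g k = q \<bullet> q + q \<bullet> proj V (g k)" by (metis inner_add_right)
        then show ?thesis using qV[OF pV] by (simp add: power2_norm_eq_inner)
      qed
      finally have "\<bar>c k\<bar> * (norm q)\<^sup>2 \<le> norm q * norm ?x"
        using Cauchy_Schwarz_ineq2[of q ?x] by (simp add: abs_mult)
      then show ?thesis using q0 by (simp add: field_simps power2_eq_square)
    qed
    then show ?thesis by blast
  qed
  then show ?thesis by metis
qed

subsection \<open>Eigenvalues of compact quadratic forms\<close>

text \<open>The weak form of an eigenspace of the adjoint of A composed with A, so that the adjoint
  itself never has to be formed. Zero is not excluded.\<close>

definition eigvec :: "('a::real_inner \<Rightarrow> 'b::real_inner) \<Rightarrow> 'a set \<Rightarrow> real \<Rightarrow> 'a set" where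
  "eigvec A Z \<nu> = {x \<in> Z. \<forall>y\<in>Z. A x \<bullet> A y = \<nu> * (x \<bullet> y)}"

text \<open>Only positive values are listed, so the kernel of A stays outside. The vectors of one
  eigenvalue form a basis of its eigenspace that need not be orthogonal, which is what
  \<open>eigen_enum\<close> delivers.\<close>

definition eigen_system ::
  "('a::real_inner \<Rightarrow> 'b::real_inner) \<Rightarrow> 'a set \<Rightarrow> nat set \<Rightarrow> (nat \<Rightarrow> real) \<Rightarrow> (nat \<Rightarrow> 'a) \<Rightarrow> bool" where
  "eigen_system A Z J \<nu> g \<longleftrightarrow>
     subspace Z \<and> complete Z \<and> compact_on Z A \<and>
     (\<forall>k\<in>J. 0 < \<nu> k \<and> g k \<in> eigvec A Z (\<nu> k)) \<and> (\<forall>j\<in>J. \<forall>k\<in>J. j \<le> k \<longrightarrow> \<nu> k \<le> \<nu> j) \<and>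
     (\<forall>\<mu>>0. finite {k \<in> J. \<nu> k = \<mu>} \<and> eigvec A Z \<mu> \<subseteq> span (g ` {k \<in> J. \<nu> k = \<mu>}) \<and>
        (\<forall>c. (\<Sum>k | k \<in> J \<and> \<nu> k = \<mu>. c k *\<^sub>R g k) = 0 \<longrightarrow> (\<forall>k\<in>J. \<nu> k = \<mu> \<longrightarrow> c k = 0)))"

context
  fixes A :: "'a::real_inner \<Rightarrow> 'b::real_inner" and Z J \<nu> g
  assumes sys: "eigen_system A Z J \<nu> g"
begin

lemma eigen_system_space: "subspace Z" "complete Z" "compact_on Z A"
  using sys by (auto simp: eigen_system_def)

lemma eigen_system_pos: "k \<in> J \<Longrightarrow> 0 < \<nu> k"
  and eigen_system_in: "k \<in> J \<Longrightarrow> g k \<in> Z"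
  and eigen_system_eq: "k \<in> J \<Longrightarrow> y \<in> Z \<Longrightarrow> A (g k) \<bullet> A y = \<nu> k * (g k \<bullet> y)"
  and eigen_system_antimono: "j \<in> J \<Longrightarrow> k \<in> J \<Longrightarrow> j \<le> k \<Longrightarrow> \<nu> k \<le> \<nu> j"
  and eigen_system_span: "0 < \<mu> \<Longrightarrow> eigvec A Z \<mu> \<subseteq> span (g ` {k \<in> J. \<nu> k = \<mu>})"
  and eigen_system_finite: "0 < \<mu> \<Longrightarrow> finite {k \<in> J. \<nu> k = \<mu>}"
  using sys by (auto simp: eigen_system_def eigvec_def)

lemma eigen_system_coeffs:
  assumes "0 < \<mu>" "(\<Sum>k | k \<in> J \<and> \<nu> k = \<mu>. c k *\<^sub>R g k) = 0"
  shows "\<forall>k\<in>J. \<nu> k = \<mu> \<longrightarrow> c k = 0"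
proof -
  have "\<forall>c. (\<Sum>k | k \<in> J \<and> \<nu> k = \<mu>. c k *\<^sub>R g k) = 0 \<longrightarrow> (\<forall>k\<in>J. \<nu> k = \<mu> \<longrightarrow> c k = 0)"
    using sys assms(1) by (simp add: eigen_system_def)
  from this[rule_format, OF assms(2)] show ?thesis by blast
qed

lemma eigen_system_orthogonal:
  assumes "j \<in> J" "k \<in> J" "\<nu> j \<noteq> \<nu> k" shows "g j \<bullet> g k = 0"
proof -
  have "\<nu> j * (g j \<bullet> g k) = \<nu> k * (g j \<bullet> g k)"
    using eigen_system_eq[OF assms(1) eigen_system_in[OF assms(2)]]
      eigen_system_eq[OF assms(2) eigen_system_in[OF assms(1)]] by (simp add: inner_commute)
  then show ?thesis using assms(3) by simp
qed

text \<open>Different eigenvalues give orthogonal vectors, so the part of a vanishing combination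
  that belongs to one eigenvalue is orthogonal to the rest and vanishes by itself.\<close>

lemma eigen_system_independent:
  assumes I: "finite I" "I \<subseteq> J" and 0: "(\<Sum>k\<in>I. c k *\<^sub>R g k) = 0" and k: "k \<in> I"
  shows "c k = 0"
proof -
  define M where "M = {l \<in> J. \<nu> l = \<nu> k}"
  define v where "v = (\<Sum>l\<in>I \<inter> M. c l *\<^sub>R g l)"
  have kJ: "k \<in> J" using k I by auto
  have M: "finite M" unfolding M_def by (rule eigen_system_finite[OF eigen_system_pos[OF kJ]])
  have "(\<Sum>l\<in>I. c l *\<^sub>R g l) = v + (\<Sum>l\<in>I - M. c l *\<^sub>R g l)"
    unfolding v_def by (rule sum.Int_Diff[OF I(1)])
  moreover have "v \<bullet> (\<Sum>l\<in>I - M. c l *\<^sub>R g l) = 0"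
  proof -
    have "g l \<bullet> g l' = 0" if "l \<in> I \<inter> M" "l' \<in> I - M" for l l'
      using that I by (intro eigen_system_orthogonal) (auto simp: M_def)
    then show ?thesis unfolding v_def by (simp add: inner_sum_left inner_sum_right)
  qed
  ultimately have "v \<bullet> v = 0" using 0 by (metis add.right_neutral inner_add_right inner_zero_right)
  then have "v = 0" by simp
  \<comment> \<open>The basis property speaks of all indices M of the eigenvalue, of which I may
    contain only some; the missing coefficients are set to zero.\<close>
  moreover have "(\<Sum>l\<in>M. (if l \<in> I then c l else 0) *\<^sub>R g l) = v"
  proof -
    have "(\<Sum>l\<in>M. (if l \<in> I then c l else 0) *\<^sub>R g l) = (\<Sum>l\<in>M. if l \<in> I then c l *\<^sub>R g l else 0)"
      by (intro sum.cong) auto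
    also have "\<dots> = (\<Sum>l\<in>M \<inter> I. c l *\<^sub>R g l)" by (rule sum.inter_restrict[OF M, symmetric])
    also have "\<dots> = v" by (simp only: v_def Int_commute)
    finally show ?thesis .
  qed
  ultimately have "(\<Sum>l | l \<in> J \<and> \<nu> l = \<nu> k. (if l \<in> I then c l else 0) *\<^sub>R g l) = 0"
    by (simp add: M_def)
  from eigen_system_coeffs[OF eigen_system_pos[OF kJ] this]
  have "\<forall>l\<in>J. \<nu> l = \<nu> k \<longrightarrow> (if l \<in> I then c l else 0) = 0" .
  from this[rule_format, OF kJ] k show ?thesis by simp
qed

text \<open>The vectors need not be orthogonal within an eigenvalue, so the difference of the two
  sides is not a weighted sum of squares. It is the squared norm of the combination with
  coefficients \<open>c k * sqrt (\<nu> k - \<gamma>)\<close>: for equal eigenvalues the two roots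
  multiply to \<nu> k - \<gamma>, and for different ones the inner product vanishes.\<close>

lemma eigen_system_lower_bound:
  assumes I: "finite I" "I \<subseteq> J" and \<gamma>: "\<And>k. k \<in> I \<Longrightarrow> \<gamma> \<le> \<nu> k" and x: "x \<in> span (g ` I)"
  shows "\<gamma> * (norm x)\<^sup>2 \<le> (norm (A x))\<^sup>2"
proof -
  obtain c where xc: "x = (\<Sum>k\<in>I. c k *\<^sub>R g k)" using span_image_coeffs[OF I(1) x] by blast
  have gZ: "g k \<in> Z" if "k \<in> I" for k using that I by (auto intro: eigen_system_in)
  have Ax: "A x = (\<Sum>k\<in>I. c k *\<^sub>R A (g k))"
    unfolding xc by (rule compact_on_sum[OF eigen_system_space(3,1) gZ])
  have "(norm (A x))\<^sup>2 - \<gamma> * (norm x)\<^sup>2 = (\<Sum>k\<in>I. \<Sum>l\<in>I. c k * c l * (A (g k) \<bullet> A (g l) - \<gamma> * (g k \<bullet> g l)))"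
    unfolding Ax unfolding xc power2_norm_sum
    by (simp add: sum_distrib_left sum_subtractf[symmetric] algebra_simps)
  also have "\<dots> = (\<Sum>k\<in>I. \<Sum>l\<in>I. c k * c l * (sqrt (\<nu> k - \<gamma>) * sqrt (\<nu> l - \<gamma>) * (g k \<bullet> g l)))"
  proof (intro sum.cong refl arg_cong[of _ _ "times _"])
    fix k l assume kl: "k \<in> I" "l \<in> I"
    have e: "A (g k) \<bullet> A (g l) - \<gamma> * (g k \<bullet> g l) = (\<nu> k - \<gamma>) * (g k \<bullet> g l)"
      using eigen_system_eq[of k "g l"] kl I gZ by (simp add: subset_iff left_diff_distrib)
    show "A (g k) \<bullet> A (g l) - \<gamma> * (g k \<bullet> g l) = sqrt (\<nu> k - \<gamma>) * sqrt (\<nu> l - \<gamma>) * (g k \<bullet> g l)"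
    proof (cases "\<nu> k = \<nu> l")
      case True
      then show ?thesis using \<gamma>[OF kl(1)] unfolding e by simp
    next
      case False
      then show ?thesis unfolding e using eigen_system_orthogonal[of k l] kl I by auto
    qed
  qed
  also have "\<dots> = (norm (\<Sum>k\<in>I. (c k * sqrt (\<nu> k - \<gamma>)) *\<^sub>R g k))\<^sup>2"
    unfolding power2_norm_sum by (simp add: mult_ac)
  also have "\<dots> \<ge> 0" by simp
  finally show ?thesis by simp
qed

text \<open>An eigenvalue above \<beta> has all its indices in I, so its eigenvectors lie in the
  span to which x is orthogonal.\<close>

lemma eigen_system_upper_bound:
  assumes I: "finite I" "I \<subseteq> J" and \<beta>: "0 \<le> \<beta>" "\<And>k. k \<in> J - I \<Longrightarrow> \<nu> k \<le> \<beta>"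
    and x: "x \<in> Z" "\<And>k. k \<in> I \<Longrightarrow> x \<bullet> g k = 0"
  shows "(norm (A x))\<^sup>2 \<le> \<beta> * (norm x)\<^sup>2"
proof (rule max_min_bound[OF eigen_system_space I(1) _ _ \<beta>(1) _ x])
  show "g k \<in> Z" if "k \<in> I" for k using that I by (auto intro: eigen_system_in)
  show "A (g k) \<bullet> A y = \<nu> k * (g k \<bullet> y)" if "k \<in> I" "y \<in> Z" for k y
    using that I by (auto intro: eigen_system_eq)
  fix \<gamma> x assume \<gamma>: "\<beta> < \<gamma>" and x: "x \<in> Z" "\<forall>y\<in>Z. A x \<bullet> A y = \<gamma> * (x \<bullet> y)"
  then have "x \<in> span (g ` {k \<in> J. \<nu> k = \<gamma>})"
    using eigen_system_span[of \<gamma>] \<beta>(1) by (auto simp: eigvec_def)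
  moreover have "{k \<in> J. \<nu> k = \<gamma>} \<subseteq> I" using \<beta>(2) \<gamma> by force
  ultimately show "x \<in> span (g ` I)" using span_mono[OF image_mono] by blast
qed

end

subsection \<open>The discrete problem\<close>

text \<open>In the application \<open>H\<close> consists of the gradients of the elements of \<open>H10\<close>, \<open>L\<close> recovers \<open>u\<close>
  from its gradient, and \<open>div_graph H L\<close> consists of the pairs of a field and its weak divergence.\<close>
definition div_graph :: "'b set \<Rightarrow> ('b \<Rightarrow> 'a) \<Rightarrow> ('b::real_inner \<times> 'a::real_inner) set" where
  "div_graph H L = {t. \<forall>g\<in>H. fst t \<bullet> g = - (snd t \<bullet> L g)}"

text \<open>The map K of the overview. The product norm on pairs of a field and its divergence is
  the graph norm of H(div), so the least squares structure is an orthogonal projection.\<close>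

definition flux :: "('b::real_inner \<times> 'a::real_inner) set \<Rightarrow> 'b \<Rightarrow> 'b \<times> 'a" where
  "flux S x = proj S (x, 0)"

lemma compact_on_finite_range:
  fixes A :: "'a::real_inner \<Rightarrow> 'b::real_inner"
  assumes "linear A" "\<And>x. norm (A x) \<le> C * norm x" "finite B" "\<And>x. A x \<in> span B"
  shows "compact_on Z A"
  unfolding compact_on_def
proof (intro conjI ballI allI impI)
  show "A (x + y) = A x + A y" "A (c *\<^sub>R x) = c *\<^sub>R A x" for x y c
    using assms(1) by (auto simp: linear_add linear_scale)
  show "\<exists>C. \<forall>x\<in>Z. norm (A x) \<le> C * norm x" using assms(2) by auto
  fix X :: "nat \<Rightarrow> 'a" assume "(\<forall>n. X n \<in> Z) \<and> bounded (range X)"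
  then obtain M where M: "\<And>n. norm (X n) \<le> M" by (auto simp: bounded_iff)
  have "norm (A (X n)) \<le> \<bar>C\<bar> * M" for n
  proof -
    have "norm (A (X n)) \<le> C * norm (X n)" by (rule assms)
    also have "\<dots> \<le> \<bar>C\<bar> * norm (X n)" by (intro mult_right_mono) auto
    also have "\<dots> \<le> \<bar>C\<bar> * M" using M by (intro mult_left_mono) auto
    finally show ?thesis .
  qed
  then have "bounded (range (\<lambda>n. A (X n)))" by (auto simp: bounded_iff)
  from bounded_seq_subseq_span[OF assms(3) _ this] assms(4)
  show "\<exists>r l. strict_mono r \<and> (\<lambda>n. A (X (r n))) \<longlonglongrightarrow> l" by (force simp: o_def)
qed

locale ls_discretization =
  fixes H :: "'b::real_inner set" and L :: "'b \<Rightarrow> 'a::real_inner"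
    and S :: "('b \<times> 'a) set" and U :: "'b set"
  assumes L: "compact_on H L"
    and S: "\<exists>B. finite B \<and> S = span B" "S \<subseteq> div_graph H L"
    and U: "\<exists>B. finite B \<and> U = span B" "U \<subseteq> H"
begin

lemma S_space: "subspace S" "complete S" and U_space: "subspace U" "complete U"
  using S U complete_span_finite subspace_span by blast+

lemma flux_in: "flux S x \<in> S"
  unfolding flux_def by (rule proj_in[OF S_space])

lemma flux_inner: "t \<in> S \<Longrightarrow> flux S x \<bullet> t = x \<bullet> fst t"
  unfolding flux_def by (subst proj_inner[OF S_space]) (auto simp: inner_prod_def)

lemma linear_flux: "linear (flux S)"
proof (rule linearI)
  show "flux S (x + y) = flux S x + flux S y" for x y
    unfolding flux_def using proj_add[OF S_space, of "(x, 0)" "(y, 0)"] by simp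
  show "flux S (c *\<^sub>R x) = c *\<^sub>R flux S x" for c x
    unfolding flux_def using proj_scaleR[OF S_space, of c "(x, 0)"] by simp
qed

lemma norm_flux_le: "norm (flux S x) \<le> norm x"
  unfolding flux_def using norm_proj_le[OF S_space, of "(x, 0)"] by (simp add: norm_Pair)

lemma compact_on_flux: "compact_on U (flux S)"
  using compact_on_finite_range[OF linear_flux, of 1] norm_flux_le flux_in S(1) by force

text \<open>The pairing of \<open>x\<close> with a flux is split with weights \<open>\<theta>\<close> and \<open>1 - \<theta>\<close> before and after
  integration by parts; \<open>\<theta> = 1 / (1 + l)\<close> is optimal.\<close>
lemma norm_flux_bound:
  assumes x: "x \<in> H" and l: "0 < l" "(norm (L x))\<^sup>2 \<le> (1 / l) * (norm x)\<^sup>2"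
  shows "(norm (flux S x))\<^sup>2 \<le> 1 / (1 + l) * (norm x)\<^sup>2"
proof -
  define \<theta> where "\<theta> = 1 / (1 + l)"
  define k where "k = flux S x"
  define y where "y = (\<theta> *\<^sub>R x, (\<theta> - 1) *\<^sub>R L x)"
  have "fst k \<bullet> x = - (snd k \<bullet> L x)"
    using flux_in[of x] S(2) x by (auto simp: div_graph_def k_def)
  then have "k \<bullet> y = fst k \<bullet> x" by (simp add: y_def inner_prod_def algebra_simps)
  also have "\<dots> = (norm k)\<^sup>2"
    using flux_inner[OF flux_in, of x x] by (simp add: k_def power2_norm_eq_inner inner_commute)
  finally have ky: "(norm k)\<^sup>2 \<le> norm k * norm y" using norm_cauchy_schwarz[of k y] by simp
  have "norm k \<le> norm y"
  proof (cases "k = 0")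
    case False
    then show ?thesis using ky by (simp add: power2_eq_square)
  qed simp
  then have "(norm k)\<^sup>2 \<le> (norm y)\<^sup>2" by (simp add: power_mono)
  also have "\<dots> = \<theta>\<^sup>2 * (norm x)\<^sup>2 + (1 - \<theta>)\<^sup>2 * (norm (L x))\<^sup>2"
    by (simp add: y_def norm_Pair power_mult_distrib power2_commute[of \<theta>])
  also have "\<dots> \<le> \<theta>\<^sup>2 * (norm x)\<^sup>2 + (1 - \<theta>)\<^sup>2 * ((1 / l) * (norm x)\<^sup>2)"
    using l by (intro add_left_mono mult_left_mono) auto
  also have "\<dots> = (\<theta>\<^sup>2 + (1 - \<theta>)\<^sup>2 / l) * (norm x)\<^sup>2" by (simp add: algebra_simps)
  also have "\<theta>\<^sup>2 + (1 - \<theta>)\<^sup>2 / l = \<theta>"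
  proof -
    have "1 - \<theta> = l * \<theta>" using l by (simp add: \<theta>_def field_simps)
    then have "\<theta>\<^sup>2 + (1 - \<theta>)\<^sup>2 / l = \<theta>\<^sup>2 + (l * \<theta>)\<^sup>2 / l" by simp
    also have "\<dots> = \<theta> * (\<theta> + l * \<theta>)" using l by (simp add: power2_eq_square distrib_left)
    also have "\<theta> + l * \<theta> = 1" using \<open>1 - \<theta> = l * \<theta>\<close> by simp
    finally show ?thesis by simp
  qed
  finally show ?thesis by (simp add: k_def \<theta>_def)
qed

lemma flux_eigenvalue_less_one:
  assumes x: "x \<in> eigvec (flux S) U \<gamma>" "x \<noteq> 0" shows "\<gamma> < 1"
proof -
  have xU: "x \<in> U" and e: "(norm (flux S x))\<^sup>2 = \<gamma> * (norm x)\<^sup>2"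
    using x by (auto simp: eigvec_def power2_norm_eq_inner)
  obtain C where C: "0 < C" "\<And>x. x \<in> H \<Longrightarrow> norm (L x) \<le> C * norm x"
    using compact_on_bound[OF L] by blast
  have xH: "x \<in> H" using xU U by auto
  have "(norm (L x))\<^sup>2 \<le> (C * norm x)\<^sup>2" using C(2)[OF xH] by (simp add: power_mono)
  also have "\<dots> = (1 / (1 / C\<^sup>2)) * (norm x)\<^sup>2" by (simp add: power_mult_distrib)
  finally have "(norm (flux S x))\<^sup>2 \<le> 1 / (1 + 1 / C\<^sup>2) * (norm x)\<^sup>2"
    using C(1) by (intro norm_flux_bound[OF xH]) auto
  then have "\<gamma> * (norm x)\<^sup>2 \<le> 1 / (1 + 1 / C\<^sup>2) * (norm x)\<^sup>2" unfolding e .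
  then have "\<gamma> \<le> 1 / (1 + 1 / C\<^sup>2)" by (rule mult_right_le_imp_le) (use x(2) in simp)
  also have "\<dots> < 1" using C(1) by (simp add: divide_less_eq add_pos_pos)
  finally show ?thesis .
qed

end

section \<open>Comparison of one discrete problem with the continuous one\<close>

locale ls_eigenproblem = ls_discretization H L S U
  for H :: "'b::real_inner set" and L :: "'b \<Rightarrow> 'a::real_inner" and S U +
  fixes lam :: "nat \<Rightarrow> real" and g :: "nat \<Rightarrow> 'b"
    and N :: nat and lamh :: "nat \<Rightarrow> real" and w :: "nat \<Rightarrow> 'b"
  assumes cont: "eigen_system L H {1..} (\<lambda>k. 1 / lam k) g"
    and disc: "eigen_system (flux S) U {1..N} (\<lambda>k. 1 / (1 + lamh k)) w"
begin

lemmas H_space = eigen_system_space(1,2)[OF cont]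

lemma lam_pos: "1 \<le> k \<Longrightarrow> 0 < lam k"
  using eigen_system_pos[OF cont, of k] by simp

lemma lam_mono: "1 \<le> j \<Longrightarrow> j \<le> k \<Longrightarrow> lam j \<le> lam k"
  using eigen_system_antimono[OF cont, of j k] lam_pos[of j] lam_pos[of k] by (simp add: field_simps)

text \<open>Some nonzero combination of the first j discrete eigenvectors is orthogonal to the first
  j - 1 continuous ones. There the Rayleigh quotient of L is at most 1 / lam j, and
  \<open>norm_flux_bound\<close> transfers this to the flux. In terms of eigenvalues:
  \<open>lam j \<le> lamh j\<close>.\<close>

lemma discrete_le_continuous:
  assumes j: "j \<in> {1..N}"
  shows "1 / (1 + lamh j) \<le> 1 / (1 + lam j)"
proof -
  have "\<exists>c. (\<exists>k\<in>{1..j}. c k \<noteq> 0) \<and> (\<forall>n\<in>{1..<j}. (\<Sum>k\<in>{1..j}. c k * (w k \<bullet> g n)) = 0)"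
    by (rule exists_nontrivial_solution) (use j in auto)
  then obtain c k where k: "k \<in> {1..j}" "c k \<noteq> 0"
    and c: "\<And>n. n \<in> {1..<j} \<Longrightarrow> (\<Sum>k\<in>{1..j}. c k * (w k \<bullet> g n)) = 0" by blast
  define x where "x = (\<Sum>k\<in>{1..j}. c k *\<^sub>R w k)"
  have jN: "{1..j} \<subseteq> {1..N}" using j by auto
  have x0: "x \<noteq> 0"
    using eigen_system_independent[OF disc _ jN, of c k] k by (auto simp: x_def)
  have "x \<in> span (w ` {1..j})" unfolding x_def by (rule sum_in_span_image)
  then have "1 / (1 + lamh j) * (norm x)\<^sup>2 \<le> (norm (flux S x))\<^sup>2"
    using eigen_system_antimono[OF disc, of _ j] j
    by (intro eigen_system_lower_bound[OF disc _ jN]) auto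
  also have "\<dots> \<le> 1 / (1 + lam j) * (norm x)\<^sup>2"
  proof (rule norm_flux_bound)
    have "x \<in> U" unfolding x_def
      using eigen_system_in[OF disc] jN by (intro subspace_sum subspace_scale U_space) auto
    then show xH: "x \<in> H" using U by auto
    show "0 < lam j" using j by (simp add: lam_pos)
    show "(norm (L x))\<^sup>2 \<le> 1 / lam j * (norm x)\<^sup>2"
    proof (rule eigen_system_upper_bound[OF cont _ _ _ _ xH, of "{1..<j}"])
      show "1 / lam k \<le> 1 / lam j" if "k \<in> {1..} - {1..<j}" for k
        using that j by (intro eigen_system_antimono[OF cont]) auto
      show "x \<bullet> g n = 0" if "n \<in> {1..<j}" for n
        using c[OF that] by (simp add: x_def inner_sum_left)
      show "0 \<le> 1 / lam j" using lam_pos[of j] j by simp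
    qed auto
  qed
  finally show ?thesis by (rule mult_right_le_imp_le) (use x0 in simp)
qed

lemma cluster_bound:
  assumes cl: "{k. 1 \<le> k \<and> lam k = ev} = {i..<i + m}" "1 \<le> i" "1 \<le> m"
    and gap: "0 < \<delta>" "i \<le> N + 1" "\<And>k. 1 \<le> k \<Longrightarrow> k < i \<Longrightarrow> 1 / (1 + ev) + \<delta> \<le> 1 / (1 + lamh k)"
    and err: "0 \<le> e" "\<And>x. x \<in> eigvec L H (1 / ev) \<Longrightarrow> infdist x U \<le> e * norm x"
      "\<And>x. x \<in> eigvec L H (1 / ev) \<Longrightarrow> infdist (x, - ev *\<^sub>R L x) S \<le> e * norm x"
    and \<beta>: "0 \<le> \<beta>" "\<And>k. i + m - 1 \<le> k \<Longrightarrow> k \<le> N \<Longrightarrow> 1 / (1 + lamh k) \<le> \<beta>"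
  shows "1 / (1 + ev) - \<beta> \<le> (5 + 4 / \<delta>\<^sup>2) * e\<^sup>2"
proof -
  define \<nu>0 where "\<nu>0 = 1 / (1 + ev)"
  have lami: "lam k = ev" if "k \<in> {i..<i + m}" for k using that cl(1) by blast
  have evi: "lam i = ev" using lami[of i] cl by simp
  have ev: "0 < ev" using lam_pos[of i] cl evi by simp
  have \<nu>0: "0 < \<nu>0" "\<nu>0 \<le> 1" using ev by (auto simp: \<nu>0_def)
  \<comment> \<open>All positions of the cluster except the last, as far as they exist: at most m -
    1 orthogonality conditions on m coefficients.\<close>
  define P where "P = {i..<min (i + m - 1) (N + 1)}"
  have "\<exists>c. (\<exists>k\<in>{i..<i + m}. c k \<noteq> 0) \<and> (\<forall>n\<in>P. (\<Sum>k\<in>{i..<i + m}. c k * (g k \<bullet> w n)) = 0)"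
    by (rule exists_nontrivial_solution) (use cl in \<open>auto simp: P_def\<close>)
  then obtain c k where k: "k \<in> {i..<i + m}" "c k \<noteq> 0"
    and c: "\<And>n. n \<in> P \<Longrightarrow> (\<Sum>k\<in>{i..<i + m}. c k * (g k \<bullet> w n)) = 0" by blast
  define x' where "x' = (\<Sum>k\<in>{i..<i + m}. c k *\<^sub>R g k)"
  define x where "x = (1 / norm x') *\<^sub>R x'"
  have "x' \<noteq> 0"
    using eigen_system_independent[OF cont, of "{i..<i + m}" c k] k cl by (auto simp: x'_def)
  then have nx: "norm x = 1" by (simp add: x_def)
  have xw: "x \<bullet> w n = 0" if "n \<in> P" for n
    using c[OF that] by (simp add: x_def x'_def inner_sum_left)
  have gE: "g k \<in> H \<and> (\<forall>y\<in>H. L (g k) \<bullet> L y = 1 / ev * (g k \<bullet> y))" if "k \<in> {i..<i + m}" for k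
    using eigen_system_in[OF cont, of k] eigen_system_eq[OF cont, of k] that cl lami[OF that] by auto
  have x'H: "x' \<in> H" unfolding x'_def using gE by (intro subspace_sum subspace_scale H_space) auto
  have xH: "x \<in> H" unfolding x_def by (intro subspace_scale H_space x'H)
  have Lx: "L x \<bullet> L y = 1 / ev * (x \<bullet> y)" if y: "y \<in> H" for y
  proof -
    have "L x' = (\<Sum>k\<in>{i..<i + m}. c k *\<^sub>R L (g k))" unfolding x'_def
      by (rule compact_on_sum[OF L H_space(1)]) (use gE in auto)
    then have "L x' \<bullet> L y = (\<Sum>k\<in>{i..<i + m}. c k * (1 / ev * (g k \<bullet> y)))"
      using gE y by (simp add: inner_sum_left)
    also have "\<dots> = 1 / ev * (x' \<bullet> y)" by (simp add: x'_def inner_sum_left sum_distrib_left mult_ac)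
    finally show ?thesis unfolding x_def by (simp add: compact_on_scaleR[OF L x'H])
  qed
  have xE: "x \<in> eigvec L H (1 / ev)" using xH Lx by (auto simp: eigvec_def)
  \<comment> \<open>The exact flux with its divergence, its best discrete approximation \<tau> and
    the error \<rho>.\<close>
  define \<xi> where "\<xi> = (x, - ev *\<^sub>R L x)"
  define \<tau> where "\<tau> = proj S \<xi>"
  define \<rho> where "\<rho> = \<xi> - \<tau>"
  define p where "p = proj U x"
  define d where "d = x - p"
  have nd: "norm d \<le> e" using err(2)[OF xE] nx proj_infdist[OF U_space, of x] by (simp add: d_def p_def)
  have n\<rho>: "norm \<rho> \<le> e" using err(3)[OF xE] nx proj_infdist[OF S_space, of \<xi>] by (simp add: \<rho>_def \<tau>_def \<xi>_def)
  have pU: "p \<in> U" unfolding p_def by (rule proj_in[OF U_space])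
  have px: "p \<bullet> y = x \<bullet> y" if "y \<in> U" for y unfolding p_def by (rule proj_inner[OF U_space that])
  have \<tau>S: "\<tau> \<in> S" unfolding \<tau>_def by (rule proj_in[OF S_space])
  have f\<rho>: "fst \<tau> = x - fst \<rho>" by (simp add: \<rho>_def \<xi>_def)
  have nf\<rho>: "norm (fst \<rho>) \<le> e" using norm_fst_le[of "fst \<rho>" "snd \<rho>"] n\<rho> by simp
  have nK: "norm (flux S v) \<le> norm v" for v by (rule norm_flux_le)
  \<comment> \<open>On S integration by parts turns the pairing with \<xi> into 1 + ev times the
    pairing with (x, 0), so both have the same projection up to this factor.\<close>
  have Kx: "flux S x = \<nu>0 *\<^sub>R \<tau>"
    unfolding flux_def
  proof (rule proj_unique[OF S_space])
    show "\<nu>0 *\<^sub>R \<tau> \<in> S" using \<tau>S S_space by (simp add: subspace_scale)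
    fix t assume t: "t \<in> S"
    have "snd t \<bullet> L x = - (fst t \<bullet> x)" using t S(2) xH by (auto simp: div_graph_def)
    then have "\<xi> \<bullet> t = (1 + ev) * (x \<bullet> fst t)"
      by (simp add: \<xi>_def inner_prod_def inner_commute algebra_simps)
    then have "\<tau> \<bullet> t = (1 + ev) * (x \<bullet> fst t)" unfolding \<tau>_def by (simp add: proj_inner[OF S_space t])
    then have "\<nu>0 * (\<tau> \<bullet> t) = x \<bullet> fst t" using ev by (simp add: \<nu>0_def)
    also have "\<dots> = (x, 0) \<bullet> t" by (simp add: inner_prod_def)
    finally show "\<nu>0 *\<^sub>R \<tau> \<bullet> t = (x, 0) \<bullet> t" by simp
  qed
  have n\<tau>: "(norm \<tau>)\<^sup>2 = 1 / \<nu>0 - (norm \<rho>)\<^sup>2"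
  proof -
    have "(norm (L x))\<^sup>2 = 1 / ev" using Lx[OF xH] nx by (simp add: power2_norm_eq_inner[symmetric])
    moreover have "(norm \<xi>)\<^sup>2 = 1 + ev\<^sup>2 * (norm (L x))\<^sup>2"
      using nx by (simp add: \<xi>_def norm_Pair power_mult_distrib)
    ultimately have "(norm \<xi>)\<^sup>2 = 1 + ev" by (simp add: power2_eq_square)
    then show ?thesis using proj_norm2[OF S_space, of \<xi>] by (simp add: \<tau>_def \<rho>_def \<nu>0_def)
  qed
  have Kp: "flux S p = flux S x - flux S d"
    using linear_diff[OF linear_flux, of x d] by (simp add: d_def)
  have np: "norm p \<le> 1" unfolding p_def using norm_proj_le[OF U_space, of x] nx by simp
  have fd: "\<bar>fst \<rho> \<bullet> v\<bar> \<le> e * norm v" for v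
    by (rule order_trans[OF Cauchy_Schwarz_ineq2 mult_right_mono[OF nf\<rho> norm_ge_zero]])
  have Kd: "\<bar>flux S d \<bullet> flux S v\<bar> \<le> e * norm v" for v
  proof -
    have "\<bar>flux S d \<bullet> flux S v\<bar> \<le> norm (flux S d) * norm (flux S v)" by (rule Cauchy_Schwarz_ineq2)
    also have "\<dots> \<le> e * norm v" using nK[of d] nK[of v] nd err(1) by (intro mult_mono) auto
    finally show ?thesis .
  qed
  have Kxv: "flux S x \<bullet> flux S v = \<nu>0 * (x \<bullet> v - fst \<rho> \<bullet> v)" for v
    using flux_inner[OF \<tau>S, of v] unfolding Kx f\<rho> by (simp add: inner_commute inner_diff_right)
  have quad: "\<nu>0 - 5 * e\<^sup>2 \<le> (norm (flux S p))\<^sup>2"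
  proof -
    have "p \<bullet> d = 0" using px[OF pU] by (simp add: d_def inner_diff_right inner_commute)
    then have "x \<bullet> d = (norm d)\<^sup>2" by (simp add: d_def power2_norm_eq_inner inner_diff_left)
    moreover have "(norm d)\<^sup>2 \<le> e\<^sup>2" using nd by (simp add: power_mono)
    ultimately have "x \<bullet> d - fst \<rho> \<bullet> d \<le> e\<^sup>2 + e * e"
      using fd[of d] mult_left_mono[OF nd err(1)] by linarith
    then have "flux S x \<bullet> flux S d \<le> \<nu>0 * (e\<^sup>2 + e * e)"
      unfolding Kxv using \<nu>0 by (intro mult_left_mono) auto
    also have "\<dots> \<le> 1 * (e\<^sup>2 + e * e)" using \<nu>0 err(1) by (intro mult_right_mono) auto
    finally have 1: "flux S x \<bullet> flux S d \<le> 2 * e\<^sup>2" by (simp add: power2_eq_square)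
    have "(norm (flux S x))\<^sup>2 = \<nu>0\<^sup>2 * (1 / \<nu>0 - (norm \<rho>)\<^sup>2)" unfolding Kx by (simp add: power_mult_distrib n\<tau>)
    also have "\<dots> = \<nu>0 - \<nu>0\<^sup>2 * (norm \<rho>)\<^sup>2" using \<nu>0 by (simp add: power2_eq_square algebra_simps)
    also have "\<dots> \<ge> \<nu>0 - 1 * e\<^sup>2"
      using \<nu>0 n\<rho> by (intro diff_left_mono mult_mono) (auto simp: power_le_one power_mono)
    finally have 2: "(norm (flux S x))\<^sup>2 \<ge> \<nu>0 - e\<^sup>2" by simp
    have "(norm (flux S p))\<^sup>2 = (norm (flux S x))\<^sup>2 - 2 * (flux S x \<bullet> flux S d) + (norm (flux S d))\<^sup>2"
      unfolding Kp by (rule power2_norm_diff)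
    then show ?thesis using 1 2 zero_le_power2[of "norm (flux S d)"] by linarith
  qed
  \<comment> \<open>As an approximate discrete eigenvector, p has a residual of first order only;
    this suffices since f enters squared.\<close>
  have resid: "flux S p \<bullet> flux S f - \<nu>0 * (p \<bullet> f) \<le> 2 * e * norm f" if f: "f \<in> U" for f
  proof -
    have "flux S p \<bullet> flux S f - \<nu>0 * (p \<bullet> f) = - (\<nu>0 * (fst \<rho> \<bullet> f)) - flux S d \<bullet> flux S f"
      unfolding Kp inner_diff_left Kxv px[OF f] by (simp add: algebra_simps)
    moreover have "- (\<nu>0 * (fst \<rho> \<bullet> f)) \<le> 1 * (e * norm f)"
    proof -
      have "- (\<nu>0 * (fst \<rho> \<bullet> f)) \<le> \<nu>0 * \<bar>fst \<rho> \<bullet> f\<bar>" using \<nu>0 by (simp add: abs_if mult_le_0_iff zero_le_mult_iff)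
      also have "\<dots> \<le> 1 * (e * norm f)" using \<nu>0 fd[of f] by (intro mult_mono) auto
      finally show ?thesis .
    qed
    ultimately show ?thesis using Kd[of f] by linarith
  qed
  define F where "F = span (w ` {1..<i})"
  have iN: "{1..<i} \<subseteq> {1..N}" using gap(2) by auto
  have FU: "F \<subseteq> U" unfolding F_def using iN eigen_system_in[OF disc]
    by (intro span_minimal U_space) auto
  have F: "subspace F" "complete F" unfolding F_def by (auto intro: complete_span_finite)
  define f where "f = proj F p"
  define z where "z = p - f"
  have fF: "f \<in> F" unfolding f_def by (rule proj_in[OF F])
  have fU: "f \<in> U" using fF FU by auto
  have Fc: "\<exists>b. y = (\<Sum>k\<in>{1..<i}. b k *\<^sub>R w k)" if "y \<in> F" for y
    by (rule span_image_coeffs) (use that in \<open>simp_all only: F_def finite_atLeastLessThan\<close>)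
  have zU: "z \<in> U" unfolding z_def by (intro subspace_diff U_space pU fU)
  have zF: "z \<bullet> y = 0" if "y \<in> F" for y unfolding z_def f_def by (rule proj_orth[OF F that])
  have Kz: "flux S z \<bullet> flux S y = 0" if y: "y \<in> F" for y
  proof -
    obtain b where b: "y = (\<Sum>k\<in>{1..<i}. b k *\<^sub>R w k)" using Fc[OF y] by blast
    have "flux S z \<bullet> flux S (w k) = 0" if k: "k \<in> {1..<i}" for k
    proof -
      have "w k \<in> F" unfolding F_def using k by (intro span_base) auto
      then show ?thesis using eigen_system_eq[OF disc _ zU, of k] zF[of "w k"] k iN
        by (auto simp: inner_commute)
    qed
    then show ?thesis unfolding b
      by (simp add: linear_sum[OF linear_flux] linear_scale[OF linear_flux] inner_sum_right)
  qed
  have pfz: "p = f + z" by (simp add: z_def)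
  have Kpfz: "flux S p = flux S f + flux S z" unfolding pfz by (rule linear_add[OF linear_flux])
  \<comment> \<open>Test the residual with f itself: on F the quotient exceeds \<nu>0 by at least
    \<delta>, while p and f pair like f with itself in both forms.\<close>
  have nf: "norm f \<le> 2 * e / \<delta>"
  proof -
    have "(\<nu>0 + \<delta>) * (norm f)\<^sup>2 \<le> (norm (flux S f))\<^sup>2"
      using gap(3) fF by (intro eigen_system_lower_bound[OF disc _ iN]) (auto simp: \<nu>0_def F_def)
    moreover have "flux S p \<bullet> flux S f = (norm (flux S f))\<^sup>2"
      unfolding Kpfz inner_add_left using Kz[OF fF] by (simp add: power2_norm_eq_inner)
    moreover have "p \<bullet> f = (norm f)\<^sup>2"
      using zF[OF fF] by (simp add: z_def inner_diff_left power2_norm_eq_inner)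
    ultimately have "\<delta> * (norm f)\<^sup>2 \<le> 2 * e * norm f" using resid[OF fU] by (simp add: algebra_simps)
    then show ?thesis using gap(1) err(1) by (cases "f = 0") (auto simp: power2_eq_square field_simps)
  qed
  \<comment> \<open>z is orthogonal to every discrete eigenvector before position i + m - 1: below i
    because f was removed, from i on by the choice of x.\<close>
  have zb: "(norm (flux S z))\<^sup>2 \<le> \<beta> * (norm z)\<^sup>2"
  proof (rule eigen_system_upper_bound[OF disc _ _ \<beta>(1) _ zU, of "{1..<min (i + m - 1) (N + 1)}"])
    show "1 / (1 + lamh k) \<le> \<beta>" if "k \<in> {1..N} - {1..<min (i + m - 1) (N + 1)}" for k
      using that by (intro \<beta>(2)) auto
    fix k assume k: "k \<in> {1..<min (i + m - 1) (N + 1)}"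
    then have kN: "k \<in> {1..N}" by auto
    show "z \<bullet> w k = 0"
    proof (cases "k < i")
      case True
      then show ?thesis using k by (intro zF) (auto simp: F_def intro: span_base)
    next
      case False
      then have "k \<in> P" using k by (auto simp: P_def)
      then have "p \<bullet> w k = 0" using xw px[OF eigen_system_in[OF disc kN]] by simp
      moreover have "f \<bullet> w k = 0"
      proof -
        obtain b where b: "f = (\<Sum>k\<in>{1..<i}. b k *\<^sub>R w k)" using Fc[OF fF] by blast
        have "w l \<bullet> w k = 0" if l: "l \<in> {1..<i}" for l
        proof (rule eigen_system_orthogonal[OF disc _ kN])
          show "l \<in> {1..N}" using l iN by auto
          \<comment> \<open>Orthogonality is available only between different discrete eigenvalues.
            They are separated by \<nu>0: values from position i on do not exceed it, earlier ones
            exceed it by \<delta>.\<close>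
          have "1 / (1 + lamh k) \<le> 1 / (1 + lam k)" by (rule discrete_le_continuous[OF kN])
          also have "\<dots> \<le> \<nu>0" using lam_mono[of i k] False cl(2) ev evi
            unfolding \<nu>0_def by (intro divide_left_mono) auto
          finally have "1 / (1 + lamh k) \<le> \<nu>0" .
          moreover have "\<nu>0 + \<delta> \<le> 1 / (1 + lamh l)" using gap(3)[of l] l by (simp add: \<nu>0_def)
          ultimately show "1 / (1 + lamh l) \<noteq> 1 / (1 + lamh k)" using gap(1) by linarith
        qed
        then show ?thesis unfolding b by (simp add: inner_sum_left)
      qed
      ultimately show ?thesis by (simp add: z_def inner_diff_left)
    qed
  qed auto
  have "(norm p)\<^sup>2 = (norm f)\<^sup>2 + (norm z)\<^sup>2"
    unfolding pfz power2_norm_add using zF[OF fF] by (simp add: inner_commute)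
  moreover have "(norm p)\<^sup>2 \<le> 1" using np by (simp add: power_le_one)
  ultimately have "(norm z)\<^sup>2 \<le> 1" using zero_le_power2[of "norm f"] by linarith
  then have "(norm (flux S z))\<^sup>2 \<le> \<beta>" using zb mult_left_mono[of "(norm z)\<^sup>2" 1 \<beta>] \<beta>(1) by linarith
  moreover have "(norm (flux S p))\<^sup>2 = (norm (flux S f))\<^sup>2 + (norm (flux S z))\<^sup>2"
    unfolding Kpfz power2_norm_add using Kz[OF fF] by (simp add: inner_commute)
  moreover have "(norm (flux S f))\<^sup>2 \<le> 4 / \<delta>\<^sup>2 * e\<^sup>2"
  proof -
    have "norm (flux S f) \<le> 2 * e / \<delta>" using nK[of f] nf by linarith
    then have "(norm (flux S f))\<^sup>2 \<le> (2 * e / \<delta>)\<^sup>2" by (simp add: power_mono)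
    then show ?thesis by (simp add: power_divide power_mult_distrib)
  qed
  ultimately show ?thesis using quad by (simp add: \<nu>0_def distrib_right)
qed

end

lemma infdist_sum_le:
  fixes v :: "'i \<Rightarrow> 'a::real_inner"
  assumes Z: "subspace Z" "complete Z"
  shows "infdist (\<Sum>k\<in>I. c k *\<^sub>R v k) Z \<le> (\<Sum>k\<in>I. \<bar>c k\<bar> * infdist (v k) Z)"
proof -
  have "infdist (\<Sum>k\<in>I. c k *\<^sub>R v k) Z = norm (\<Sum>k\<in>I. c k *\<^sub>R (v k - proj Z (v k)))"
    unfolding proj_infdist[OF Z, symmetric]
    by (simp add: linear_sum[OF linear_proj[OF Z]] linear_scale[OF linear_proj[OF Z]]
        sum_subtractf scaleR_diff_right)
  also have "\<dots> \<le> (\<Sum>k\<in>I. norm (c k *\<^sub>R (v k - proj Z (v k))))" by (rule norm_sum)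
  finally show ?thesis by (simp add: proj_infdist[OF Z])
qed

lemma infdist_scaleR_le:
  fixes v :: "'a::real_inner"
  assumes "subspace Z" "complete Z" shows "infdist (c *\<^sub>R v) Z \<le> \<bar>c\<bar> * infdist v Z"
  using infdist_sum_le[OF assms, of "\<lambda>_. c" "\<lambda>_. v" "{0 :: nat}"] by simp

section \<open>Families of discretizations as h tends to 0\<close>

locale ls_eigenproblem_family =
  fixes H :: "'b::real_inner set" and L :: "'b \<Rightarrow> 'a::real_inner"
    and S :: "real \<Rightarrow> ('b \<times> 'a) set" and U :: "real \<Rightarrow> 'b set"
    and lam :: "nat \<Rightarrow> real" and g :: "nat \<Rightarrow> 'b"
    and N :: "real \<Rightarrow> nat" and lamh :: "real \<Rightarrow> nat \<Rightarrow> real" and w :: "real \<Rightarrow> nat \<Rightarrow> 'b"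
  assumes prob: "\<And>h. 0 < h \<Longrightarrow> ls_eigenproblem H L (S h) (U h) lam g (N h) (lamh h) (w h)"
    and conv_U: "\<And>ev x. 0 < ev \<Longrightarrow> x \<in> eigvec L H (1 / ev) \<Longrightarrow>
        ((\<lambda>h. infdist x (U h)) \<longlongrightarrow> 0) (at_right 0)"
    and conv_S: "\<And>ev x. 0 < ev \<Longrightarrow> x \<in> eigvec L H (1 / ev) \<Longrightarrow>
        ((\<lambda>h. infdist (x, - ev *\<^sub>R L x) (S h)) \<longlongrightarrow> 0) (at_right 0)"
begin

lemma cont_sys: "eigen_system L H {1..} (\<lambda>k. 1 / lam k) g"
  using prob[of 1] by (simp add: ls_eigenproblem_def ls_eigenproblem_axioms_def)

lemmas lam_pos = ls_eigenproblem.lam_pos[OF prob[OF zero_less_one]]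
  and lam_mono = ls_eigenproblem.lam_mono[OF prob[OF zero_less_one]]

text \<open>A relation rather than a supremum, so that one estimate serves both a null sequence, for
  convergence, and the quantity \<epsilon>, for the final rate. Errors are relative to
  \<open>norm x\<close>, the norm of the gradient.\<close>

definition err_bound :: "real \<Rightarrow> real \<Rightarrow> real \<Rightarrow> bool" where
  "err_bound ev h e \<longleftrightarrow> 0 \<le> e \<and> (\<forall>x\<in>eigvec L H (1 / ev).
     infdist x (U h) \<le> e * norm x \<and> infdist (x, - ev *\<^sub>R L x) (S h) \<le> e * norm x)"

text \<open>Convergence is assumed for each eigenvector separately. Since the eigenspace has a
  finite basis whose coefficients are controlled by \<open>coeff_bound\<close>, the errors tend to
  zero uniformly.\<close>

lemma err_bound_tendsto:
  assumes ev: "0 < ev"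
  shows "\<exists>e. (e \<longlongrightarrow> 0) (at_right 0) \<and> (\<forall>h>0. err_bound ev h (e h))"
proof -
  note sys = cont_sys
  define J where "J = {k \<in> {1..}. 1 / lam k = 1 / ev}"
  have J: "finite J" unfolding J_def by (rule eigen_system_finite[OF sys]) (use ev in simp)
  have JJ: "J \<subseteq> {1..}" by (auto simp: J_def)
  have gE: "g k \<in> eigvec L H (1 / ev)" if "k \<in> J" for k
    using that sys by (auto simp: J_def eigen_system_def)
  have ind: "\<And>c. (\<Sum>k\<in>J. c k *\<^sub>R g k) = 0 \<Longrightarrow> \<forall>k\<in>J. c k = 0"
    using eigen_system_independent[OF sys J JJ] by blast
  obtain M where M: "\<And>c k. k \<in> J \<Longrightarrow> \<bar>c k\<bar> \<le> M k * norm (\<Sum>k\<in>J. c k *\<^sub>R g k)"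
    using coeff_bound[OF J ind] by blast
  define q where "q h k = infdist (g k) (U h) + infdist (g k, - ev *\<^sub>R L (g k)) (S h)" for h k
  define e where "e h = (\<Sum>k\<in>J. \<bar>M k\<bar> * q h k)" for h
  have q0: "0 \<le> q h k" for h k by (simp add: q_def infdist_nonneg)
  have "(e \<longlongrightarrow> (\<Sum>k\<in>J. \<bar>M k\<bar> * (0 + 0))) (at_right 0)"
    unfolding e_def q_def by (intro tendsto_intros conv_U[OF ev] conv_S[OF ev] gE)
  then have "(e \<longlongrightarrow> 0) (at_right 0)" by simp
  moreover have "err_bound ev h (e h)" if h: "0 < h" for h
    unfolding err_bound_def
  proof (intro conjI ballI)
    show "0 \<le> e h" unfolding e_def by (intro sum_nonneg mult_nonneg_nonneg q0) auto
    interpret ls_eigenproblem H L "S h" "U h" lam g "N h" "lamh h" "w h" by (rule prob[OF h])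
    fix x assume x: "x \<in> eigvec L H (1 / ev)"
    then have "x \<in> span (g ` J)" using eigen_system_span[OF sys, of "1 / ev"] ev by (auto simp: J_def)
    then obtain c where xc: "x = (\<Sum>k\<in>J. c k *\<^sub>R g k)" using span_image_coeffs[OF J] by blast
    have Lx: "L x = (\<Sum>k\<in>J. c k *\<^sub>R L (g k))" unfolding xc
      by (rule compact_on_sum[OF eigen_system_space(3,1)[OF sys]]) (use gE in \<open>auto simp: eigvec_def\<close>)
    have pair: "(x, - ev *\<^sub>R L x) = (\<Sum>k\<in>J. c k *\<^sub>R (g k, - ev *\<^sub>R L (g k)))"
      by (rule prod_eqI) (simp_all add: fst_sum snd_sum Lx scaleR_sum_right mult.commute sum_negf flip: xc)
    have cM: "\<bar>c k\<bar> \<le> \<bar>M k\<bar> * norm x" if "k \<in> J" for k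
    proof -
      have "\<bar>c k\<bar> \<le> M k * norm x" using M[OF that, of c] by (simp add: xc)
      also have "\<dots> \<le> \<bar>M k\<bar> * norm x" by (intro mult_right_mono) auto
      finally show ?thesis .
    qed
    have le: "(\<Sum>k\<in>J. \<bar>c k\<bar> * r k) \<le> e h * norm x" if r: "\<And>k. 0 \<le> r k \<and> r k \<le> q h k" for r
    proof -
      have "\<bar>c k\<bar> * r k \<le> (\<bar>M k\<bar> * norm x) * q h k" if "k \<in> J" for k
        using r[of k] cM[OF that] by (intro mult_mono) auto
      then have "(\<Sum>k\<in>J. \<bar>c k\<bar> * r k) \<le> (\<Sum>k\<in>J. (\<bar>M k\<bar> * norm x) * q h k)" by (rule sum_mono)
      also have "\<dots> = e h * norm x" by (simp add: e_def sum_distrib_left mult_ac)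
      finally show ?thesis .
    qed
    show "infdist x (U h) \<le> e h * norm x" unfolding xc
      by (rule order_trans[OF infdist_sum_le[OF U_space]], fold xc, rule le)
         (auto simp: q_def infdist_nonneg)
    show "infdist (x, - ev *\<^sub>R L x) (S h) \<le> e h * norm x" unfolding pair
      by (rule order_trans[OF infdist_sum_le[OF S_space]], rule le)
         (auto simp: q_def infdist_nonneg)
  qed
  ultimately show ?thesis by blast
qed

text \<open>The condition \<open>i \<le> N h + 1\<close> says that the i - 1 discrete eigenvalues
  below the cluster exist; \<delta> is independent of h.\<close>

definition gap :: "nat \<Rightarrow> real \<Rightarrow> bool" where
  "gap i ev \<longleftrightarrow> (\<exists>\<delta>>0. eventually (\<lambda>h. i \<le> N h + 1 \<and>
     (\<forall>k. 1 \<le> k \<longrightarrow> k < i \<longrightarrow> 1 / (1 + ev) + \<delta> \<le> 1 / (1 + lamh h k))) (at_right 0))"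

text \<open>\<open>cluster_bound\<close> serves twice: with \<beta> = 0 and an error tending to zero
  it yields enough discrete eigenvalues, and with \<beta> = \<nu> it yields the error. As \<nu>
  stays above half of \<nu>0, a difference of reciprocals turns into a difference of eigenvalues at
  the cost of a fixed factor.\<close>

lemma cluster_estimate:
  assumes cl: "{k. 1 \<le> k \<and> lam k = ev} = {i..<i + m}" "1 \<le> i" "1 \<le> m" and gap: "gap i ev"
  shows "\<exists>C. eventually (\<lambda>h. \<forall>j\<in>{i..<i + m}. j \<le> N h \<and>
           (\<forall>e. err_bound ev h e \<longrightarrow> \<bar>ev - lamh h j\<bar> \<le> C * e\<^sup>2)) (at_right 0)"
proof -
  have lami: "lam k = ev" if "k \<in> {i..<i + m}" for k using that cl(1) by blast
  have ev: "0 < ev" using lam_pos[of i] lami[of i] cl by simp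
  obtain \<delta> where \<delta>: "0 < \<delta>" and ev1: "eventually (\<lambda>h. i \<le> N h + 1 \<and>
     (\<forall>k. 1 \<le> k \<longrightarrow> k < i \<longrightarrow> 1 / (1 + ev) + \<delta> \<le> 1 / (1 + lamh h k))) (at_right 0)"
    using gap by (auto simp: gap_def)
  define C where "C = 5 + 4 / \<delta>\<^sup>2"
  have C: "0 < C" using \<delta> by (simp add: C_def add_pos_pos)
  define \<nu>0 where "\<nu>0 = 1 / (1 + ev)"
  have \<nu>0: "0 < \<nu>0" using ev by (simp add: \<nu>0_def)
  obtain e1 where e1: "(e1 \<longlongrightarrow> 0) (at_right 0)" "\<And>h. 0 < h \<Longrightarrow> err_bound ev h (e1 h)"
    using err_bound_tendsto[OF ev] by blast
  have "((\<lambda>h. C * (e1 h)\<^sup>2) \<longlongrightarrow> C * 0\<^sup>2) (at_right 0)" by (intro tendsto_intros e1)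
  then have "((\<lambda>h. C * (e1 h)\<^sup>2) \<longlongrightarrow> 0) (at_right 0)" by simp
  from order_tendstoD(2)[OF this, of "\<nu>0 / 2"] \<nu>0
  have ev2: "eventually (\<lambda>h. C * (e1 h)\<^sup>2 < \<nu>0 / 2) (at_right 0)" by simp
  have ev3: "eventually (\<lambda>h. 0 < h) (at_right (0::real))" by (rule eventually_at_right_less)
  \<comment> \<open>The factor after C is the reciprocal of \<nu>0 (\<nu>0 / 2), a lower bound of
    \<nu>0 \<nu>.\<close>
  define D where "D = C * (2 * (1 + ev) * (1 + ev))"
  have "eventually (\<lambda>h. \<forall>j\<in>{i..<i + m}. j \<le> N h \<and>
           (\<forall>e. err_bound ev h e \<longrightarrow> \<bar>ev - lamh h j\<bar> \<le> D * e\<^sup>2)) (at_right 0)"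
    using ev1 ev2 ev3
  proof eventually_elim
    case (elim h)
    interpret ls_eigenproblem H L "S h" "U h" lam g "N h" "lamh h" "w h" by (rule prob) fact
    have est: "\<nu>0 - \<beta> \<le> C * e\<^sup>2"
      if "err_bound ev h e" "0 \<le> \<beta>" "\<And>k. i + m - 1 \<le> k \<Longrightarrow> k \<le> N h \<Longrightarrow> 1 / (1 + lamh h k) \<le> \<beta>" for e \<beta>
      unfolding \<nu>0_def C_def
      by (rule cluster_bound[OF cl \<delta>]) (use that elim in \<open>auto simp: err_bound_def\<close>)
    have N: "i + m - 1 \<le> N h"
    proof (rule ccontr)
      assume "\<not> i + m - 1 \<le> N h"
      then have "\<nu>0 - 0 \<le> C * (e1 h)\<^sup>2" by (intro est e1) (use elim in auto)
      then show False using elim \<nu>0 by simp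
    qed
    show ?case
    proof (intro ballI conjI allI impI)
      fix j assume j: "j \<in> {i..<i + m}"
      show jN: "j \<le> N h" using j N by auto
      have j1: "j \<in> {1..N h}" using j jN cl by auto
      define \<nu> where "\<nu> = 1 / (1 + lamh h j)"
      have \<nu>p: "0 < \<nu>" using eigen_system_pos[OF disc j1] by (simp add: \<nu>_def)
      have \<nu>le: "\<nu> \<le> \<nu>0" using discrete_le_continuous[OF j1] lami[OF j] by (simp add: \<nu>_def \<nu>0_def)
      have low: "\<nu>0 - \<nu> \<le> C * e\<^sup>2" if "err_bound ev h e" for e
      proof (rule est[OF that])
        show "0 \<le> \<nu>" using \<nu>p by simp
        show "1 / (1 + lamh h k) \<le> \<nu>" if "i + m - 1 \<le> k" "k \<le> N h" for k
          unfolding \<nu>_def using that j j1 by (intro eigen_system_antimono[OF disc]) auto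
      qed
      have half: "\<nu>0 / 2 \<le> \<nu>" using low[OF e1(2)] elim by fastforce
      fix e assume "err_bound ev h e"
      note l = low[OF this]
      have lh: "lamh h j = 1 / \<nu> - 1" by (simp add: \<nu>_def)
      have le: "ev = 1 / \<nu>0 - 1" using ev by (simp add: \<nu>0_def)
      have "\<bar>ev - lamh h j\<bar> = (\<nu>0 - \<nu>) / (\<nu>0 * \<nu>)"
      proof -
        have "lamh h j - ev = (\<nu>0 - \<nu>) / (\<nu>0 * \<nu>)"
          unfolding lh le using \<nu>0 \<nu>p by (simp add: field_simps)
        moreover have "0 \<le> (\<nu>0 - \<nu>) / (\<nu>0 * \<nu>)" using \<nu>le \<nu>0 \<nu>p by simp
        ultimately show ?thesis by linarith
      qed
      also have "\<dots> \<le> C * e\<^sup>2 / (\<nu>0 * (\<nu>0 / 2))"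
        using l half \<nu>0 \<nu>p C by (intro frac_le mult_left_mono) auto
      also have "\<dots> = D * e\<^sup>2" using ev by (simp add: D_def \<nu>0_def field_simps)
      finally show "\<bar>ev - lamh h j\<bar> \<le> D * e\<^sup>2" .
    qed
  qed
  then show ?thesis by blast
qed

text \<open>Multiplicities are finite and \<open>lam\<close> is nondecreasing, so the indices of one
  value form an interval.\<close>

lemma cluster_interval:
  assumes k: "1 \<le> k"
  shows "\<exists>i m. {l. 1 \<le> l \<and> lam l = lam k} = {i..<i + m} \<and> 1 \<le> i \<and> 1 \<le> m \<and> i \<le> k \<and> k < i + m"
proof -
  define J where "J = {l. 1 \<le> l \<and> lam l = lam k}"
  have "{l \<in> {1..}. 1 / lam l = 1 / lam k} = J" by (auto simp: J_def)
  then have J: "finite J" using eigen_system_finite[OF cont_sys, of "1 / lam k"] lam_pos[OF k] by simp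
  have kJ: "k \<in> J" using k by (simp add: J_def)
  define a b where "a = Min J" and "b = Max J"
  have ab: "a \<in> J" "b \<in> J" "a \<le> k" "k \<le> b" using J kJ by (auto simp: a_def b_def intro: Min_in Max_in)
  have "J = {a..<a + (b + 1 - a)}"
  proof (intro equalityI subsetI)
    fix l assume "l \<in> J"
    then have "a \<le> l" "l \<le> b" using J by (auto simp: a_def b_def)
    then show "l \<in> {a..<a + (b + 1 - a)}" by auto
  next
    fix l assume "l \<in> {a..<a + (b + 1 - a)}"
    then have l: "a \<le> l" "l \<le> b" by auto
    have a: "1 \<le> a" "lam a = lam k" "lam b = lam k" using ab by (auto simp: J_def)
    have "lam a \<le> lam l" "lam l \<le> lam b" using l a(1) by (auto intro: lam_mono)
    then have "lam l = lam k" using a by linarith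
    then show "l \<in> J" using a l by (simp add: J_def)
  qed
  moreover have "1 \<le> a" using ab(1) by (simp add: J_def)
  ultimately show ?thesis using ab unfolding J_def[symmetric]
    by (intro exI[of _ a] exI[of _ "b + 1 - a"]) auto
qed

text \<open>Convergence at the single index i - 1 suffices, because the earlier discrete eigenvalues
  are not larger. The margin is taken at the midpoint b between \<open>lam (i - 1)\<close> and
  ev.\<close>

lemma gap_if_convergent:
  assumes cl: "{k. 1 \<le> k \<and> lam k = ev} = {i..<i + m}" "1 \<le> i" "1 \<le> m"
    and conv: "1 < i \<Longrightarrow> eventually (\<lambda>h. i - 1 \<le> N h) (at_right 0) \<and> ((\<lambda>h. lamh h (i - 1)) \<longlongrightarrow> lam (i - 1)) (at_right 0)"
  shows "gap i ev"
proof (cases "i = 1")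
  case True
  then show ?thesis unfolding gap_def by (intro exI[of _ 1]) auto
next
  case False
  then have i: "1 < i" "1 \<le> i - 1" using cl by auto
  have "i \<in> {k. 1 \<le> k \<and> lam k = ev}" using cl by (simp only:) simp
  then have evi: "lam i = ev" by simp
  have "i - 1 \<notin> {i..<i + m}" using i by auto
  then have "lam (i - 1) \<noteq> ev" unfolding cl(1)[symmetric] using i by simp
  moreover have "lam (i - 1) \<le> ev" using lam_mono[of "i - 1" i] i evi by simp
  ultimately have lt: "lam (i - 1) < ev" by simp
  define b where "b = (lam (i - 1) + ev) / 2"
  have b: "lam (i - 1) < b" "b < ev" using lt by (auto simp: b_def)
  have b0: "0 < b" using lam_pos[OF i(2)] b by simp
  define \<delta> where "\<delta> = 1 / (1 + b) - 1 / (1 + ev)"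
  have \<delta>: "0 < \<delta>" using b b0 by (simp add: \<delta>_def frac_less2)
  from conv[OF i(1)] have c: "eventually (\<lambda>h. i - 1 \<le> N h) (at_right 0)"
    "eventually (\<lambda>h. lamh h (i - 1) < b) (at_right 0)"
    using order_tendstoD(2)[OF _ b(1)] by auto
  have ev3: "eventually (\<lambda>h. 0 < h) (at_right (0::real))" by (rule eventually_at_right_less)
  show ?thesis unfolding gap_def
  proof (intro exI conjI)
    show "0 < \<delta>" by fact
    show "eventually (\<lambda>h. i \<le> N h + 1 \<and>
      (\<forall>k. 1 \<le> k \<longrightarrow> k < i \<longrightarrow> 1 / (1 + ev) + \<delta> \<le> 1 / (1 + lamh h k))) (at_right 0)"
      using c ev3
    proof eventually_elim
      case (elim h)
      interpret ls_eigenproblem H L "S h" "U h" lam g "N h" "lamh h" "w h" by (rule prob) fact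
      have "1 / (1 + ev) + \<delta> \<le> 1 / (1 + lamh h k)" if "1 \<le> k" "k < i" for k
      proof -
        have "0 < 1 + lamh h (i - 1)" using eigen_system_pos[OF disc, of "i - 1"] i elim by simp
        then have "1 / (1 + b) \<le> 1 / (1 + lamh h (i - 1))" using elim b0 by (intro divide_left_mono) auto
        also have "\<dots> \<le> 1 / (1 + lamh h k)"
          using that i elim by (intro eigen_system_antimono[OF disc]) auto
        finally show ?thesis by (simp add: \<delta>_def)
      qed
      then show ?case using elim by auto
    qed
  qed
qed

text \<open>The cluster of k begins at some i \<le> k, so the induction hypothesis applies to i - 1
  and gives the gap that the estimate for the whole cluster requires.\<close>

lemma eigenvalues_converge:
  "1 \<le> k \<Longrightarrow> eventually (\<lambda>h. k \<le> N h) (at_right 0) \<and> ((\<lambda>h. lamh h k) \<longlongrightarrow> lam k) (at_right 0)"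
proof (induction k rule: less_induct)
  case (less k)
  obtain i m where cl: "{l. 1 \<le> l \<and> lam l = lam k} = {i..<i + m}" "1 \<le> i" "1 \<le> m" "i \<le> k" "k < i + m"
    using cluster_interval[OF less.prems] by blast
  have "gap i (lam k)"
    by (rule gap_if_convergent[OF cl(1-3)]) (rule less.IH, use cl in auto)
  from cluster_estimate[OF cl(1-3) this] obtain C where
    "eventually (\<lambda>h. \<forall>j\<in>{i..<i + m}. j \<le> N h \<and>
       (\<forall>e. err_bound (lam k) h e \<longrightarrow> \<bar>lam k - lamh h j\<bar> \<le> C * e\<^sup>2)) (at_right 0)" by blast
  then have C: "eventually (\<lambda>h. k \<le> N h \<and> (\<forall>e. err_bound (lam k) h e \<longrightarrow> \<bar>lam k - lamh h k\<bar> \<le> C * e\<^sup>2)) (at_right 0)"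
    by (rule eventually_mono) (use cl(4,5) in auto)
  obtain e1 where e1: "(e1 \<longlongrightarrow> 0) (at_right 0)" "\<And>h. 0 < h \<Longrightarrow> err_bound (lam k) h (e1 h)"
    using err_bound_tendsto[OF lam_pos[OF less.prems]] by blast
  have "((\<lambda>h. C * (e1 h)\<^sup>2) \<longlongrightarrow> C * 0\<^sup>2) (at_right 0)" by (intro tendsto_intros e1)
  then have 0: "((\<lambda>h. C * (e1 h)\<^sup>2) \<longlongrightarrow> 0) (at_right 0)" by simp
  have "eventually (\<lambda>h. norm (lamh h k - lam k) \<le> C * (e1 h)\<^sup>2) (at_right 0)"
    using C eventually_at_right_less[of "0::real"]
    by eventually_elim (use e1 in \<open>auto simp: abs_minus_commute\<close>)
  then have "((\<lambda>h. lamh h k) \<longlongrightarrow> lam k) (at_right 0)"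
    by (rule LIM_zero_cancel[OF Lim_null_comparison[OF _ 0]])
  moreover have "eventually (\<lambda>h. k \<le> N h) (at_right 0)" by (rule eventually_mono[OF C]) blast
  ultimately show ?case by blast
qed

theorem eigenvalue_estimate:
  assumes cl: "{k. 1 \<le> k \<and> lam k = ev} = {i..<i + m}" "1 \<le> i" "1 \<le> m"
  shows "\<exists>C. eventually (\<lambda>h. \<forall>j\<in>{i..<i + m}. j \<le> N h \<and>
           (\<forall>e. err_bound ev h e \<longrightarrow> \<bar>ev - lamh h j\<bar> \<le> C * e\<^sup>2)) (at_right 0)"
  by (rule cluster_estimate[OF cl gap_if_convergent[OF cl]]) (rule eigenvalues_converge, simp)

end

subsection \<open>The Hilbert space of square integrable functions\<close>

lemma L2_measurable: "f \<in> L2 \<Omega> \<Longrightarrow> f \<in> borel_measurable (lebesgue_on \<Omega>)"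
  and L2_integrable: "f \<in> L2 \<Omega> \<Longrightarrow> integrable (lebesgue_on \<Omega>) (\<lambda>x. (norm (f x))\<^sup>2)"
  by (auto simp: L2_def)

lemma L2_zero: "(\<lambda>x. 0) \<in> L2 \<Omega>"
  by (simp add: L2_def)

lemma L2_add:
  assumes "f \<in> L2 \<Omega>" "g \<in> L2 \<Omega>" shows "(\<lambda>x. f x + g x) \<in> L2 \<Omega>"
proof -
  note [measurable] = L2_measurable[OF assms(1)] L2_measurable[OF assms(2)]
  have "integrable (lebesgue_on \<Omega>) (\<lambda>x. (norm (f x + g x))\<^sup>2)"
  proof (rule Bochner_Integration.integrable_bound)
    show "integrable (lebesgue_on \<Omega>) (\<lambda>x. 2 * (norm (f x))\<^sup>2 + 2 * (norm (g x))\<^sup>2)"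
      using L2_integrable[OF assms(1)] L2_integrable[OF assms(2)] by simp
    show "AE x in lebesgue_on \<Omega>. norm ((norm (f x + g x))\<^sup>2) \<le> norm (2 * (norm (f x))\<^sup>2 + 2 * (norm (g x))\<^sup>2)"
    proof (intro AE_I2)
      fix x
      show "norm ((norm (f x + g x))\<^sup>2) \<le> norm (2 * (norm (f x))\<^sup>2 + 2 * (norm (g x))\<^sup>2)"
        using parallelogram_law[of "f x" "g x"] zero_le_power2[of "norm (f x - g x)"] by simp
    qed
  qed simp
  then show ?thesis by (simp add: L2_def)
qed

lemma L2_scaleR: "f \<in> L2 \<Omega> \<Longrightarrow> (\<lambda>x. c *\<^sub>R f x) \<in> L2 \<Omega>"
  by (auto simp: L2_def power_mult_distrib)

lemma L2_uminus: "f \<in> L2 \<Omega> \<Longrightarrow> (\<lambda>x. - f x) \<in> L2 \<Omega>"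
  using L2_scaleR[of f \<Omega> "-1"] by simp

lemma L2_diff: "f \<in> L2 \<Omega> \<Longrightarrow> g \<in> L2 \<Omega> \<Longrightarrow> (\<lambda>x. f x - g x) \<in> L2 \<Omega>"
  using L2_add[of f \<Omega> "\<lambda>x. (-1) *\<^sub>R g x"] L2_scaleR[of g \<Omega> "-1"] by simp

lemma L2_inner_integrable:
  assumes "f \<in> L2 \<Omega>" "g \<in> L2 \<Omega>" shows "integrable (lebesgue_on \<Omega>) (\<lambda>x. f x \<bullet> g x)"
proof (rule Bochner_Integration.integrable_bound)
  note [measurable] = L2_measurable[OF assms(1)] L2_measurable[OF assms(2)]
  show "integrable (lebesgue_on \<Omega>) (\<lambda>x. (norm (f x))\<^sup>2 + (norm (g x))\<^sup>2)"
    using L2_integrable[OF assms(1)] L2_integrable[OF assms(2)] by simp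
  show "(\<lambda>x. f x \<bullet> g x) \<in> borel_measurable (lebesgue_on \<Omega>)" by measurable
  show "AE x in lebesgue_on \<Omega>. norm (f x \<bullet> g x) \<le> norm ((norm (f x))\<^sup>2 + (norm (g x))\<^sup>2)"
  proof (intro AE_I2)
    fix x
    have "\<bar>f x \<bullet> g x\<bar> \<le> norm (f x) * norm (g x)" by (rule Cauchy_Schwarz_ineq2)
    also have "\<dots> \<le> (norm (f x))\<^sup>2 + (norm (g x))\<^sup>2"
      using sum_squares_bound[of "norm (f x)" "norm (g x)"]
        mult_nonneg_nonneg[OF norm_ge_zero norm_ge_zero, of "f x" "g x"] by linarith
    finally show "norm (f x \<bullet> g x) \<le> norm ((norm (f x))\<^sup>2 + (norm (g x))\<^sup>2)" by simp
  qed
qed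

lemma L2_component:
  fixes g :: "real^'d \<Rightarrow> real^'n"
  assumes g: "g \<in> L2 \<Omega>" shows "(\<lambda>x. g x $ i) \<in> L2 \<Omega>"
proof -
  note [measurable] = L2_measurable[OF g]
  have "(\<lambda>x. g x \<bullet> axis i 1) \<in> borel_measurable (lebesgue_on \<Omega>)" by measurable
  then have m[measurable]: "(\<lambda>x. g x $ i) \<in> borel_measurable (lebesgue_on \<Omega>)" by (simp add: inner_axis)
  have "(norm (g x $ i))\<^sup>2 \<le> (norm (g x))\<^sup>2" for x
    by (rule power_mono) (simp_all add: component_le_norm_cart)
  then have "integrable (lebesgue_on \<Omega>) (\<lambda>x. (norm (g x $ i))\<^sup>2)"
    by (intro Bochner_Integration.integrable_bound[OF L2_integrable[OF g]]) auto
  then show ?thesis using m by (simp add: L2_def)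
qed

lemma L2_nn_integral:
  assumes "f \<in> L2 \<Omega>"
  shows "(\<integral>\<^sup>+x. ennreal ((norm (f x))\<^sup>2) \<partial>lebesgue_on \<Omega>) = ennreal (L2_inner \<Omega> f f)"
  unfolding L2_inner_def power2_norm_eq_inner
  by (intro nn_integral_eq_integral L2_inner_integrable assms) auto

text \<open>A subsequence with increments \<open>d n\<close> of norm at most \<open>2\<close> to the power \<open>-n\<close> converges a.e.,
  because the weighted sum of \<open>2 ^ n * (norm (d n x))\<^sup>2\<close> has a finite integral.\<close>
lemma L2_fast_Cauchy_convergent:
  fixes f :: "nat \<Rightarrow> real^'d \<Rightarrow> 'b::euclidean_space"
  assumes f: "\<And>n. f n \<in> L2 \<Omega>"
    and fast: "\<And>n. L2_inner \<Omega> (\<lambda>x. f (Suc n) x - f n x) (\<lambda>x. f (Suc n) x - f n x) \<le> (1 / 4) ^ n"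
  shows "AE x in lebesgue_on \<Omega>. convergent (\<lambda>n. f n x)"
proof -
  let ?M = "lebesgue_on \<Omega>"
  note [measurable] = L2_measurable[OF f]
  define d where "d n x = f (Suc n) x - f n x" for n x
  have dL: "d n \<in> L2 \<Omega>" for n unfolding d_def by (intro L2_diff f)
  note [measurable] = L2_measurable[OF dL]
  have "(\<integral>\<^sup>+x. (\<Sum>n. ennreal (2 ^ n * (norm (d n x))\<^sup>2)) \<partial>?M)
      = (\<Sum>n. \<integral>\<^sup>+x. ennreal (2 ^ n * (norm (d n x))\<^sup>2) \<partial>?M)"
    by (rule nn_integral_suminf) measurable
  also have "\<dots> = (\<Sum>n. ennreal (2 ^ n * L2_inner \<Omega> (d n) (d n)))"
    by (simp add: ennreal_mult nn_integral_cmult L2_nn_integral[OF dL] L2_inner_def)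
  also have "\<dots> \<le> (\<Sum>n. ennreal ((1 / 2) ^ n))"
  proof (intro suminf_le ennreal_leI)
    fix n
    have "2 ^ n * L2_inner \<Omega> (d n) (d n) \<le> 2 ^ n * (1 / 4) ^ n"
      using fast[of n] unfolding d_def by (intro mult_left_mono) auto
    also have "\<dots> = (1 / 2 :: real) ^ n" by (simp add: power_mult_distrib[symmetric])
    finally show "2 ^ n * L2_inner \<Omega> (d n) (d n) \<le> (1 / 2) ^ n" .
  qed auto
  also have "\<dots> = ennreal (\<Sum>n. (1 / 2) ^ n)"
    by (intro suminf_ennreal2 summable_geometric) auto
  finally have "(\<integral>\<^sup>+x. (\<Sum>n. ennreal (2 ^ n * (norm (d n x))\<^sup>2)) \<partial>?M) \<noteq> \<infinity>"
    by (auto simp: top_unique)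
  then have "AE x in ?M. (\<Sum>n. ennreal (2 ^ n * (norm (d n x))\<^sup>2)) \<noteq> \<infinity>"
    by (intro nn_integral_PInf_AE) auto
  then show ?thesis
  proof eventually_elim
    case (elim x)
    then have "summable (\<lambda>n. 2 ^ n * (norm (d n x))\<^sup>2)"
      by (intro summable_suminf_not_top) auto
    then have "bounded (range (\<lambda>n. 2 ^ n * (norm (d n x))\<^sup>2))"
      by (rule convergent_imp_bounded[OF summable_LIMSEQ_zero])
    then obtain C where C: "\<And>n. norm (2 ^ n * (norm (d n x))\<^sup>2) \<le> C"
      by (auto simp: bounded_iff)
    have le: "norm (d n x) \<le> sqrt C * (1 / sqrt 2) ^ n" for n
    proof (rule power2_le_imp_le)
      have "(norm (d n x))\<^sup>2 \<le> C / 2 ^ n" using C[of n] by (simp add: field_simps)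
      also have "\<dots> = (sqrt C * (1 / sqrt 2) ^ n)\<^sup>2"
        using order_trans[OF norm_ge_zero C[of 0]]
        by (simp add: power_mult_distrib power_divide power_mult[symmetric] mult.commute[of n 2])
          (simp add: power_mult)
      finally show "(norm (d n x))\<^sup>2 \<le> (sqrt C * (1 / sqrt 2) ^ n)\<^sup>2" .
      show "0 \<le> sqrt C * (1 / sqrt 2) ^ n" using order_trans[OF norm_ge_zero C[of 0]] by simp
    qed
    have "summable (\<lambda>n. sqrt C * (1 / sqrt 2) ^ n)"
      by (intro summable_mult summable_geometric) (simp add: real_less_rsqrt)
    then have "summable (\<lambda>n. d n x)" by (rule summable_comparison_test'[where N = 0]) (rule le)
    then have "convergent (\<lambda>n. f 0 x + (\<Sum>k<n. d k x))"
      unfolding summable_iff_convergent by (intro convergent_add convergent_const)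
    moreover have "f 0 x + (\<Sum>k<n. d k x) = f n x" for n
      by (simp add: d_def sum_lessThan_telescope[of "\<lambda>k. f k x"])
    ultimately show ?case by simp
  qed
qed

text \<open>Riesz-Fischer. The limit is taken pointwise along a fast subsequence, and Fatou's lemma
  then carries the Cauchy estimate of the full sequence to it.\<close>

lemma L2_complete:
  fixes f :: "nat \<Rightarrow> real^'d \<Rightarrow> 'b::euclidean_space"
  assumes f: "\<And>n. f n \<in> L2 \<Omega>"
    and cauchy: "\<And>e. 0 < e \<Longrightarrow> \<exists>M. \<forall>m\<ge>M. \<forall>n\<ge>M. L2_inner \<Omega> (\<lambda>x. f m x - f n x) (\<lambda>x. f m x - f n x) < e"
  shows "\<exists>F\<in>L2 \<Omega>. \<forall>e>0. \<exists>M. \<forall>n\<ge>M. L2_inner \<Omega> (\<lambda>x. F x - f n x) (\<lambda>x. F x - f n x) \<le> e"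
proof -
  let ?M = "lebesgue_on \<Omega>"
  note [measurable] = L2_measurable[OF f]
  have "\<exists>M. \<forall>k. \<forall>m\<ge>M k. \<forall>n\<ge>M k. L2_inner \<Omega> (\<lambda>x. f m x - f n x) (\<lambda>x. f m x - f n x) < (1 / 4) ^ k"
    using cauchy by (intro choice) simp
  then obtain M where M: "\<And>k m n. m \<ge> M k \<Longrightarrow> n \<ge> M k \<Longrightarrow>
      L2_inner \<Omega> (\<lambda>x. f m x - f n x) (\<lambda>x. f m x - f n x) < (1 / 4) ^ k" by blast
  \<comment> \<open>Summing the thresholds makes r monotone; adding k makes it at least k, so it
    eventually passes every bound.\<close>
  define r where "r k = (\<Sum>j\<le>k. M j) + k" for k
  have rM: "M k \<le> r k" for k using member_le_sum[of k "{..k}" M] by (simp add: r_def trans_le_add1)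
  have rmono: "r k \<le> r (Suc k)" for k by (simp add: r_def)
  have rk: "k \<le> r k" for k by (simp add: r_def)
  have conv: "AE x in ?M. convergent (\<lambda>k. f (r k) x)"
    using f less_imp_le[OF M[OF order_trans[OF rM rmono] rM]]
    by (intro L2_fast_Cauchy_convergent) auto
  define F where "F x = lim (\<lambda>k. f (r k) x)" for x
  have [measurable]: "F \<in> borel_measurable ?M"
    unfolding F_def by (rule borel_measurable_lim_metric) measurable
  have bound: "(\<integral>\<^sup>+x. ennreal ((norm (F x - f n x))\<^sup>2) \<partial>?M) \<le> ennreal e"
    if e: "0 < e" and K: "\<And>m. m \<ge> K \<Longrightarrow> L2_inner \<Omega> (\<lambda>x. f m x - f n x) (\<lambda>x. f m x - f n x) < e" for e n K
  proof -
    have "AE x in ?M. ennreal ((norm (F x - f n x))\<^sup>2) = liminf (\<lambda>k. ennreal ((norm (f (r k) x - f n x))\<^sup>2))"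
      using conv
    proof eventually_elim
      case (elim x)
      then have "(\<lambda>k. f (r k) x) \<longlonglongrightarrow> F x" by (simp add: convergent_LIMSEQ_iff F_def)
      then have "(\<lambda>k. ennreal ((norm (f (r k) x - f n x))\<^sup>2)) \<longlonglongrightarrow> ennreal ((norm (F x - f n x))\<^sup>2)"
        by (intro tendsto_intros)
      from lim_imp_Liminf[OF _ this] show ?case by simp
    qed
    then have "(\<integral>\<^sup>+x. ennreal ((norm (F x - f n x))\<^sup>2) \<partial>?M)
        = (\<integral>\<^sup>+x. liminf (\<lambda>k. ennreal ((norm (f (r k) x - f n x))\<^sup>2)) \<partial>?M)"
      by (rule nn_integral_cong_AE)
    also have "\<dots> \<le> liminf (\<lambda>k. \<integral>\<^sup>+x. ennreal ((norm (f (r k) x - f n x))\<^sup>2) \<partial>?M)"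
      by (rule nn_integral_liminf) measurable
    also have "\<dots> = liminf (\<lambda>k. ennreal (L2_inner \<Omega> (\<lambda>x. f (r k) x - f n x) (\<lambda>x. f (r k) x - f n x)))"
      by (simp add: L2_nn_integral[OF L2_diff[OF f f]])
    also have "\<dots> \<le> liminf (\<lambda>k. ennreal e)"
    proof (rule Liminf_mono)
      have "ennreal (L2_inner \<Omega> (\<lambda>x. f (r k) x - f n x) (\<lambda>x. f (r k) x - f n x)) \<le> ennreal e" if "k \<ge> K" for k
        by (intro ennreal_leI less_imp_le K order_trans[OF that rk])
      then show "\<forall>\<^sub>F k in sequentially. ennreal (L2_inner \<Omega> (\<lambda>x. f (r k) x - f n x) (\<lambda>x. f (r k) x - f n x)) \<le> ennreal e"
        by (auto simp: eventually_sequentially)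
    qed
    also have "\<dots> = ennreal e" by (simp add: Liminf_const)
    finally show ?thesis .
  qed
  have FL: "F \<in> L2 \<Omega>"
  proof -
    have "(\<integral>\<^sup>+x. ennreal ((norm (F x - f (M 0) x))\<^sup>2) \<partial>?M) \<le> ennreal 1"
      using M[of 0 _ "M 0"] by (intro bound[of _ "M 0"]) auto
    then have "integrable ?M (\<lambda>x. (norm (F x - f (M 0) x))\<^sup>2)"
      by (intro integrableI_bounded) (auto simp: le_less_trans)
    then have "(\<lambda>x. F x - f (M 0) x) \<in> L2 \<Omega>" by (simp add: L2_def)
    from L2_add[OF this f[of "M 0"]] show ?thesis by simp
  qed
  moreover have "\<exists>K. \<forall>n\<ge>K. L2_inner \<Omega> (\<lambda>x. F x - f n x) (\<lambda>x. F x - f n x) \<le> e" if "0 < e" for e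
  proof -
    obtain K where K: "\<And>m n. m \<ge> K \<Longrightarrow> n \<ge> K \<Longrightarrow> L2_inner \<Omega> (\<lambda>x. f m x - f n x) (\<lambda>x. f m x - f n x) < e"
      using cauchy[OF \<open>0 < e\<close>] by blast
    have "L2_inner \<Omega> (\<lambda>x. F x - f n x) (\<lambda>x. F x - f n x) \<le> e" if "n \<ge> K" for n
    proof -
      have "ennreal (L2_inner \<Omega> (\<lambda>x. F x - f n x) (\<lambda>x. F x - f n x)) \<le> ennreal e"
        using bound[OF \<open>0 < e\<close>, of K n] K that L2_nn_integral[OF L2_diff[OF FL f]] by simp
      then show ?thesis using \<open>0 < e\<close> by (simp add: ennreal_le_iff)
    qed
    then show ?thesis by blast
  qed
  ultimately show ?thesis by blast
qed

text \<open>A partial equivalence: functions outside \<open>L2\<close> are not related even to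
  themselves, so the quotient consists of classes of square integrable functions only. The whole
  space is used because the type cannot depend on \<Omega>; functions on \<Omega> enter by zero
  extension.\<close>

definition l2_rel :: "(real^'d::finite \<Rightarrow> 'b::euclidean_space) \<Rightarrow> (real^'d \<Rightarrow> 'b) \<Rightarrow> bool" where
  "l2_rel f g \<longleftrightarrow> f \<in> L2 UNIV \<and> g \<in> L2 UNIV \<and> (AE x in lebesgue_on UNIV. f x = g x)"

quotient_type (overloaded) ('d, 'b) l2 = "real^'d::finite \<Rightarrow> 'b::euclidean_space" / partial: l2_rel
proof (rule part_equivpI)
  show "\<exists>f. l2_rel f (f :: real^'d \<Rightarrow> 'b)"
    by (intro exI[of _ "\<lambda>_. 0"]) (simp add: l2_rel_def L2_zero)
  show "symp (l2_rel :: (real^'d \<Rightarrow> 'b) \<Rightarrow> _)"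
    by (rule sympI) (auto simp: l2_rel_def)
  show "transp (l2_rel :: (real^'d \<Rightarrow> 'b) \<Rightarrow> _)"
    by (rule transpI) (auto simp: l2_rel_def)
qed

instantiation l2 :: (finite, euclidean_space) real_inner
begin

lift_definition zero_l2 :: "('a, 'b) l2" is "\<lambda>x. 0"
  by (simp add: l2_rel_def L2_zero)

lift_definition plus_l2 :: "('a, 'b) l2 \<Rightarrow> ('a, 'b) l2 \<Rightarrow> ('a, 'b) l2" is "\<lambda>f g x. f x + g x"
  by (auto simp: l2_rel_def intro: L2_add)

lift_definition minus_l2 :: "('a, 'b) l2 \<Rightarrow> ('a, 'b) l2 \<Rightarrow> ('a, 'b) l2" is "\<lambda>f g x. f x - g x"
  by (auto simp: l2_rel_def intro: L2_diff)

lift_definition uminus_l2 :: "('a, 'b) l2 \<Rightarrow> ('a, 'b) l2" is "\<lambda>f x. - f x"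
  by (auto simp: l2_rel_def intro: L2_uminus)

lift_definition scaleR_l2 :: "real \<Rightarrow> ('a, 'b) l2 \<Rightarrow> ('a, 'b) l2" is "\<lambda>c f x. c *\<^sub>R f x"
  by (auto simp: l2_rel_def intro: L2_scaleR)

lift_definition inner_l2 :: "('a, 'b) l2 \<Rightarrow> ('a, 'b) l2 \<Rightarrow> real" is "L2_inner UNIV"
  unfolding L2_inner_def l2_rel_def
  by (intro integral_cong_AE borel_measurable_inner L2_measurable) auto

definition norm_l2 :: "('a, 'b) l2 \<Rightarrow> real" where "norm_l2 f = sqrt (f \<bullet> f)"
definition dist_l2 :: "('a, 'b) l2 \<Rightarrow> ('a, 'b) l2 \<Rightarrow> real" where "dist_l2 f g = norm (f - g)"
definition sgn_l2 :: "('a, 'b) l2 \<Rightarrow> ('a, 'b) l2" where "sgn_l2 f = inverse (norm f) *\<^sub>R f"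
definition uniformity_l2 :: "(('a, 'b) l2 \<times> ('a, 'b) l2) filter" where
  "uniformity_l2 = (INF e\<in>{0<..}. principal {(f, g). dist f g < e})"
definition open_l2 :: "('a, 'b) l2 set \<Rightarrow> bool" where
  "open_l2 U = (\<forall>x\<in>U. \<forall>\<^sub>F (x', y) in uniformity. x' = x \<longrightarrow> y \<in> U)"

instance
proof
  fix a b c :: "('a, 'b) l2" and r s :: real
  show "a + b + c = a + (b + c)" by transfer (auto simp: l2_rel_def algebra_simps intro!: L2_add)
  show "a + b = b + a" by transfer (auto simp: l2_rel_def algebra_simps intro!: L2_add)
  show "0 + a = a" by transfer (auto simp: l2_rel_def)
  show "- a + a = 0" by transfer (auto simp: l2_rel_def L2_zero)
  show "a - b = a + - b" by transfer (auto simp: l2_rel_def intro: L2_diff)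
  show "r *\<^sub>R (a + b) = r *\<^sub>R a + r *\<^sub>R b"
    by transfer (auto simp: l2_rel_def scaleR_add_right intro!: L2_add L2_scaleR)
  show "(r + s) *\<^sub>R a = r *\<^sub>R a + s *\<^sub>R a"
    by transfer (auto simp: l2_rel_def scaleR_add_left intro!: L2_add L2_scaleR)
  show "r *\<^sub>R s *\<^sub>R a = (r * s) *\<^sub>R a" by transfer (auto simp: l2_rel_def intro!: L2_scaleR)
  show "1 *\<^sub>R a = a" by transfer (auto simp: l2_rel_def)
  show "dist a b = norm (a - b)" by (rule dist_l2_def)
  show "sgn a = inverse (norm a) *\<^sub>R a" by (rule sgn_l2_def)
  show "uniformity = (INF e\<in>{0<..}. principal {(f, g). dist f (g :: ('a, 'b) l2) < e})"
    by (rule uniformity_l2_def)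
  show "open U = (\<forall>x\<in>U. \<forall>\<^sub>F (x', y) in uniformity. x' = x \<longrightarrow> y \<in> U)" for U :: "('a, 'b) l2 set"
    by (rule open_l2_def)
  show "a \<bullet> b = b \<bullet> a" by transfer (simp add: L2_inner_def inner_commute)
  show "(a + b) \<bullet> c = a \<bullet> c + b \<bullet> c"
    by transfer (simp add: L2_inner_def l2_rel_def inner_add_left L2_inner_integrable)
  show "r *\<^sub>R a \<bullet> b = r * (a \<bullet> b)" by transfer (simp add: L2_inner_def)
  show "0 \<le> a \<bullet> a" by transfer (simp add: L2_inner_def)
  show "(a \<bullet> a = 0) = (a = 0)"
  proof transfer
    fix f :: "real^'a \<Rightarrow> 'b" assume "l2_rel f f"
    then have f: "f \<in> L2 UNIV" by (simp add: l2_rel_def)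
    show "(L2_inner UNIV f f = 0) = l2_rel f (\<lambda>x. 0)"
      unfolding L2_inner_def l2_rel_def
      by (subst integral_nonneg_eq_0_iff_AE[OF L2_inner_integrable[OF f f]]) (use f L2_zero in auto)
  qed
  show "norm a = sqrt (a \<bullet> a)" by (rule norm_l2_def)
qed

end

lemma rep_l2_in: "rep_l2 a \<in> L2 UNIV"
  using Quotient3_rep_reflp[OF Quotient3_l2, of a] by (simp add: l2_rel_def)

lemma abs_rep_l2: "abs_l2 (rep_l2 a) = a"
  by (rule Quotient3_abs_rep[OF Quotient3_l2])

lemma rep_abs_l2: "f \<in> L2 UNIV \<Longrightarrow> AE x in lebesgue_on UNIV. rep_l2 (abs_l2 f) x = f x"
  using Quotient3_rep_abs[OF Quotient3_l2, of f] by (simp add: l2_rel_def)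

lemma abs_l2_eq_iff:
  "f \<in> L2 UNIV \<Longrightarrow> g \<in> L2 UNIV \<Longrightarrow> abs_l2 f = abs_l2 g \<longleftrightarrow> (AE x in lebesgue_on UNIV. f x = g x)"
  using Quotient3_rel[OF Quotient3_l2, of f g] by (auto simp: l2_rel_def)

lemma abs_l2_add: "f \<in> L2 UNIV \<Longrightarrow> g \<in> L2 UNIV \<Longrightarrow> abs_l2 f + abs_l2 g = abs_l2 (\<lambda>x. f x + g x)"
  by (intro plus_l2.abs_eq) (auto simp: l2_rel_def)

lemma abs_l2_diff: "f \<in> L2 UNIV \<Longrightarrow> g \<in> L2 UNIV \<Longrightarrow> abs_l2 f - abs_l2 g = abs_l2 (\<lambda>x. f x - g x)"
  by (intro minus_l2.abs_eq) (auto simp: l2_rel_def)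

lemma abs_l2_scaleR: "f \<in> L2 UNIV \<Longrightarrow> c *\<^sub>R abs_l2 f = abs_l2 (\<lambda>x. c *\<^sub>R f x)"
  by (intro scaleR_l2.abs_eq) (auto simp: l2_rel_def)

lemma abs_l2_inner: "f \<in> L2 UNIV \<Longrightarrow> g \<in> L2 UNIV \<Longrightarrow> abs_l2 f \<bullet> abs_l2 g = L2_inner UNIV f g"
  by (intro inner_l2.abs_eq) (auto simp: l2_rel_def)

instance l2 :: (finite, euclidean_space) complete_space
proof
  fix X :: "nat \<Rightarrow> ('a, 'b) l2" assume X: "Cauchy X"
  have eq: "(norm (abs_l2 f - X n))\<^sup>2 = L2_inner UNIV (\<lambda>x. f x - rep_l2 (X n) x) (\<lambda>x. f x - rep_l2 (X n) x)"
    if "f \<in> L2 UNIV" for f n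
  proof -
    have "abs_l2 f - X n = abs_l2 (\<lambda>x. f x - rep_l2 (X n) x)"
      using abs_l2_diff[OF that rep_l2_in[of "X n"]] by (simp add: abs_rep_l2)
    then show ?thesis
      by (simp add: power2_norm_eq_inner abs_l2_inner L2_diff[OF that rep_l2_in])
  qed
  have "\<exists>F\<in>L2 UNIV. \<forall>e>0. \<exists>M. \<forall>n\<ge>M. L2_inner UNIV (\<lambda>x. F x - rep_l2 (X n) x) (\<lambda>x. F x - rep_l2 (X n) x) \<le> e"
  proof (rule L2_complete[OF rep_l2_in])
    fix e :: real assume e: "0 < e"
    then obtain M where M: "\<And>m n. m \<ge> M \<Longrightarrow> n \<ge> M \<Longrightarrow> norm (X m - X n) < sqrt e"
      using CauchyD[OF X, of "sqrt e"] by auto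
    have "L2_inner UNIV (\<lambda>x. rep_l2 (X m) x - rep_l2 (X n) x) (\<lambda>x. rep_l2 (X m) x - rep_l2 (X n) x) < e"
      if "m \<ge> M" "n \<ge> M" for m n
    proof -
      have "(norm (X m - X n))\<^sup>2 < (sqrt e)\<^sup>2" using M[OF that] by (intro power_strict_mono) auto
      then show ?thesis using eq[OF rep_l2_in, of "X m" n] e by (simp add: abs_rep_l2)
    qed
    then show "\<exists>M. \<forall>m\<ge>M. \<forall>n\<ge>M. L2_inner UNIV (\<lambda>x. rep_l2 (X m) x - rep_l2 (X n) x)
        (\<lambda>x. rep_l2 (X m) x - rep_l2 (X n) x) < e" by blast
  qed
  then obtain F where F: "F \<in> L2 UNIV"
    "\<And>e. 0 < e \<Longrightarrow> \<exists>M. \<forall>n\<ge>M. L2_inner UNIV (\<lambda>x. F x - rep_l2 (X n) x) (\<lambda>x. F x - rep_l2 (X n) x) \<le> e"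
    by blast
  have "X \<longlonglongrightarrow> abs_l2 F"
  proof (rule LIMSEQ_I)
    fix r :: real assume r: "0 < r"
    then have "0 < r\<^sup>2 / 2" by simp
    from F(2)[OF this] obtain M where M: "\<And>n. n \<ge> M \<Longrightarrow> (norm (abs_l2 F - X n))\<^sup>2 \<le> r\<^sup>2 / 2"
      using eq[OF F(1)] by auto
    have "norm (X n - abs_l2 F) < r" if "n \<ge> M" for n
    proof (rule power2_less_imp_less)
      have "0 < r\<^sup>2" using r by simp
      then show "(norm (X n - abs_l2 F))\<^sup>2 < r\<^sup>2"
        using M[OF that] unfolding norm_minus_commute[of "X n"] by linarith
    qed (use r in simp)
    then show "\<exists>M. \<forall>n\<ge>M. norm (X n - abs_l2 F) < r" by blast
  qed
  then show "convergent X" by (rule convergentI)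
qed

subsection \<open>Zero extension\<close>

definition emb :: "(real^'d) set \<Rightarrow> (real^'d::finite \<Rightarrow> 'b::euclidean_space) \<Rightarrow> ('d, 'b) l2" where
  "emb \<Omega> f = abs_l2 (\<lambda>x. indicator \<Omega> x *\<^sub>R f x)"

context
  fixes \<Omega> :: "(real^'d::finite) set" assumes \<Omega>: "\<Omega> \<in> sets lebesgue"
begin

lemma lebesgue_on_UNIV_sets: "\<Omega> \<inter> space lebesgue \<in> sets lebesgue"
  using \<Omega> by simp

lemma L2_extend_iff: "f \<in> L2 \<Omega> \<longleftrightarrow> (\<lambda>x. indicator \<Omega> x *\<^sub>R f x) \<in> L2 UNIV"
proof -
  have *: "indicator \<Omega> x *\<^sub>R (norm (f x))\<^sup>2 = (norm (indicator \<Omega> x *\<^sub>R f x))\<^sup>2" for x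
    by (simp add: indicator_def)
  show ?thesis unfolding L2_def mem_Collect_eq
    integrable_restrict_space[OF lebesgue_on_UNIV_sets] borel_measurable_restrict_space_iff[OF lebesgue_on_UNIV_sets]
    by (simp only: lebesgue_on_UNIV_eq *)
qed

lemma L2_subset:
  assumes "f \<in> L2 UNIV" shows "f \<in> L2 \<Omega>"
proof -
  have f: "f \<in> borel_measurable lebesgue" "integrable lebesgue (\<lambda>x. (norm (f x))\<^sup>2)"
    using assms by (auto simp: L2_def lebesgue_on_UNIV_eq)
  note [measurable] = f(1) \<Omega>
  have "integrable lebesgue (\<lambda>x. indicator \<Omega> x *\<^sub>R (norm (f x))\<^sup>2)"
    by (rule integrable_mult_indicator[OF \<Omega> f(2)])
  then have "integrable (lebesgue_on \<Omega>) (\<lambda>x. (norm (f x))\<^sup>2)"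
    by (simp only: integrable_restrict_space[OF lebesgue_on_UNIV_sets])
  moreover have "f \<in> borel_measurable (lebesgue_on \<Omega>)" using f(1) by (rule measurable_restrict_space1)
  ultimately show ?thesis by (simp add: L2_def)
qed

lemma AE_extend_iff:
  "(AE x in lebesgue_on UNIV. indicator \<Omega> x *\<^sub>R f x = indicator \<Omega> x *\<^sub>R (g x :: 'b::euclidean_space))
     \<longleftrightarrow> (AE x in lebesgue_on \<Omega>. f x = g x)"
  unfolding AE_restrict_space_iff[OF lebesgue_on_UNIV_sets] lebesgue_on_UNIV_eq
  by (intro AE_cong) (auto simp: indicator_def)

lemma emb_eq_iff: "f \<in> L2 \<Omega> \<Longrightarrow> g \<in> L2 \<Omega> \<Longrightarrow> emb \<Omega> f = emb \<Omega> g \<longleftrightarrow> (AE x in lebesgue_on \<Omega>. f x = g x)"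
  unfolding emb_def AE_extend_iff[symmetric] L2_extend_iff by (rule abs_l2_eq_iff)

lemma emb_add: "f \<in> L2 \<Omega> \<Longrightarrow> g \<in> L2 \<Omega> \<Longrightarrow> emb \<Omega> (\<lambda>x. f x + g x) = emb \<Omega> f + emb \<Omega> g"
  unfolding emb_def L2_extend_iff scaleR_add_right by (rule abs_l2_add[symmetric])

lemma emb_diff: "f \<in> L2 \<Omega> \<Longrightarrow> g \<in> L2 \<Omega> \<Longrightarrow> emb \<Omega> (\<lambda>x. f x - g x) = emb \<Omega> f - emb \<Omega> g"
  unfolding emb_def L2_extend_iff scaleR_diff_right by (rule abs_l2_diff[symmetric])

lemma emb_scaleR: "f \<in> L2 \<Omega> \<Longrightarrow> emb \<Omega> (\<lambda>x. c *\<^sub>R f x) = c *\<^sub>R emb \<Omega> f"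
  unfolding emb_def L2_extend_iff scaleR_left_commute[of _ c] by (rule abs_l2_scaleR[symmetric])

lemma emb_inner: "f \<in> L2 \<Omega> \<Longrightarrow> g \<in> L2 \<Omega> \<Longrightarrow> emb \<Omega> f \<bullet> emb \<Omega> g = L2_inner \<Omega> f g"
proof -
  assume fg: "f \<in> L2 \<Omega>" "g \<in> L2 \<Omega>"
  have *: "indicator \<Omega> x *\<^sub>R (f x \<bullet> g x) = (indicator \<Omega> x *\<^sub>R f x) \<bullet> (indicator \<Omega> x *\<^sub>R g x)" for x
    by (simp add: indicator_def)
  show ?thesis using fg unfolding emb_def L2_extend_iff
    by (simp only: abs_l2_inner L2_inner_def integral_restrict_space[OF lebesgue_on_UNIV_sets]
      lebesgue_on_UNIV_eq *)
qed

lemma emb_norm: "f \<in> L2 \<Omega> \<Longrightarrow> norm (emb \<Omega> f) = L2_norm \<Omega> f"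
  by (simp add: norm_eq_sqrt_inner emb_inner L2_norm_def)

lemma rep_l2_L2: "rep_l2 a \<in> L2 \<Omega>"
  by (rule L2_subset[OF rep_l2_in])

lemma emb_rep_inner: "f \<in> L2 \<Omega> \<Longrightarrow> emb \<Omega> f \<bullet> a = L2_inner \<Omega> f (rep_l2 a)"
proof -
  assume f: "f \<in> L2 \<Omega>"
  have *: "indicator \<Omega> x *\<^sub>R (f x \<bullet> rep_l2 a x) = (indicator \<Omega> x *\<^sub>R f x) \<bullet> rep_l2 a x" for x
    by (simp add: indicator_def)
  have "emb \<Omega> f \<bullet> a = emb \<Omega> f \<bullet> abs_l2 (rep_l2 a)" by (simp add: abs_rep_l2)
  also have "\<dots> = L2_inner UNIV (\<lambda>x. indicator \<Omega> x *\<^sub>R f x) (rep_l2 a)"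
    unfolding emb_def using f L2_extend_iff rep_l2_in by (intro abs_l2_inner) auto
  also have "\<dots> = L2_inner \<Omega> f (rep_l2 a)"
    by (simp add: L2_inner_def integral_restrict_space[OF lebesgue_on_UNIV_sets] lebesgue_on_UNIV_eq *)
  finally show ?thesis .
qed

text \<open>Taking a representative and embedding it is multiplication by the indicator of \<Omega>.
  This map is symmetric, hence its fixed points are described by continuous linear equations. Limits
  of test functions are therefore still classes supported in \<Omega>.\<close>

lemma closed_range_emb: "closed {a :: ('d, 'b::euclidean_space) l2. emb \<Omega> (rep_l2 a) = a}"
proof -
  have sym: "emb \<Omega> (rep_l2 a) \<bullet> b = a \<bullet> emb \<Omega> (rep_l2 b)" for a b :: "('d, 'b) l2"
    using emb_rep_inner[OF rep_l2_L2, of a b] emb_rep_inner[OF rep_l2_L2, of b a]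
    by (simp add: L2_inner_def inner_commute)
  have "emb \<Omega> (rep_l2 a) = a \<longleftrightarrow> (\<forall>b. a \<bullet> emb \<Omega> (rep_l2 b) = a \<bullet> b)" for a :: "('d, 'b) l2"
    unfolding sym[symmetric] by (metis inner_commute vector_eq_rdot)
  then have "{a :: ('d, 'b) l2. emb \<Omega> (rep_l2 a) = a} = (\<Inter>b. {a. a \<bullet> emb \<Omega> (rep_l2 b) = a \<bullet> b})"
    by auto
  then show ?thesis by (auto intro!: closed_INT closed_Collect_eq continuous_intros)
qed

lemma emb_rep_emb: "f \<in> L2 \<Omega> \<Longrightarrow> emb \<Omega> (rep_l2 (emb \<Omega> f)) = emb \<Omega> f"
proof -
  assume f: "f \<in> L2 \<Omega>"
  then have "(\<lambda>x. indicator \<Omega> x *\<^sub>R f x) \<in> L2 UNIV" using L2_extend_iff by blast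
  from rep_abs_l2[OF this] have "AE x in lebesgue_on UNIV. rep_l2 (emb \<Omega> f) x = indicator \<Omega> x *\<^sub>R f x"
    by (simp add: emb_def)
  then have "AE x in lebesgue_on UNIV. indicator \<Omega> x *\<^sub>R rep_l2 (emb \<Omega> f) x = indicator \<Omega> x *\<^sub>R f x"
    by eventually_elim (simp add: indicator_def)
  then show ?thesis using emb_eq_iff[OF rep_l2_L2 f] AE_extend_iff by blast
qed

end

subsection \<open>Smooth functions\<close>

lemma has_derivative_cgrad:
  assumes "\<phi> differentiable (at x)" shows "(\<phi> has_derivative (\<lambda>v. cgrad \<phi> x \<bullet> v)) (at x)"
proof -
  define f where "f = frechet_derivative \<phi> (at x)"
  have f: "(\<phi> has_derivative f) (at x)"
    using assms frechet_derivative_works unfolding f_def by blast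
  then have lin: "linear f" by (rule has_derivative_linear)
  have "f v = cgrad \<phi> x \<bullet> v" for v
  proof -
    have "v = (\<Sum>i\<in>UNIV. v $ i *\<^sub>R axis i 1)"
      using basis_expansion[of v] by (simp add: scalar_mult_eq_scaleR)
    then have "f v = (\<Sum>i\<in>UNIV. v $ i * f (axis i 1))"
      using linear_sum[OF lin, of "\<lambda>i. v $ i *\<^sub>R axis i 1" UNIV] linear_scale[OF lin] by simp
    then show ?thesis by (simp add: inner_vec_def cgrad_def f_def mult.commute)
  qed
  then have "f = (\<lambda>v. cgrad \<phi> x \<bullet> v)" by blast
  with f show ?thesis by simp
qed

lemma cgrad_eqI:
  assumes "(\<phi> has_derivative (\<lambda>v. g \<bullet> v)) (at x)" shows "cgrad \<phi> x = g"
proof -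
  have "frechet_derivative \<phi> (at x) = (\<lambda>v. g \<bullet> v)" using frechet_derivative_at[OF assms] by simp
  then show ?thesis by (simp add: cgrad_def vec_eq_iff inner_axis)
qed

lemma k_times_cont_diff_Suc_D: "k_times_cont_diff (Suc k) \<phi> \<Longrightarrow> k_times_cont_diff k \<phi>"
proof (induction k arbitrary: \<phi>)
  case 0
  then have "continuous (at x) \<phi>" for x
    by (auto intro: differentiable_imp_continuous_within)
  then show ?case by (simp add: continuous_at_imp_continuous_on)
next
  case (Suc k)
  then have "k_times_cont_diff (Suc k) (\<lambda>x. cgrad \<phi> x $ i)" for i
    by (subst (asm) k_times_cont_diff.simps) blast
  then have "k_times_cont_diff k (\<lambda>x. cgrad \<phi> x $ i)" for i by (rule Suc.IH)
  then show ?case using Suc.prems by simp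
qed

lemma k_times_cont_diff_const: "k_times_cont_diff k (\<lambda>x :: real^'d::finite. c)"
proof (induction k arbitrary: c)
  case (Suc k)
  have "cgrad (\<lambda>x. c) x = 0" for x :: "real^'d" by (rule cgrad_eqI) simp
  then show ?case using Suc[of 0] by simp
qed simp

lemma k_times_cont_diff_add:
  "k_times_cont_diff k \<phi> \<Longrightarrow> k_times_cont_diff k \<psi> \<Longrightarrow> k_times_cont_diff k (\<lambda>x. \<phi> x + \<psi> x)"
proof (induction k arbitrary: \<phi> \<psi>)
  case 0
  then show ?case by (simp add: continuous_on_add)
next
  case (Suc k)
  then have d: "\<phi> differentiable (at x)" "\<psi> differentiable (at x)" for x by auto
  have "cgrad (\<lambda>x. \<phi> x + \<psi> x) x = cgrad \<phi> x + cgrad \<psi> x" for x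
    using has_derivative_add[OF has_derivative_cgrad[OF d(1)] has_derivative_cgrad[OF d(2)]]
    by (intro cgrad_eqI) (simp add: inner_add_left)
  then show ?case using Suc d by (auto intro: differentiable_add)
qed

lemma k_times_cont_diff_mult:
  "k_times_cont_diff k \<phi> \<Longrightarrow> k_times_cont_diff k \<psi> \<Longrightarrow> k_times_cont_diff k (\<lambda>x. \<phi> x * \<psi> x)"
proof (induction k arbitrary: \<phi> \<psi>)
  case 0
  then show ?case by (simp add: continuous_on_mult)
next
  case (Suc k)
  then have d: "\<phi> differentiable (at x)" "\<psi> differentiable (at x)" for x by auto
  have "cgrad (\<lambda>x. \<phi> x * \<psi> x) x = \<phi> x *\<^sub>R cgrad \<psi> x + \<psi> x *\<^sub>R cgrad \<phi> x" for x
    using has_derivative_mult[OF has_derivative_cgrad[OF d(1)] has_derivative_cgrad[OF d(2)]]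
    by (intro cgrad_eqI) (simp add: inner_add_left mult.commute)
  moreover have "k_times_cont_diff k (\<lambda>x. \<phi> x * cgrad \<psi> x $ i + \<psi> x * cgrad \<phi> x $ i)" for i
    using Suc.prems k_times_cont_diff_Suc_D[OF Suc.prems(1)] k_times_cont_diff_Suc_D[OF Suc.prems(2)]
    by (intro k_times_cont_diff_add Suc.IH) auto
  ultimately show ?case using d by simp
qed

lemma k_times_cont_diff_prod:
  "(\<And>l. l \<in> I \<Longrightarrow> k_times_cont_diff k (f l)) \<Longrightarrow> k_times_cont_diff k (\<lambda>x. \<Prod>l\<in>I. f l x)"
  by (induction I rule: infinite_finite_induct) (auto intro: k_times_cont_diff_const k_times_cont_diff_mult)

text \<open>The family is closed under differentiation up to linear combinations; its member for
  \<open>k = 0\<close> is the classical smooth function vanishing on the negative axis.\<close>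
definition expinv :: "nat \<Rightarrow> real \<Rightarrow> real" where
  "expinv k t = (if t \<le> 0 then 0 else inverse t ^ k * exp (- inverse t))"

lemma expinv_tendsto_0: "(expinv k \<longlongrightarrow> 0) (at_right 0)"
proof -
  have "((\<lambda>t. inverse t ^ k / exp (inverse t :: real)) \<longlongrightarrow> 0) (at_right 0)"
    by (rule filterlim_compose[OF tendsto_power_div_exp_0 filterlim_inverse_at_top_right])
  moreover have "eventually (\<lambda>t. inverse t ^ k / exp (inverse t) = expinv k t) (at_right 0)"
    unfolding eventually_at_right_field
    by (intro exI[of _ 1]) (auto simp: expinv_def exp_minus divide_inverse)
  ultimately show ?thesis by (rule Lim_transform_eventually)
qed

text \<open>Away from 0 this is the product rule. At 0 the right difference quotient of member k is
  member k + 1 itself, which tends to zero.\<close>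

lemma DERIV_expinv: "(expinv k has_real_derivative expinv (k + 2) t - real k * expinv (k + 1) t) (at t)"
proof (cases t "0 :: real" rule: linorder_cases)
  case less
  have "((\<lambda>_. 0) has_real_derivative 0) (at t)" by simp
  moreover have "eventually (\<lambda>s. 0 = expinv k s) (nhds t)"
    using eventually_nhds_in_open[of "{..<0}" t] less by (auto simp: expinv_def elim!: eventually_mono)
  ultimately have "(expinv k has_real_derivative 0) (at t)"
    using DERIV_cong_ev[of t t "\<lambda>_. 0" "expinv k" 0 0] by simp
  then show ?thesis using less by (simp add: expinv_def)
next
  case equal
  have "((\<lambda>h. (expinv k h - expinv k 0) / h) \<longlongrightarrow> 0) (at 0)"
  proof (rule filterlim_split_at)
    have "eventually (\<lambda>h. 0 = (expinv k h - expinv k 0) / h) (at_left 0)"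
      unfolding eventually_at_left_field by (intro exI[of _ "-1"]) (auto simp: expinv_def)
    then show "((\<lambda>h. (expinv k h - expinv k 0) / h) \<longlongrightarrow> 0) (at_left 0)"
      by (rule Lim_transform_eventually[rotated]) simp
    have "eventually (\<lambda>h. expinv (k + 1) h = (expinv k h - expinv k 0) / h) (at_right 0)"
      unfolding eventually_at_right_field by (intro exI[of _ 1]) (auto simp: expinv_def field_simps)
    then show "((\<lambda>h. (expinv k h - expinv k 0) / h) \<longlongrightarrow> 0) (at_right 0)"
      by (rule Lim_transform_eventually[rotated]) (rule expinv_tendsto_0)
  qed
  then have "(expinv k has_real_derivative 0) (at 0)"
    by (simp add: has_field_derivative_iff)
  then show ?thesis using equal by (simp add: expinv_def)
next
  case greater
  have "((\<lambda>s. inverse s ^ k * exp (- inverse s)) has_real_derivative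
      inverse t ^ k * (exp (- inverse t) * (inverse t * inverse t)) +
      real k * (- (inverse t * inverse t)) * inverse t ^ (k - 1) * exp (- inverse t)) (at t)"
    using greater by (auto intro!: derivative_eq_intros simp: power2_eq_square)
  also have "inverse t ^ k * (exp (- inverse t) * (inverse t * inverse t)) +
      real k * (- (inverse t * inverse t)) * inverse t ^ (k - 1) * exp (- inverse t)
      = expinv (k + 2) t - real k * expinv (k + 1) t"
    using greater by (cases k) (auto simp: expinv_def algebra_simps)
  finally have "((\<lambda>s. inverse s ^ k * exp (- inverse s)) has_real_derivative
      expinv (k + 2) t - real k * expinv (k + 1) t) (at t)" .
  moreover have "eventually (\<lambda>s. inverse s ^ k * exp (- inverse s) = expinv k s) (nhds t)"
    using eventually_nhds_in_open[of "{0<..}" t] greater by (auto simp: expinv_def elim!: eventually_mono)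
  ultimately show ?thesis
    using DERIV_cong_ev[of t t "\<lambda>s. inverse s ^ k * exp (- inverse s)" "expinv k"] by blast
qed

text \<open>The induction runs over all exponents n at once, since differentiation leads to n + 1
  and n + 2. The affine argument covers both faces of a box in direction i.\<close>

lemma k_times_cont_diff_expinv:
  fixes i :: "'d::finite"
  shows "k_times_cont_diff k (\<lambda>x :: real^'d. expinv n (a * x $ i + b))"
proof (induction k arbitrary: n)
  have der: "((\<lambda>x :: real^'d. expinv n (a * x $ i + b)) has_derivative
     (\<lambda>v. axis i ((expinv (n + 2) (a * x $ i + b) - real n * expinv (n + 1) (a * x $ i + b)) * a) \<bullet> v)) (at x)"
    for n and x :: "real^'d"
  proof -
    have "((\<lambda>x. a * x $ i + b) has_derivative (\<lambda>v. a * v $ i)) (at x)"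
      by (auto intro!: derivative_eq_intros bounded_linear.has_derivative[OF bounded_linear_vec_nth])
    from has_derivative_compose[OF this DERIV_expinv[of n "a * x $ i + b", unfolded has_field_derivative_def]]
    show ?thesis by (simp add: inner_axis' mult_ac)
  qed
  {
    case 0
    show ?case using der[of n] by (auto intro!: continuous_at_imp_continuous_on has_derivative_continuous)
  next
    case (Suc k)
    have g: "cgrad (\<lambda>x :: real^'d. expinv n (a * x $ i + b)) x $ j = (if j = i then a else 0) *
        (expinv (n + 2) (a * x $ i + b) + (- real n) * expinv (n + 1) (a * x $ i + b))" for x :: "real^'d" and j
      unfolding cgrad_eqI[OF der] by (simp add: axis_def mult.commute)
    show ?case unfolding k_times_cont_diff.simps g
    proof (intro conjI allI)
      show "(\<lambda>x :: real^'d. expinv n (a * x $ i + b)) differentiable (at x)" for x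
        using der[of n x] unfolding differentiable_def by blast
    qed (intro k_times_cont_diff_add k_times_cont_diff_mult k_times_cont_diff_const Suc.IH)
  }
qed

lemma test_funD:
  assumes "\<phi> \<in> test_fun \<Omega>"
  shows "k_times_cont_diff k \<phi>" "compact (closure {x. \<phi> x \<noteq> 0})" "closure {x. \<phi> x \<noteq> 0} \<subseteq> \<Omega>"
    "\<phi> differentiable (at x)" "(\<phi> has_derivative (\<lambda>v. cgrad \<phi> x \<bullet> v)) (at x)"
    "continuous_on UNIV \<phi>" "continuous_on UNIV (\<lambda>x. cgrad \<phi> x $ i)"
proof -
  have s: "k_times_cont_diff k \<phi>" for k using assms by (simp add: test_fun_def)
  show "k_times_cont_diff k \<phi>" by (rule s)
  show "compact (closure {x. \<phi> x \<noteq> 0})" "closure {x. \<phi> x \<noteq> 0} \<subseteq> \<Omega>"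
    using assms by (auto simp: test_fun_def)
  show d: "\<phi> differentiable (at x)" using s[of "Suc 0"] by simp
  then show "(\<phi> has_derivative (\<lambda>v. cgrad \<phi> x \<bullet> v)) (at x)" by (rule has_derivative_cgrad)
  show "continuous_on UNIV \<phi>" using s[of 0] by simp
  show "continuous_on UNIV (\<lambda>x. cgrad \<phi> x $ i)" using s[of "Suc 0"] by simp
qed

lemma continuous_cgrad: "\<phi> \<in> test_fun \<Omega> \<Longrightarrow> continuous_on UNIV (cgrad \<phi>)"
  unfolding continuous_on_componentwise[of _ "cgrad \<phi>"] Basis_vec_def
  by (auto simp: inner_axis intro: test_funD)

lemma cgrad_eq_0:
  assumes "\<phi> \<in> test_fun \<Omega>" "x \<notin> closure {x. \<phi> x \<noteq> 0}" shows "cgrad \<phi> x = 0"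
proof (rule cgrad_eqI)
  have "((\<lambda>_. 0) has_derivative (\<lambda>v. 0)) (at x)" by simp
  then have "(\<phi> has_derivative (\<lambda>v. 0)) (at x)"
    by (rule has_derivative_transform_within_open[OF _ open_Compl[OF closed_closure]])
      (use assms(2) closure_subset[of "{x. \<phi> x \<noteq> 0}"] in auto)
  then show "(\<phi> has_derivative (\<lambda>v. 0 \<bullet> v)) (at x)" by simp
qed

lemma test_fun_zero: "(\<lambda>x. 0) \<in> test_fun \<Omega>"
  by (simp add: test_fun_def k_times_cont_diff_const)

lemma test_fun_scale_add:
  assumes \<phi>: "\<phi> \<in> test_fun \<Omega>" and \<psi>: "\<psi> \<in> test_fun \<Omega>"
  shows "(\<lambda>x. c * \<phi> x + \<psi> x) \<in> test_fun \<Omega>"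
    "cgrad (\<lambda>x. c * \<phi> x + \<psi> x) x = c *\<^sub>R cgrad \<phi> x + cgrad \<psi> x"
proof -
  have sub: "closure {x. c * \<phi> x + \<psi> x \<noteq> 0} \<subseteq> closure {x. \<phi> x \<noteq> 0} \<union> closure {x. \<psi> x \<noteq> 0}"
    unfolding closure_Un[symmetric] by (intro closure_mono) auto
  have "compact (closure {x. c * \<phi> x + \<psi> x \<noteq> 0})"
    using compact_Int_closed[OF compact_Un[OF test_funD(2)[OF \<phi>] test_funD(2)[OF \<psi>]] closed_closure,
        of "{x. c * \<phi> x + \<psi> x \<noteq> 0}"]
    unfolding Int_absorb1[OF sub] .
  then show "(\<lambda>x. c * \<phi> x + \<psi> x) \<in> test_fun \<Omega>"
    using sub test_funD(3)[OF \<phi>] test_funD(3)[OF \<psi>] test_funD(1)[OF \<phi>] test_funD(1)[OF \<psi>]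
    by (auto simp: test_fun_def intro!: k_times_cont_diff_add k_times_cont_diff_mult k_times_cont_diff_const)
  show "cgrad (\<lambda>x. c * \<phi> x + \<psi> x) x = c *\<^sub>R cgrad \<phi> x + cgrad \<psi> x"
    by (rule cgrad_eqI) (auto intro!: derivative_eq_intros test_funD(5)[OF \<phi>] test_funD(5)[OF \<psi>] simp: inner_add_left)
qed

subsection \<open>The fundamental lemma of the calculus of variations\<close>

text \<open>Smooth functions that are positive exactly in the open box. As exp (- 1 / t) tends to 1
  for large t, scaling the distances to the faces by \<open>Suc n\<close> makes them tend to the
  indicator of the box.\<close>

definition bump :: "real^'d \<Rightarrow> real^'d \<Rightarrow> nat \<Rightarrow> real^'d::finite \<Rightarrow> real" where
  "bump a b n x = (\<Prod>i\<in>UNIV. expinv 0 (real (Suc n) * (x $ i - a $ i)) * expinv 0 (real (Suc n) * (b $ i - x $ i)))"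

lemma expinv_0_bounds: "0 \<le> expinv 0 t" "expinv 0 t \<le> 1"
  by (auto simp: expinv_def)

lemma bump_bounds: "0 \<le> bump a b n x" "bump a b n x \<le> 1"
  unfolding bump_def
  by (auto intro!: prod_nonneg prod_le_1 mult_nonneg_nonneg mult_le_one expinv_0_bounds)

lemma bump_eq_0_iff: "bump a b n x = 0 \<longleftrightarrow> x \<notin> box a b"
proof -
  have "expinv 0 t = 0 \<longleftrightarrow> t \<le> 0" for t by (simp add: expinv_def)
  then have "bump a b n x = 0 \<longleftrightarrow> (\<exists>i. x $ i \<le> a $ i \<or> b $ i \<le> x $ i)"
    by (simp add: bump_def mult_le_0_iff del: of_nat_Suc)
  then show ?thesis by (simp only: mem_box_cart not_all de_Morgan_conj not_less)
qed

lemma bump_test_fun: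
  assumes "cbox a b \<subseteq> \<Omega>" shows "bump a b n \<in> test_fun \<Omega>"
proof -
  have "k_times_cont_diff k (bump a b n)" for k
  proof -
    have "k_times_cont_diff k (\<lambda>x. expinv 0 (real (Suc n) * x $ i + - real (Suc n) * a $ i) *
        expinv 0 (- real (Suc n) * x $ i + real (Suc n) * b $ i))" for i
      by (intro k_times_cont_diff_mult k_times_cont_diff_expinv)
    then have "k_times_cont_diff k (\<lambda>x. \<Prod>i\<in>UNIV. expinv 0 (real (Suc n) * x $ i + - real (Suc n) * a $ i) *
        expinv 0 (- real (Suc n) * x $ i + real (Suc n) * b $ i))" by (intro k_times_cont_diff_prod)
    moreover have "bump a b n = (\<lambda>x. \<Prod>i\<in>UNIV. expinv 0 (real (Suc n) * x $ i + - real (Suc n) * a $ i) *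
        expinv 0 (- real (Suc n) * x $ i + real (Suc n) * b $ i))"
      by (simp add: bump_def fun_eq_iff right_diff_distrib) (simp add: algebra_simps)
    ultimately show ?thesis by simp
  qed
  moreover have sub: "closure {x. bump a b n x \<noteq> 0} \<subseteq> cbox a b"
    unfolding bump_eq_0_iff by (intro closure_minimal) (use box_subset_cbox in auto)
  moreover have "compact (closure {x. bump a b n x \<noteq> 0})"
    using bounded_subset[OF bounded_cbox sub] by (simp add: compact_eq_bounded_closed)
  ultimately show ?thesis using assms by (auto simp: test_fun_def)
qed

lemma bump_tendsto: "(\<lambda>n. bump a b n x) \<longlonglongrightarrow> indicator (box a b) x"
proof (cases "x \<in> box a b")
  case False
  then have "bump a b n x = 0" for n by (simp add: bump_eq_0_iff)
  then show ?thesis using False by simp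
next
  case True
  have *: "(\<lambda>n. expinv 0 (real (Suc n) * c)) \<longlonglongrightarrow> 1" if c: "0 < c" for c
  proof -
    have "(\<lambda>n. exp (- (inverse (real (Suc n)) * inverse c))) \<longlonglongrightarrow> exp (- (0 * inverse c))"
      by (intro tendsto_intros LIMSEQ_inverse_real_of_nat)
    moreover have "expinv 0 (real (Suc n) * c) = exp (- (inverse (real (Suc n)) * inverse c))" for n
      using c by (simp add: expinv_def zero_less_mult_iff not_le del: of_nat_Suc)
    ultimately show ?thesis by simp
  qed
  have "(\<lambda>n. bump a b n x) \<longlonglongrightarrow> (\<Prod>i\<in>(UNIV::'a set). 1 * 1)"
    unfolding bump_def by (intro tendsto_prod tendsto_mult *) (use True in \<open>auto simp: mem_box_cart\<close>)
  then show ?thesis using True by simp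
qed

lemma continuous_lebesgue_measurable:
  fixes f :: "real^'d::finite \<Rightarrow> 'b::euclidean_space"
  assumes "continuous_on UNIV f" shows "f \<in> borel_measurable lebesgue" "f \<in> borel_measurable (lebesgue_on \<Omega>)"
proof -
  show "f \<in> borel_measurable lebesgue"
    by (rule measurable_completion) (use assms in \<open>simp add: borel_measurable_continuous_onI\<close>)
  then show "f \<in> borel_measurable (lebesgue_on \<Omega>)" by (rule measurable_restrict_space1)
qed

lemma continuous_compact_support_integrable:
  fixes f :: "real^'d::finite \<Rightarrow> 'b::euclidean_space"
  assumes f: "continuous_on UNIV f" and K: "compact K" "\<And>x. x \<notin> K \<Longrightarrow> f x = 0"
  shows "integrable lborel f" "integrable lebesgue f"
proof -
  have "integrable lborel (\<lambda>x. indicator K x *\<^sub>R f x)"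
    using K f by (intro borel_integrable_compact) (auto intro: continuous_on_subset)
  also have "(\<lambda>x. indicator K x *\<^sub>R f x) = f" using K(2) by (auto simp: fun_eq_iff indicator_def)
  finally show "integrable lborel f" .
  then show "integrable lebesgue f" by (subst integrable_completion) auto
qed

lemma continuous_compact_support_L2:
  fixes f :: "real^'d::finite \<Rightarrow> 'b::euclidean_space"
  assumes f: "continuous_on UNIV f" and K: "compact K" "\<And>x. x \<notin> K \<Longrightarrow> f x = 0" and \<Omega>: "\<Omega> \<in> sets lebesgue"
  shows "f \<in> L2 \<Omega>"
proof (rule L2_subset[OF \<Omega>])
  have "integrable lebesgue (\<lambda>x. (norm (f x))\<^sup>2)"
    by (rule continuous_compact_support_integrable(2)[OF _ K(1)]) (auto intro!: continuous_intros f simp: K(2))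
  then show "f \<in> L2 UNIV"
    using continuous_lebesgue_measurable(1)[OF f] by (simp add: L2_def lebesgue_on_UNIV_eq)
qed

lemma test_fun_outside: "\<phi> \<in> test_fun \<Omega> \<Longrightarrow> x \<notin> closure {x. \<phi> x \<noteq> 0} \<Longrightarrow> \<phi> x = 0"
  using closure_subset[of "{x. \<phi> x \<noteq> 0}"] by auto

lemma test_fun_L2:
  assumes "\<phi> \<in> test_fun \<Omega>" "\<Omega>' \<in> sets lebesgue"
  shows "\<phi> \<in> L2 \<Omega>'" "cgrad \<phi> \<in> L2 \<Omega>'" "(\<lambda>x. cgrad \<phi> x $ i) \<in> L2 \<Omega>'"
proof -
  note K = test_funD(2)[OF assms(1)]
  show "\<phi> \<in> L2 \<Omega>'"
    by (rule continuous_compact_support_L2[OF test_funD(6)[OF assms(1)] K test_fun_outside[OF assms(1)] assms(2)])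
  show "cgrad \<phi> \<in> L2 \<Omega>'"
    by (rule continuous_compact_support_L2[OF continuous_cgrad[OF assms(1)] K cgrad_eq_0[OF assms(1)] assms(2)])
  show "(\<lambda>x. cgrad \<phi> x $ i) \<in> L2 \<Omega>'"
    by (rule continuous_compact_support_L2[OF test_funD(7)[OF assms(1)] K _ assms(2)])
      (simp add: cgrad_eq_0[OF assms(1)])
qed

text \<open>Open boxes are stable under intersection and generate the Borel sets, so the integral
  vanishes on every Borel set, and a density is determined by its integrals. The argument runs on
  \<open>lborel\<close>, hence the Borel representative h' of h.\<close>

lemma integral_box_zero_imp_AE_zero:
  fixes h :: "real^'d::finite \<Rightarrow> real"
  assumes h: "integrable lebesgue h" and box: "\<And>a b. (\<integral>x. indicator (box a b) x *\<^sub>R h x \<partial>lebesgue) = 0"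
  shows "AE x in lebesgue. h x = 0"
proof -
  obtain h' where h': "h' \<in> borel_measurable lborel" "AE x in lborel. h x = h' x"
    using completion_ex_borel_measurable_real[of h lborel] h by auto
  have eq: "AE x in lebesgue. h x = h' x" using h'(2) by (rule AE_completion)
  have h'L[measurable]: "h' \<in> borel_measurable lebesgue" using h'(1) by (rule measurable_completion)
  have [measurable]: "h \<in> borel_measurable lebesgue" using h by simp
  have [measurable]: "box a b \<in> sets lebesgue" for a b :: "real^'d" by simp
  have h'i: "integrable lborel h'"
  proof -
    have "integrable lebesgue h'"
      by (rule integrable_cong_AE_imp[OF h h'L]) (use eq in auto)
    then show ?thesis using h'(1) by (simp add: integrable_completion)
  qed
  have si: "set_integrable lborel A h'" if "A \<in> sets borel" for A
    unfolding set_integrable_def using h'i that by (intro integrable_mult_indicator) auto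
  have box': "(LINT x:box a b|lborel. h' x) = 0" for a b
  proof -
    have m: "(\<lambda>x. indicator (box a b) x *\<^sub>R h' x) \<in> borel_measurable lborel" using h'(1) by measurable
    have "(LINT x:box a b|lborel. h' x) = (\<integral>x. indicator (box a b) x *\<^sub>R h' x \<partial>lebesgue)"
      unfolding set_lebesgue_integral_def by (rule integral_completion[OF m, symmetric])
    also have "\<dots> = (\<integral>x. indicator (box a b) x *\<^sub>R h x \<partial>lebesgue)"
      by (rule integral_cong_AE) (measurable, use eq in \<open>auto elim: eventually_mono\<close>)
    also have "\<dots> = 0" by (rule box)
    finally show ?thesis .
  qed
  \<comment> \<open>The complement step of the induction subtracts from the integral over the whole
    space, which is an increasing union of boxes.\<close>
  have UN: "(LINT x:UNIV|lborel. h' x) = 0"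
  proof -
    have "((\<lambda>i. LINT x:box (\<chi> k. - real i) (\<chi> k. real i)|lborel. h' x) \<longlonglongrightarrow>
        (LINT x:(\<Union>i. box (\<chi> k. - real i) (\<chi> k. real i))|lborel. h' x))"
    proof (rule set_integral_cont_up)
      show "incseq (\<lambda>i. box (\<chi> k. - real i) (\<chi> k. real i :: real^'d))"
        unfolding incseq_def subset_iff mem_box_cart vec_lambda_beta
      proof (intro allI impI)
        fix m n :: nat and x :: "real^'d" and k
        assume "m \<le> n" and x: "\<forall>k. - real m < x $ k \<and> x $ k < real m"
        then have "real m \<le> real n" by simp
        then show "- real n < x $ k \<and> x $ k < real n" using x[rule_format, of k] by linarith
      qed
    qed (auto intro!: si)
    moreover have "(\<Union>i. box (\<chi> k. - real i) (\<chi> k. real i :: real^'d)) = UNIV"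
    proof -
      have "x \<in> (\<Union>i. box (\<chi> k. - real i) (\<chi> k. real i))" for x :: "real^'d"
      proof -
      obtain n where n: "norm x < real n" using reals_Archimedean2 by blast
      have "- real n < x $ k \<and> x $ k < real n" for k using component_le_norm_cart[of x k] n by linarith
      then have "x \<in> box (\<chi> k. - real n) (\<chi> k. real n)" by (simp add: mem_box_cart)
      then show ?thesis by blast
      qed
      then show ?thesis by blast
    qed
    ultimately show ?thesis by (simp add: box' LIMSEQ_const_iff)
  qed
  have "(LINT x:A|lborel. h' x) = 0" if "A \<in> sets borel" for A
  proof -
    have A: "A \<in> sigma_sets UNIV (range (\<lambda>(a, b). box a b))"
      using that by (simp add: borel_eq_box)
    have I: "Int_stable (range (\<lambda>(a, b). box a b :: (real^'d) set))"
      by (auto simp: Int_stable_def box_Int_box)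
    have "range (\<lambda>(a, b). box a b :: (real^'d) set) \<subseteq> Pow UNIV" by simp
    from I this A show ?thesis
    proof (induction rule: sigma_sets_induct_disjoint)
      case (basic A) then show ?case by (auto simp: box')
    next
      case (compl A)
      then have A: "A \<in> sets borel" by (simp add: borel_eq_box)
      have "(LINT x:UNIV|lborel. h' x) = (LINT x:A \<union> (UNIV - A)|lborel. h' x)" by simp
      also have "\<dots> = (LINT x:A|lborel. h' x) + (LINT x:UNIV - A|lborel. h' x)"
        using A by (intro set_integral_Un si) auto
      finally show ?case using UN compl by simp
    next
      case (union A)
      then have A: "A i \<in> sets borel" for i by (auto simp: borel_eq_box)
      have "(LINT x:(\<Union>i. A i)|lborel. h' x) = (\<Sum>i. LINT x:A i|lborel. h' x)"
        using union(1) A by (intro lebesgue_integral_countable_add si) (auto simp: disjoint_family_on_def)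
      then show ?case using union by simp
    qed (auto simp: set_lebesgue_integral_def)
  qed
  then have "AE x in lborel. h' x = 0"
    using density_unique_real[OF h'i, of "\<lambda>_. 0"] by simp
  then have "AE x in lebesgue. h' x = 0" by (rule AE_completion)
  with eq show ?thesis by eventually_elim simp
qed

text \<open>Bumps converge boundedly to the indicator of a box, so g has zero integral over every
  open box whose closure lies in \<Omega>. Countably many closed boxes exhaust \<Omega>.\<close>

lemma fundamental_lemma:
  fixes g :: "real^'d::finite \<Rightarrow> real"
  assumes \<Omega>: "open \<Omega>" and g: "g \<in> L2 \<Omega>" and 0: "\<And>\<phi>. \<phi> \<in> test_fun \<Omega> \<Longrightarrow> L2_inner \<Omega> g \<phi> = 0"
  shows "AE x in lebesgue_on \<Omega>. g x = 0"
proof -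
  have \<Omega>L: "\<Omega> \<in> sets lebesgue" using \<Omega> by auto
  note lsp = lebesgue_on_UNIV_sets[OF \<Omega>L]
  note [measurable] = L2_measurable[OF g]
  have boxL: "box a b \<in> sets lebesgue" for a b :: "real^'d" by simp
  have box2: "(\<lambda>x. indicator (box a b) x :: real) \<in> L2 \<Omega>'" if "\<Omega>' \<in> sets lebesgue" for a b :: "real^'d" and \<Omega>'
  proof (rule L2_subset[OF that])
    have "(\<lambda>x. (norm (indicator (box a b) x :: real))\<^sup>2) = indicator (box a b)"
      by (simp add: fun_eq_iff indicator_def)
    moreover have "integrable lebesgue (indicator (box a b) :: _ \<Rightarrow> real)"
      using emeasure_bounded_finite[OF bounded_box, of a b] by (intro integrable_real_indicator) auto
    ultimately show "(\<lambda>x. indicator (box a b) x :: real) \<in> L2 UNIV"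
      by (simp add: L2_def lebesgue_on_UNIV_eq)
  qed
  have gb: "integrable (lebesgue_on \<Omega>) (\<lambda>x. g x * indicator (box a b) x)" for a b
    using L2_inner_integrable[OF g box2[OF \<Omega>L, of a b]] by simp
  have box0: "(\<integral>x. g x * indicator (box a b) x \<partial>lebesgue_on \<Omega>) = 0" if "cbox a b \<subseteq> \<Omega>" for a b
  proof -
    have t: "bump a b n \<in> test_fun \<Omega>" for n by (rule bump_test_fun[OF that])
    have [measurable]: "bump a b n \<in> borel_measurable (lebesgue_on \<Omega>)" for n
      by (rule L2_measurable[OF test_fun_L2(1)[OF t \<Omega>L]])
    have [measurable]: "(\<lambda>x. indicator (box a b) x :: real) \<in> borel_measurable (lebesgue_on \<Omega>)"
      by (rule L2_measurable[OF box2[OF \<Omega>L]])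
    have "(\<lambda>n. \<integral>x. g x * bump a b n x \<partial>lebesgue_on \<Omega>)
        \<longlonglongrightarrow> (\<integral>x. g x * indicator (box a b) x \<partial>lebesgue_on \<Omega>)"
    proof (rule integral_dominated_convergence)
      show "integrable (lebesgue_on \<Omega>) (\<lambda>x. \<bar>g x * indicator (box a b) x\<bar>)"
        using gb by (rule integrable_abs)
      show "AE x in lebesgue_on \<Omega>. (\<lambda>n. g x * bump a b n x) \<longlonglongrightarrow> g x * indicator (box a b) x"
        by (intro AE_I2 tendsto_intros bump_tendsto)
      show "AE x in lebesgue_on \<Omega>. norm (g x * bump a b n x) \<le> \<bar>g x * indicator (box a b) x\<bar>" for n
      proof (intro AE_I2)
        fix x
        have "\<bar>bump a b n x\<bar> \<le> \<bar>indicator (box a b) x\<bar>"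
          using bump_bounds[of a b n x] bump_eq_0_iff[of a b n x] by (auto simp: indicator_def)
        then show "norm (g x * bump a b n x) \<le> \<bar>g x * indicator (box a b) x\<bar>"
          by (simp add: abs_mult mult_left_mono)
      qed
    qed measurable
    moreover have "(\<integral>x. g x * bump a b n x \<partial>lebesgue_on \<Omega>) = 0" for n
      using 0[OF t, of n] by (simp add: L2_inner_def)
    ultimately show ?thesis by (simp add: LIMSEQ_const_iff)
  qed
  \<comment> \<open>Cutting g off to one box gives an integrable function on the whole space.
    Testing it with another box only meets the intersection, again a box inside \<Omega>; the faces
    are a null set.\<close>
  have cb: "AE x in lebesgue. x \<in> cbox a b \<longrightarrow> g x = 0" if ab: "cbox a b \<subseteq> \<Omega>" for a b
  proof -
    define h where "h x = indicator \<Omega> x *\<^sub>R (g x * indicator (box a b) x)" for x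
    have hi: "integrable lebesgue h"
      unfolding h_def integrable_restrict_space[OF lsp, symmetric] by (rule gb)
    have "AE x in lebesgue. h x = 0"
    proof (rule integral_box_zero_imp_AE_zero[OF hi])
      fix c d :: "real^'d"
      define p q where "p = (\<Sum>i\<in>Basis. max (a \<bullet> i) (c \<bullet> i) *\<^sub>R i)" and "q = (\<Sum>i\<in>Basis. min (b \<bullet> i) (d \<bullet> i) *\<^sub>R i)"
      have pq: "box a b \<inter> box c d = box p q" by (simp add: box_Int_box p_def q_def)
      have sub: "cbox p q \<subseteq> cbox a b" by (auto simp: mem_box p_def q_def)
      have "(\<integral>x. indicator (box c d) x *\<^sub>R h x \<partial>lebesgue)
          = (\<integral>x. indicator \<Omega> x *\<^sub>R (g x * indicator (box p q) x) \<partial>lebesgue)"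
        unfolding pq[symmetric] h_def by (intro Bochner_Integration.integral_cong) (auto simp: indicator_def)
      also have "\<dots> = (\<integral>x. g x * indicator (box p q) x \<partial>lebesgue_on \<Omega>)"
        by (rule integral_restrict_space[OF lsp, symmetric])
      also have "\<dots> = 0" by (rule box0) (use sub ab in auto)
      finally show "(\<integral>x. indicator (box c d) x *\<^sub>R h x \<partial>lebesgue) = 0" .
    qed
    moreover have "AE x in lebesgue. x \<notin> cbox a b - box a b"
      using negligible_frontier_interval[of a b] by (intro AE_not_in) (simp add: negligible_iff_null_sets)
    ultimately show ?thesis
      by eventually_elim (use ab in \<open>auto simp: h_def indicator_def split: if_splits\<close>)
  qed
  obtain \<D> where D: "countable \<D>" "\<D> \<subseteq> Pow \<Omega>" "\<And>X. X \<in> \<D> \<Longrightarrow> \<exists>a b. X = cbox a b" "\<Union>\<D> = \<Omega>"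
    using open_countable_Union_open_cbox[OF \<Omega>] by metis
  have "AE x in lebesgue. \<forall>X\<in>\<D>. x \<in> X \<longrightarrow> g x = 0"
    unfolding AE_ball_countable[OF D(1)]
  proof
    fix X assume X: "X \<in> \<D>"
    then obtain a b where "X = cbox a b" using D(3) by blast
    then show "AE x in lebesgue. x \<in> X \<longrightarrow> g x = 0" using cb[of a b] X D(2) by blast
  qed
  then have "AE x in lebesgue. x \<in> \<Omega> \<longrightarrow> g x = 0"
    by eventually_elim (use D(4) in blast)
  then show ?thesis by (simp add: AE_restrict_space_iff[OF lsp])
qed

lemma fundamental_lemma_vec:
  fixes g :: "real^'d::finite \<Rightarrow> real^'d"
  assumes \<Omega>: "open \<Omega>" and g: "g \<in> L2 \<Omega>"
    and 0: "\<And>\<phi> i. \<phi> \<in> test_fun \<Omega> \<Longrightarrow> L2_inner \<Omega> (\<lambda>x. g x $ i) \<phi> = 0"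
  shows "AE x in lebesgue_on \<Omega>. g x = 0"
proof -
  have "AE x in lebesgue_on \<Omega>. g x $ i = 0" for i
    by (rule fundamental_lemma[OF \<Omega> L2_component[OF g] 0])
  then have "AE x in lebesgue_on \<Omega>. \<forall>i\<in>UNIV. g x $ i = 0"
    by (intro AE_finite_allI) auto
  then show ?thesis by eventually_elim (simp add: vec_eq_iff)
qed

subsection \<open>Integration by parts and the Poincare inequality\<close>

text \<open>Difference quotients in a coordinate direction have integral zero by translation
  invariance. The mean value bound M and a common bounded support allow dominated convergence to the
  partial derivative.\<close>

lemma integral_partial_derivative_eq_0:
  fixes \<psi> :: "real^'d::finite \<Rightarrow> real"
  assumes D: "\<And>x. (\<psi> has_derivative (\<lambda>v. D x \<bullet> v)) (at x)" and Dc: "continuous_on UNIV D"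
    and K: "compact K" "\<And>x. x \<notin> K \<Longrightarrow> \<psi> x = 0" "\<And>x. x \<notin> K \<Longrightarrow> D x = 0"
  shows "(\<integral>x. D x $ i \<partial>lebesgue) = 0"
proof -
  define e where "e n = (1 / real (Suc n)) *\<^sub>R (axis i 1 :: real^'d)" for n
  have ne: "norm (e n) = 1 / real (Suc n)" "norm (e n) \<le> 1" for n by (auto simp: e_def norm_axis_1)
  have c\<psi>: "continuous_on UNIV \<psi>"
    using D by (auto intro!: continuous_at_imp_continuous_on has_derivative_continuous)
  have "compact (D ` K)" using Dc K by (intro compact_continuous_image) (auto intro: continuous_on_subset)
  then obtain M where M: "0 < M" "\<And>x. x \<in> K \<Longrightarrow> norm (D x) \<le> M"
    using compact_imp_bounded bounded_pos by (metis imageI)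
  then have DM: "norm (D x) \<le> M" for x using K(3)[of x] by (cases "x \<in> K") auto
  obtain R where R: "0 < R" "\<And>x. x \<in> K \<Longrightarrow> norm x \<le> R"
    using compact_imp_bounded[OF K(1)] bounded_pos by metis
  define s where "s n x = real (Suc n) * (\<psi> (x + e n) - \<psi> x)" for n x
  have cs: "continuous_on UNIV (s n)" for n unfolding s_def
    by (intro continuous_intros c\<psi> continuous_on_compose2[OF c\<psi>]) auto
  have s0: "(\<integral>x. s n x \<partial>lborel) = 0" for n
  proof -
    have i1: "integrable lborel \<psi>" by (rule continuous_compact_support_integrable(1)[OF c\<psi> K(1,2)])
    then have m: "\<psi> \<in> borel_measurable borel" by simp
    have "integrable lborel (\<lambda>x. \<psi> (x + e n)) \<and> (\<integral>x. \<psi> (x + e n) \<partial>lborel) = (\<integral>x. \<psi> x \<partial>lborel)"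
    proof -
      have l: "distr lborel borel (\<lambda>x. e n + x) = (lborel :: (real^'d) measure)"
        by (simp add: lborel_distr_plus)
      have "integrable (distr lborel borel (\<lambda>x. e n + x)) \<psi>" using i1 l by simp
      then have "integrable lborel (\<lambda>x. \<psi> (e n + x))" by (subst (asm) integrable_distr_eq) (use m in auto)
      moreover have "integral\<^sup>L (distr lborel borel (\<lambda>x. e n + x)) \<psi> = (\<integral>x. \<psi> (e n + x) \<partial>lborel)"
        by (rule integral_distr) (use m in auto)
      ultimately show ?thesis using l by (simp add: add.commute)
    qed
    then show ?thesis unfolding s_def using i1 by simp
  qed
  have bound: "\<bar>s n x\<bar> \<le> M" for n x
  proof -
    have "norm (\<psi> (x + e n) - \<psi> x) \<le> M * norm ((x + e n) - x)"
    proof (rule differentiable_bound[OF convex_UNIV])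
      show "onorm (\<lambda>v. D y \<bullet> v) \<le> M" for y
        using DM[of y] by (intro onorm_le) (metis Cauchy_Schwarz_ineq2 mult_right_mono norm_ge_zero order_trans real_norm_def)
    qed (use D in auto)
    also have "\<dots> = M / real (Suc n)" by (simp add: ne(1))
    finally have "real (Suc n) * \<bar>\<psi> (x + e n) - \<psi> x\<bar> \<le> M" by (simp add: field_simps del: of_nat_Suc)
    moreover have "\<bar>s n x\<bar> = real (Suc n) * \<bar>\<psi> (x + e n) - \<psi> x\<bar>"
      unfolding s_def abs_mult by simp
    ultimately show ?thesis by simp
  qed
  \<comment> \<open>The shifts have norm at most 1, so a ball of radius R + 1 contains the support
    of every quotient.\<close>
  have out: "s n x = 0" if "x \<notin> cball 0 (R + 1)" for n x
  proof -
    have x: "R + 1 < norm x" using that by simp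
    have "norm x \<le> norm (x + e n) + norm (e n)" using norm_triangle_ineq4[of "x + e n" "e n"] by simp
    then have "R < norm (x + e n)" "R < norm x" using ne(2)[of n] x by linarith+
    then have "x + e n \<notin> K" "x \<notin> K" using R(2) by force+
    then show ?thesis by (simp add: s_def K)
  qed
  have lim: "(\<lambda>n. s n x) \<longlonglongrightarrow> D x $ i" for x
  proof -
    have "((\<lambda>t. x + t *\<^sub>R (axis i 1 :: real^'d)) has_derivative (\<lambda>t. t *\<^sub>R axis i 1)) (at 0)"
      by (auto intro!: derivative_eq_intros)
    from has_derivative_compose[OF this, of \<psi> "\<lambda>v. D x \<bullet> v"] D[of x]
    have "((\<lambda>t. \<psi> (x + t *\<^sub>R axis i 1)) has_derivative (\<lambda>t. D x $ i * t)) (at 0)"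
      by (simp add: inner_axis mult.commute)
    then have "((\<lambda>t. \<psi> (x + t *\<^sub>R axis i 1)) has_real_derivative D x $ i) (at 0)"
      by (simp add: has_field_derivative_def)
    then have l: "((\<lambda>t. (\<psi> (x + t *\<^sub>R axis i 1) - \<psi> x) / t) \<longlongrightarrow> D x $ i) (at 0)"
      by (simp add: DERIV_def)
    have "filterlim (\<lambda>n. inverse (real (Suc n))) (at 0) sequentially"
      unfolding filterlim_at using LIMSEQ_inverse_real_of_nat by auto
    from filterlim_compose[OF l this] show ?thesis
      by (simp add: s_def e_def divide_inverse mult.commute)
  qed
  have "(\<lambda>n. \<integral>x. s n x \<partial>lborel) \<longlonglongrightarrow> (\<integral>x. D x $ i \<partial>lborel)"
  proof (rule integral_dominated_convergence)
    show "integrable lborel (\<lambda>x :: real^'d. M * indicator (cball 0 (R + 1)) x :: real)"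
      using emeasure_bounded_finite[OF bounded_cball, of "0 :: real^'d" "R + 1"]
      by (intro integrable_mult_right integrable_real_indicator) auto
    show "(\<lambda>x. D x $ i) \<in> borel_measurable lborel"
      using Dc by (simp add: borel_measurable_continuous_onI continuous_on_component)
    show "s n \<in> borel_measurable lborel" for n using cs by (simp add: borel_measurable_continuous_onI)
    show "AE x in lborel. norm (s n x) \<le> M * indicator (cball 0 (R + 1)) x" for n
      using bound[of n] out[of _ n] by (intro AE_I2) (auto simp: indicator_def)
  qed (use lim in auto)
  then have "(\<integral>x. D x $ i \<partial>lborel) = 0" by (simp add: s0 LIMSEQ_const_iff)
  moreover have "(\<integral>x. D x $ i \<partial>lebesgue) = (\<integral>x. D x $ i \<partial>lborel)"
    using Dc by (intro integral_completion) (simp add: borel_measurable_continuous_onI continuous_on_component)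
  ultimately show ?thesis by simp
qed

lemma L2_inner_commute: "L2_inner \<Omega> f g = L2_inner \<Omega> g f"
  by (simp add: L2_inner_def inner_commute)

lemma L2_inner_compact_support:
  assumes \<Omega>: "\<Omega> \<in> sets lebesgue" and 0: "\<And>x. x \<notin> \<Omega> \<Longrightarrow> f x \<bullet> g x = 0"
  shows "L2_inner \<Omega> f g = (\<integral>x. f x \<bullet> g x \<partial>lebesgue)"
  unfolding L2_inner_def integral_restrict_space[OF lebesgue_on_UNIV_sets[OF \<Omega>]]
  by (intro Bochner_Integration.integral_cong) (use 0 in \<open>auto simp: indicator_def\<close>)

lemma test_fun_zero_outside: "\<phi> \<in> test_fun \<Omega> \<Longrightarrow> x \<notin> \<Omega> \<Longrightarrow> \<phi> x = 0"
  by (rule test_fun_outside) (use test_funD(3) in auto)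

lemma test_fun_integration_by_parts:
  fixes \<Omega> :: "(real^'d::finite) set"
  assumes \<Omega>: "\<Omega> \<in> sets lebesgue" and \<phi>: "\<phi> \<in> test_fun \<Omega>" and \<psi>: "\<psi> \<in> test_fun \<Omega>"
  shows "L2_inner \<Omega> \<phi> (\<lambda>x. cgrad \<psi> x $ i) = - L2_inner \<Omega> (\<lambda>x. cgrad \<phi> x $ i) \<psi>"
proof -
  let ?K = "closure {x. \<phi> x \<noteq> 0}"
  define D where "D x = \<phi> x *\<^sub>R cgrad \<psi> x + \<psi> x *\<^sub>R cgrad \<phi> x" for x
  have "(\<integral>x. D x $ i \<partial>lebesgue) = 0"
  proof (rule integral_partial_derivative_eq_0[OF _ _ test_funD(2)[OF \<phi>]])
    show "((\<lambda>x. \<phi> x * \<psi> x) has_derivative (\<lambda>v. D x \<bullet> v)) (at x)" for x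
      using has_derivative_mult[OF test_funD(5)[OF \<phi>, of x] test_funD(5)[OF \<psi>, of x]]
      by (simp add: D_def inner_add_left mult.commute)
    show "continuous_on UNIV D" unfolding D_def
      by (intro continuous_intros continuous_cgrad[OF \<phi>] continuous_cgrad[OF \<psi>] test_funD(6)[OF \<phi>] test_funD(6)[OF \<psi>])
    show "\<phi> x * \<psi> x = 0" "D x = 0" if "x \<notin> ?K" for x
      using test_fun_outside[OF \<phi> that] cgrad_eq_0[OF \<phi> that] by (auto simp: D_def)
  qed
  moreover have "(\<integral>x. D x $ i \<partial>lebesgue) = (\<integral>x. \<phi> x * cgrad \<psi> x $ i \<partial>lebesgue) + (\<integral>x. cgrad \<phi> x $ i * \<psi> x \<partial>lebesgue)"
  proof -
    have "integrable lebesgue (\<lambda>x. \<phi> x * cgrad \<psi> x $ i)" "integrable lebesgue (\<lambda>x. cgrad \<phi> x $ i * \<psi> x)"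
      using L2_inner_integrable[OF test_fun_L2(1)[OF \<phi>] test_fun_L2(3)[OF \<psi>], of UNIV i]
        L2_inner_integrable[OF test_fun_L2(3)[OF \<phi>] test_fun_L2(1)[OF \<psi>], of UNIV i]
      by (simp_all add: lebesgue_on_UNIV_eq)
    then show ?thesis by (simp add: D_def mult.commute)
  qed
  moreover have "L2_inner \<Omega> \<phi> (\<lambda>x. cgrad \<psi> x $ i) = (\<integral>x. \<phi> x * cgrad \<psi> x $ i \<partial>lebesgue)"
    using test_fun_zero_outside[OF \<phi>] by (subst L2_inner_compact_support[OF \<Omega>]) auto
  moreover have "L2_inner \<Omega> (\<lambda>x. cgrad \<phi> x $ i) \<psi> = (\<integral>x. cgrad \<phi> x $ i * \<psi> x \<partial>lebesgue)"
    using test_fun_zero_outside[OF \<psi>] by (subst L2_inner_compact_support[OF \<Omega>]) auto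
  ultimately show ?thesis by simp
qed

lemma has_wgrad_test_fun:
  fixes \<Omega> :: "(real^'d::finite) set"
  assumes "\<Omega> \<in> sets lebesgue" "\<phi> \<in> test_fun \<Omega>" shows "has_wgrad \<Omega> \<phi> (cgrad \<phi>)"
  using assms test_fun_integration_by_parts[OF assms] by (simp add: has_wgrad_def test_fun_L2(2))

text \<open>Integrate the partial derivative of \<open>x $ i * (\<phi> x)\<^sup>2\<close>.\<close>
lemma test_fun_poincare:
  fixes \<Omega> :: "(real^'d::finite) set"
  assumes \<Omega>: "\<Omega> \<in> sets lebesgue" and \<phi>: "\<phi> \<in> test_fun \<Omega>" and R: "0 < R" "\<And>x. x \<in> \<Omega> \<Longrightarrow> norm x \<le> R"
  shows "L2_norm \<Omega> \<phi> \<le> 2 * R * L2_norm \<Omega> (cgrad \<phi>)"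
proof -
  fix i :: 'd
  let ?K = "closure {x. \<phi> x \<noteq> 0}"
  \<comment> \<open>The partial derivative of \<open>x $ i * (\<phi> x)\<^sup>2\<close> is \<phi>
    squared minus \<phi> q. Its integral vanishes, so the norm of \<phi> is at most that of q, which
    is bounded through |x| \<le> R. Any coordinate i will do.\<close>
  define q where "q x = - 2 * (x $ i) * cgrad \<phi> x $ i" for x
  define D where "D x = (\<phi> x)\<^sup>2 *\<^sub>R axis i 1 + (2 * x $ i * \<phi> x) *\<^sub>R cgrad \<phi> x" for x
  note K = test_funD(2)[OF \<phi>]
  have c: "continuous_on UNIV (\<lambda>x :: real^'d. x $ i)" by (intro continuous_intros)
  have qL: "q \<in> L2 \<Omega>"
  proof (rule continuous_compact_support_L2[OF _ K _ \<Omega>])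
    show "continuous_on UNIV q" unfolding q_def by (intro continuous_intros test_funD(7)[OF \<phi>])
  qed (simp add: q_def cgrad_eq_0[OF \<phi>])
  have \<phi>L: "\<phi> \<in> L2 \<Omega>" and cL: "cgrad \<phi> \<in> L2 \<Omega>" using test_fun_L2[OF \<phi> \<Omega>] by auto
  have "(\<integral>x. D x $ i \<partial>lebesgue) = 0"
  proof (rule integral_partial_derivative_eq_0[OF _ _ K])
    fix x :: "real^'d"
    have "((\<lambda>x. x $ i * (\<phi> x)\<^sup>2) has_derivative (\<lambda>v. v $ i * (\<phi> x)\<^sup>2 + x $ i * (2 * \<phi> x * (cgrad \<phi> x \<bullet> v)))) (at x)"
      by (auto intro!: derivative_eq_intros test_funD(5)[OF \<phi>] bounded_linear.has_derivative[OF bounded_linear_vec_nth])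
    moreover have "(\<lambda>v. v $ i * (\<phi> x)\<^sup>2 + x $ i * (2 * \<phi> x * (cgrad \<phi> x \<bullet> v))) = (\<lambda>v. D x \<bullet> v)"
      by (simp add: D_def inner_add_left inner_axis' fun_eq_iff mult_ac)
    ultimately show "((\<lambda>x. x $ i * (\<phi> x)\<^sup>2) has_derivative (\<lambda>v. D x \<bullet> v)) (at x)" by simp
  next
    show "continuous_on UNIV D" unfolding D_def
      by (intro continuous_intros continuous_cgrad[OF \<phi>] test_funD(6)[OF \<phi>])
    show "x $ i * (\<phi> x)\<^sup>2 = 0" "D x = 0" if "x \<notin> ?K" for x
      using test_fun_outside[OF \<phi> that] cgrad_eq_0[OF \<phi> that] by (auto simp: D_def)
  qed
  moreover have "(\<integral>x. D x $ i \<partial>lebesgue) = (\<integral>x. \<phi> x * \<phi> x \<partial>lebesgue) - (\<integral>x. \<phi> x * q x \<partial>lebesgue)"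
  proof -
    have qU: "q \<in> L2 UNIV"
    proof (rule continuous_compact_support_L2[OF _ K])
      show "continuous_on UNIV q" unfolding q_def by (intro continuous_intros test_funD(7)[OF \<phi>])
    qed (simp_all add: q_def cgrad_eq_0[OF \<phi>])
    have "integrable lebesgue (\<lambda>x. \<phi> x * \<phi> x)" "integrable lebesgue (\<lambda>x. \<phi> x * q x)"
      using L2_inner_integrable[OF test_fun_L2(1)[OF \<phi>] test_fun_L2(1)[OF \<phi>], of UNIV]
        L2_inner_integrable[OF test_fun_L2(1)[OF \<phi>] qU] by (simp_all add: lebesgue_on_UNIV_eq)
    then have "(\<integral>x. \<phi> x * \<phi> x \<partial>lebesgue) - (\<integral>x. \<phi> x * q x \<partial>lebesgue) = (\<integral>x. \<phi> x * \<phi> x - \<phi> x * q x \<partial>lebesgue)"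
      by simp
    also have "(\<lambda>x. \<phi> x * \<phi> x - \<phi> x * q x) = (\<lambda>x. D x $ i)"
      by (simp add: fun_eq_iff D_def q_def power2_eq_square mult_ac)
    finally show ?thesis by simp
  qed
  moreover have "L2_inner \<Omega> \<phi> \<phi> = (\<integral>x. \<phi> x * \<phi> x \<partial>lebesgue)" "L2_inner \<Omega> \<phi> q = (\<integral>x. \<phi> x * q x \<partial>lebesgue)"
    using test_fun_zero_outside[OF \<phi>] by (subst L2_inner_compact_support[OF \<Omega>]; simp)+
  ultimately have eq: "L2_inner \<Omega> \<phi> \<phi> = L2_inner \<Omega> \<phi> q" by simp
  have nq: "L2_norm \<Omega> q \<le> 2 * R * L2_norm \<Omega> (cgrad \<phi>)"
  proof -
    have "L2_inner \<Omega> q q \<le> (\<integral>x. (2 * R)\<^sup>2 * (cgrad \<phi> x \<bullet> cgrad \<phi> x) \<partial>lebesgue_on \<Omega>)"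
      unfolding L2_inner_def
    proof (rule integral_mono)
      fix x assume "x \<in> space (lebesgue_on \<Omega>)"
      then have "norm x \<le> R" using R(2) by (simp add: space_restrict_space)
      then have "\<bar>x $ i\<bar> \<le> R" using component_le_norm_cart[of x i] by linarith
      then have "\<bar>q x\<bar> \<le> 2 * R * norm (cgrad \<phi> x)"
        unfolding q_def abs_mult using component_le_norm_cart[of "cgrad \<phi> x" i] R(1)
        by (intro mult_mono) auto
      then have "\<bar>q x\<bar>\<^sup>2 \<le> (2 * R * norm (cgrad \<phi> x))\<^sup>2" by (intro power_mono) auto
      then show "q x \<bullet> q x \<le> (2 * R)\<^sup>2 * (cgrad \<phi> x \<bullet> cgrad \<phi> x)"
        by (simp add: power_mult_distrib power2_norm_eq_inner power2_eq_square[of "q x"])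
    qed (use L2_inner_integrable[OF qL qL] L2_inner_integrable[OF cL cL] in auto)
    also have "\<dots> = (2 * R)\<^sup>2 * L2_inner \<Omega> (cgrad \<phi>) (cgrad \<phi>)" by (simp add: L2_inner_def)
    finally have "sqrt (L2_inner \<Omega> q q) \<le> sqrt ((2 * R)\<^sup>2 * L2_inner \<Omega> (cgrad \<phi>) (cgrad \<phi>))" by simp
    then show ?thesis using R(1) by (simp add: L2_norm_def real_sqrt_mult)
  qed
  have "(norm (emb \<Omega> \<phi>))\<^sup>2 \<le> norm (emb \<Omega> \<phi>) * norm (emb \<Omega> q)"
    using eq norm_cauchy_schwarz[of "emb \<Omega> \<phi>" "emb \<Omega> q"]
    by (simp add: power2_norm_eq_inner emb_inner[OF \<Omega>] \<phi>L qL)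
  then have "norm (emb \<Omega> \<phi>) \<le> norm (emb \<Omega> q)"
    by (cases "emb \<Omega> \<phi> = 0") (auto simp: power2_eq_square)
  then show ?thesis using nq by (simp add: emb_norm[OF \<Omega>] \<phi>L qL)
qed

lemma emb_scaled_sum:
  assumes "\<Omega> \<in> sets lebesgue" "f \<in> L2 \<Omega>" "g \<in> L2 \<Omega>"
  shows "emb \<Omega> (\<lambda>x. c *\<^sub>R f x + g x) = c *\<^sub>R emb \<Omega> f + emb \<Omega> g"
  using assms by (simp add: emb_add L2_scaleR emb_scaleR)

lemma L2_inner_comb:
  assumes "f \<in> L2 \<Omega>" "g \<in> L2 \<Omega>" "h \<in> L2 \<Omega>"
  shows "L2_inner \<Omega> (\<lambda>x. c *\<^sub>R f x + g x) h = c * L2_inner \<Omega> f h + L2_inner \<Omega> g h"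
  using L2_inner_integrable[OF assms(1,3)] L2_inner_integrable[OF assms(2,3)]
  by (simp add: L2_inner_def inner_add_left)

lemma L2_inner_diff_left:
  assumes "f \<in> L2 \<Omega>" "g \<in> L2 \<Omega>" "h \<in> L2 \<Omega>"
  shows "L2_inner \<Omega> (\<lambda>x. f x - g x) h = L2_inner \<Omega> f h - L2_inner \<Omega> g h"
  using L2_inner_integrable[OF assms(1,3)] L2_inner_integrable[OF assms(2,3)]
  by (simp add: L2_inner_def inner_diff_left)

section \<open>Uniqueness and linearity of weak derivatives\<close>

locale open_domain =
  fixes \<Omega> :: "(real^'d::finite) set"
  assumes open_domain: "open \<Omega>"
begin

lemma domain_sets: "\<Omega> \<in> sets lebesgue"
  using open_domain by auto

lemmas test_L2 = test_fun_L2[OF _ domain_sets]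
lemmas emb_simps = emb_inner[OF domain_sets] emb_norm[OF domain_sets]

lemma has_wgrad_L2: "has_wgrad \<Omega> u g \<Longrightarrow> g \<in> L2 \<Omega>"
  and has_wdiv_L2: "has_wdiv \<Omega> \<tau> q \<Longrightarrow> q \<in> L2 \<Omega>"
  by (auto simp: has_wgrad_def has_wdiv_def)

lemma has_wgrad_unique:
  assumes "has_wgrad \<Omega> u g" "has_wgrad \<Omega> u g'" shows "emb \<Omega> g = emb \<Omega> g'"
proof -
  have g: "g \<in> L2 \<Omega>" "g' \<in> L2 \<Omega>" using assms by (auto simp: has_wgrad_def)
  have "AE x in lebesgue_on \<Omega>. g x - g' x = 0"
  proof (rule fundamental_lemma_vec[OF open_domain L2_diff[OF g]])
    fix \<phi> i assume \<phi>: "\<phi> \<in> test_fun \<Omega>"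
    have "L2_inner \<Omega> (\<lambda>x. (g x - g' x) $ i) \<phi> = L2_inner \<Omega> (\<lambda>x. g x $ i) \<phi> - L2_inner \<Omega> (\<lambda>x. g' x $ i) \<phi>"
      using L2_inner_diff_left[OF L2_component[OF g(1)] L2_component[OF g(2)] test_L2(1)[OF \<phi>], of i i]
      by simp
    also have "\<dots> = 0" using assms \<phi> by (simp add: has_wgrad_def)
    finally show "L2_inner \<Omega> (\<lambda>x. (g x - g' x) $ i) \<phi> = 0" .
  qed
  then show ?thesis unfolding emb_eq_iff[OF domain_sets g] by eventually_elim simp
qed

lemma has_wdiv_unique:
  assumes "has_wdiv \<Omega> \<tau> q" "has_wdiv \<Omega> \<tau> q'" shows "emb \<Omega> q = emb \<Omega> q'"
proof -
  have q: "q \<in> L2 \<Omega>" "q' \<in> L2 \<Omega>" using assms by (auto simp: has_wdiv_def)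
  have "AE x in lebesgue_on \<Omega>. q x - q' x = 0"
  proof (rule fundamental_lemma[OF open_domain L2_diff[OF q]])
    fix \<phi> assume \<phi>: "\<phi> \<in> test_fun \<Omega>"
    show "L2_inner \<Omega> (\<lambda>x. q x - q' x) \<phi> = 0"
      using L2_inner_diff_left[OF q test_L2(1)[OF \<phi>]] assms \<phi> by (simp add: has_wdiv_def)
  qed
  then show ?thesis unfolding emb_eq_iff[OF domain_sets q] by eventually_elim simp
qed

lemma has_wgrad_comb:
  assumes u: "u \<in> L2 \<Omega>" "has_wgrad \<Omega> u g" and v: "v \<in> L2 \<Omega>" "has_wgrad \<Omega> v k"
  shows "has_wgrad \<Omega> (\<lambda>x. c * u x + v x) (\<lambda>x. c *\<^sub>R g x + k x)"
  unfolding has_wgrad_def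
proof (intro conjI ballI allI)
  note g = has_wgrad_L2[OF u(2)] and k = has_wgrad_L2[OF v(2)]
  show "(\<lambda>x. c *\<^sub>R g x + k x) \<in> L2 \<Omega>" by (intro L2_add L2_scaleR g k)
  fix \<phi> i assume \<phi>: "\<phi> \<in> test_fun \<Omega>"
  show "L2_inner \<Omega> (\<lambda>x. c * u x + v x) (\<lambda>x. cgrad \<phi> x $ i) = - L2_inner \<Omega> (\<lambda>x. (c *\<^sub>R g x + k x) $ i) \<phi>"
    using L2_inner_comb[OF u(1) v(1) test_L2(3)[OF \<phi>], of c i]
      L2_inner_comb[OF L2_component[OF g] L2_component[OF k] test_L2(1)[OF \<phi>], of c i i] u(2) v(2) \<phi>
    by (simp add: has_wgrad_def)
qed

lemma has_wdiv_comb: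
  assumes u: "u \<in> L2 \<Omega>" "has_wdiv \<Omega> u g" and v: "v \<in> L2 \<Omega>" "has_wdiv \<Omega> v k"
  shows "has_wdiv \<Omega> (\<lambda>x. c *\<^sub>R u x + v x) (\<lambda>x. c * g x + k x)"
  unfolding has_wdiv_def
proof (intro conjI ballI)
  note g = has_wdiv_L2[OF u(2)] and k = has_wdiv_L2[OF v(2)]
  show "(\<lambda>x. c * g x + k x) \<in> L2 \<Omega>" using L2_add[OF L2_scaleR[OF g, of c] k] by simp
  fix \<phi> assume \<phi>: "\<phi> \<in> test_fun \<Omega>"
  show "L2_inner \<Omega> (\<lambda>x. c *\<^sub>R u x + v x) (cgrad \<phi>) = - L2_inner \<Omega> (\<lambda>x. c * g x + k x) \<phi>"
    using L2_inner_comb[OF u(1) v(1) test_L2(2)[OF \<phi>], of c]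
      L2_inner_comb[OF g k test_L2(1)[OF \<phi>], of c] u(2) v(2) \<phi>
    by (simp add: has_wdiv_def)
qed

lemma H1_has_wgrad: "u \<in> H1 \<Omega> \<Longrightarrow> has_wgrad \<Omega> u (wgrad \<Omega> u)"
  using someI_ex[of "has_wgrad \<Omega> u"] by (simp add: H1_def wgrad_def)

lemma Hdiv_has_wdiv: "\<tau> \<in> Hdiv \<Omega> \<Longrightarrow> has_wdiv \<Omega> \<tau> (wdiv \<Omega> \<tau>)"
  using someI_ex[of "has_wdiv \<Omega> \<tau>"] by (simp add: Hdiv_def wdiv_def)

lemma emb_wgrad: "has_wgrad \<Omega> u g \<Longrightarrow> emb \<Omega> (wgrad \<Omega> u) = emb \<Omega> g"
  unfolding wgrad_def by (rule has_wgrad_unique[OF someI[of "has_wgrad \<Omega> u"]])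

lemma emb_wdiv: "has_wdiv \<Omega> \<tau> q \<Longrightarrow> emb \<Omega> (wdiv \<Omega> \<tau>) = emb \<Omega> q"
  unfolding wdiv_def by (rule has_wdiv_unique[OF someI[of "has_wdiv \<Omega> \<tau>"]])

end

subsection \<open>The gradient and divergence graphs\<close>

lemma subspace_closure:
  fixes V :: "'a::real_normed_vector set"
  assumes V: "subspace V" shows "subspace (closure V)"
proof (rule subspaceI)
  show "0 \<in> closure V" using subspace_0[OF V] closure_subset by blast
next
  fix x y assume "x \<in> closure V" "y \<in> closure V"
  then obtain f g where "\<And>n. f n \<in> V" "f \<longlonglongrightarrow> x" "\<And>n. g n \<in> V" "g \<longlonglongrightarrow> y"
    unfolding closure_sequential by blast
  then show "x + y \<in> closure V"
    unfolding closure_sequential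
    by (intro exI[of _ "\<lambda>n. f n + g n"]) (simp add: subspace_add[OF V] tendsto_add)
next
  fix c x assume "x \<in> closure V"
  then obtain f where "\<And>n. f n \<in> V" "f \<longlonglongrightarrow> x" unfolding closure_sequential by blast
  then show "c *\<^sub>R x \<in> closure V"
    unfolding closure_sequential
    by (intro exI[of _ "\<lambda>n. c *\<^sub>R f n"]) (simp add: subspace_scale[OF V] tendsto_scaleR)
qed

context open_domain
begin

definition test_graph :: "(('d, real) l2 \<times> ('d, real^'d) l2) set" where
  "test_graph = (\<lambda>\<phi>. (emb \<Omega> \<phi>, emb \<Omega> (cgrad \<phi>))) ` test_fun \<Omega>"

text \<open>The space \<open>H10\<close> at the level of classes: pairs of a function and its weak
  gradient. As a closed set in a complete product it provides the completeness that projections and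
  the Riesz theorem require.\<close>

definition grad_graph :: "(('d, real) l2 \<times> ('d, real^'d) l2) set" where
  "grad_graph = closure test_graph"

definition grads :: "('d, real^'d) l2 set" where
  "grads = snd ` grad_graph"

text \<open>Well defined on \<open>grads\<close> for bounded domains, by the Poincare inequality.\<close>
definition potential :: "('d, real^'d) l2 \<Rightarrow> ('d, real) l2" where
  "potential b = (SOME a. (a, b) \<in> grad_graph)"

lemma test_graphI: "\<phi> \<in> test_fun \<Omega> \<Longrightarrow> (emb \<Omega> \<phi>, emb \<Omega> (cgrad \<phi>)) \<in> test_graph"
  by (simp add: test_graph_def)

lemma closed_grad_graph: "closed grad_graph"
  by (simp add: grad_graph_def)

lemma subspace_grad_graph: "subspace grad_graph"
proof -
  have "subspace test_graph"
  proof (rule subspaceI)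
    have "emb \<Omega> (\<lambda>x. 0 :: real) = 0" "emb \<Omega> (\<lambda>x. 0 :: real^'d) = 0"
      using emb_scaleR[OF domain_sets L2_zero, of 0, where ?'a = real] emb_scaleR[OF domain_sets L2_zero, of 0, where ?'a = "real^'d"]
      by simp_all
    moreover have "cgrad (\<lambda>x :: real^'d. 0) = (\<lambda>x. 0)" by (intro ext cgrad_eqI) simp
    ultimately show "0 \<in> test_graph"
      unfolding test_graph_def by (intro image_eqI[of _ _ "\<lambda>x. 0"]) (auto simp: test_fun_zero zero_prod_def)
  next
    fix p q assume "p \<in> test_graph" "q \<in> test_graph"
    then obtain \<phi> \<psi> where \<phi>: "\<phi> \<in> test_fun \<Omega>" "\<psi> \<in> test_fun \<Omega>"
      and p: "p = (emb \<Omega> \<phi>, emb \<Omega> (cgrad \<phi>))" "q = (emb \<Omega> \<psi>, emb \<Omega> (cgrad \<psi>))"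
      by (auto simp: test_graph_def)
    have "p + q = (emb \<Omega> (\<lambda>x. 1 * \<phi> x + \<psi> x), emb \<Omega> (cgrad (\<lambda>x. 1 * \<phi> x + \<psi> x)))"
      using emb_scaled_sum[OF domain_sets test_L2(1)[OF \<phi>(1)] test_L2(1)[OF \<phi>(2)], of 1]
        emb_scaled_sum[OF domain_sets test_L2(2)[OF \<phi>(1)] test_L2(2)[OF \<phi>(2)], of 1]
      unfolding p test_fun_scale_add(2)[OF \<phi>, THEN ext, of "\<lambda>_. 1"] by simp
    then show "p + q \<in> test_graph"
      using test_graphI[OF test_fun_scale_add(1)[OF \<phi>, of 1]] by simp
  next
    fix c p assume "p \<in> test_graph"
    then obtain \<phi> where \<phi>: "\<phi> \<in> test_fun \<Omega>" and p: "p = (emb \<Omega> \<phi>, emb \<Omega> (cgrad \<phi>))"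
      by (auto simp: test_graph_def)
    have z: "cgrad (\<lambda>x :: real^'d. 0) x = 0" for x by (rule cgrad_eqI) simp
    have "cgrad (\<lambda>x. c * \<phi> x + 0) = (\<lambda>x. c *\<^sub>R cgrad \<phi> x)"
      using test_fun_scale_add(2)[OF \<phi> test_fun_zero, of c] by (auto simp: z)
    then have "c *\<^sub>R p = (emb \<Omega> (\<lambda>x. c * \<phi> x + 0), emb \<Omega> (cgrad (\<lambda>x. c * \<phi> x + 0)))"
      using emb_scaleR[OF domain_sets test_L2(1)[OF \<phi>], of c] emb_scaleR[OF domain_sets test_L2(2)[OF \<phi>], of c]
      by (simp add: p)
    then show "c *\<^sub>R p \<in> test_graph"
      using test_graphI[OF test_fun_scale_add(1)[OF \<phi> test_fun_zero, of c]] by simp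
  qed
  then show ?thesis unfolding grad_graph_def by (rule subspace_closure)
qed

text \<open>Being supported in \<Omega> is a closed condition that holds for test functions. It lets
  one pass to representatives on \<Omega> and back without loss.\<close>

lemma grad_graph_rep:
  assumes "(a, b) \<in> grad_graph" shows "emb \<Omega> (rep_l2 a) = a" "emb \<Omega> (rep_l2 b) = b"
proof -
  have "closed ({a. emb \<Omega> (rep_l2 a) = a} \<times> {b. emb \<Omega> (rep_l2 b) = b} :: (('d, real) l2 \<times> ('d, real^'d) l2) set)"
    by (intro closed_Times closed_range_emb[OF domain_sets])
  moreover have "test_graph \<subseteq> {a. emb \<Omega> (rep_l2 a) = a} \<times> {b. emb \<Omega> (rep_l2 b) = b}"
    by (auto simp: test_graph_def emb_rep_emb[OF domain_sets] test_L2)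
  ultimately have "grad_graph \<subseteq> {a. emb \<Omega> (rep_l2 a) = a} \<times> {b. emb \<Omega> (rep_l2 b) = b}"
    unfolding grad_graph_def by (intro closure_minimal)
  then show "emb \<Omega> (rep_l2 a) = a" "emb \<Omega> (rep_l2 b) = b" using assms by auto
qed

lemma H10_imp_graph:
  assumes u: "u \<in> H10 \<Omega>" shows "(emb \<Omega> u, emb \<Omega> (wgrad \<Omega> u)) \<in> grad_graph"
  unfolding grad_graph_def closure_approachable
proof (intro allI impI)
  fix e :: real assume "0 < e"
  then obtain \<phi> where \<phi>: "\<phi> \<in> test_fun \<Omega>" "H1_norm \<Omega> (\<lambda>x. u x - \<phi> x) < e"
    using u by (auto simp: H10_def)
  have uH: "u \<in> H1 \<Omega>" "u \<in> L2 \<Omega>" using u by (auto simp: H10_def H1_def)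
  note g = H1_has_wgrad[OF uH(1)]
  have "has_wgrad \<Omega> (\<lambda>x. (-1) * \<phi> x + u x) (\<lambda>x. (-1) *\<^sub>R cgrad \<phi> x + wgrad \<Omega> u x)"
    by (rule has_wgrad_comb[OF test_L2(1)[OF \<phi>(1)] has_wgrad_test_fun[OF domain_sets \<phi>(1)] uH(2) g])
  then have d: "has_wgrad \<Omega> (\<lambda>x. u x - \<phi> x) (\<lambda>x. wgrad \<Omega> u x - cgrad \<phi> x)" by simp
  have w: "wgrad \<Omega> (\<lambda>x. u x - \<phi> x) \<in> L2 \<Omega>"
    using H1_has_wgrad[of "\<lambda>x. u x - \<phi> x"] d L2_diff[OF uH(2) test_L2(1)[OF \<phi>(1)]] has_wgrad_L2
    by (auto simp: H1_def)
  have "dist (emb \<Omega> \<phi>, emb \<Omega> (cgrad \<phi>)) (emb \<Omega> u, emb \<Omega> (wgrad \<Omega> u))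
      = norm (emb \<Omega> u - emb \<Omega> \<phi>, emb \<Omega> (wgrad \<Omega> u) - emb \<Omega> (cgrad \<phi>))"
    by (simp add: dist_norm norm_minus_commute norm_Pair)
  also have "emb \<Omega> u - emb \<Omega> \<phi> = emb \<Omega> (\<lambda>x. u x - \<phi> x)"
    by (rule emb_diff[OF domain_sets uH(2) test_L2(1)[OF \<phi>(1)], symmetric])
  also have "emb \<Omega> (wgrad \<Omega> u) - emb \<Omega> (cgrad \<phi>) = emb \<Omega> (wgrad \<Omega> (\<lambda>x. u x - \<phi> x))"
    using emb_diff[OF domain_sets has_wgrad_L2[OF g] test_L2(2)[OF \<phi>(1)]] emb_wgrad[OF d] by simp
  also have "norm (emb \<Omega> (\<lambda>x. u x - \<phi> x), emb \<Omega> (wgrad \<Omega> (\<lambda>x. u x - \<phi> x))) = H1_norm \<Omega> (\<lambda>x. u x - \<phi> x)"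
    unfolding norm_Pair emb_simps(2)[OF w] emb_simps(2)[OF L2_diff[OF uH(2) test_L2(1)[OF \<phi>(1)]]] H1_norm_def
    by simp
  finally have "dist (emb \<Omega> \<phi>, emb \<Omega> (cgrad \<phi>)) (emb \<Omega> u, emb \<Omega> (wgrad \<Omega> u)) < e" using \<phi>(2) by simp
  then show "\<exists>y\<in>test_graph. dist y (emb \<Omega> u, emb \<Omega> (wgrad \<Omega> u)) < e"
    by (rule bexI[OF _ test_graphI[OF \<phi>(1)]])
qed

text \<open>For a fixed test function, integration by parts is a closed condition on pairs, so it
  survives the closure that defines \<open>grad_graph\<close>.\<close>

lemma graph_imp_H10:
  assumes ug: "(emb \<Omega> u, emb \<Omega> g) \<in> grad_graph" and u: "u \<in> L2 \<Omega>" and g: "g \<in> L2 \<Omega>"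
  shows "has_wgrad \<Omega> u g" "u \<in> H10 \<Omega>"
proof -
  have "L2_inner \<Omega> u (\<lambda>x. cgrad \<phi> x $ i) = - L2_inner \<Omega> (\<lambda>x. g x $ i) \<phi>" if \<phi>: "\<phi> \<in> test_fun \<Omega>" for \<phi> i
  proof -
    define Z where "Z = {p :: ('d, real) l2 \<times> ('d, real^'d) l2.
      fst p \<bullet> emb \<Omega> (\<lambda>x. cgrad \<phi> x $ i) = - (snd p \<bullet> emb \<Omega> (\<lambda>x. \<phi> x *\<^sub>R axis i 1))}"
    have aL: "(\<lambda>x. \<phi> x *\<^sub>R axis i 1 :: real^'d) \<in> L2 \<Omega>"
    proof (rule continuous_compact_support_L2[OF _ test_funD(2)[OF \<phi>] _ domain_sets])
      show "continuous_on UNIV (\<lambda>x. \<phi> x *\<^sub>R axis i 1 :: real^'d)"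
        by (intro continuous_on_scaleR continuous_on_const test_funD(6)[OF \<phi>])
      fix x assume "x \<notin> closure {x. \<phi> x \<noteq> 0}"
      then have "\<phi> x = 0" by (rule test_fun_outside[OF \<phi>])
      then show "\<phi> x *\<^sub>R axis i 1 = (0 :: real^'d)" by simp
    qed
    have ax: "L2_inner \<Omega> k (\<lambda>x. \<phi> x *\<^sub>R axis i 1) = L2_inner \<Omega> (\<lambda>x. k x $ i) \<phi>" for k
      by (simp add: L2_inner_def inner_axis mult.commute)
    have "closed Z" unfolding Z_def by (intro closed_Collect_eq continuous_intros)
    moreover have "test_graph \<subseteq> Z"
    proof
      fix p assume "p \<in> test_graph"
      then obtain \<psi> where \<psi>: "\<psi> \<in> test_fun \<Omega>" and p: "p = (emb \<Omega> \<psi>, emb \<Omega> (cgrad \<psi>))"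
        by (auto simp: test_graph_def)
      show "p \<in> Z" using test_fun_integration_by_parts[OF domain_sets \<psi> \<phi>, of i]
        by (simp add: Z_def p emb_simps test_L2[OF \<phi>] test_L2[OF \<psi>] aL ax)
    qed
    ultimately have "grad_graph \<subseteq> Z" unfolding grad_graph_def by (intro closure_minimal)
    then have "(emb \<Omega> u, emb \<Omega> g) \<in> Z" using ug by blast
    then show ?thesis by (simp add: Z_def emb_simps test_L2[OF \<phi>] aL ax u g)
  qed
  then show wg: "has_wgrad \<Omega> u g" using g by (simp add: has_wgrad_def)
  then have uH: "u \<in> H1 \<Omega>" using u by (auto simp: H1_def)
  have "\<exists>\<phi>\<in>test_fun \<Omega>. H1_norm \<Omega> (\<lambda>x. u x - \<phi> x) < e" if "0 < e" for e
  proof -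
    obtain \<phi> where \<phi>: "\<phi> \<in> test_fun \<Omega>"
      "dist (emb \<Omega> \<phi>, emb \<Omega> (cgrad \<phi>)) (emb \<Omega> u, emb \<Omega> g) < e"
    proof -
      obtain y where "y \<in> test_graph" "dist y (emb \<Omega> u, emb \<Omega> g) < e"
        using ug \<open>0 < e\<close> unfolding grad_graph_def closure_approachable by blast
      then show ?thesis using that unfolding test_graph_def by blast
    qed
    have "has_wgrad \<Omega> (\<lambda>x. (-1) * \<phi> x + u x) (\<lambda>x. (-1) *\<^sub>R cgrad \<phi> x + g x)"
      by (rule has_wgrad_comb[OF test_L2(1)[OF \<phi>(1)] has_wgrad_test_fun[OF domain_sets \<phi>(1)] u wg])
    then have d: "has_wgrad \<Omega> (\<lambda>x. u x - \<phi> x) (\<lambda>x. g x - cgrad \<phi> x)" by simp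
    have w: "wgrad \<Omega> (\<lambda>x. u x - \<phi> x) \<in> L2 \<Omega>"
      using H1_has_wgrad[of "\<lambda>x. u x - \<phi> x"] d L2_diff[OF u test_L2(1)[OF \<phi>(1)]] has_wgrad_L2
      by (auto simp: H1_def)
    have "H1_norm \<Omega> (\<lambda>x. u x - \<phi> x) = norm (emb \<Omega> (\<lambda>x. u x - \<phi> x), emb \<Omega> (\<lambda>x. g x - cgrad \<phi> x))"
      unfolding norm_Pair emb_simps(2)[OF L2_diff[OF u test_L2(1)[OF \<phi>(1)]]] emb_wgrad[OF d, symmetric]
        emb_simps(2)[OF w] H1_norm_def by simp
    also have "\<dots> = dist (emb \<Omega> u, emb \<Omega> g) (emb \<Omega> \<phi>, emb \<Omega> (cgrad \<phi>))"
      unfolding emb_diff[OF domain_sets u test_L2(1)[OF \<phi>(1)]] emb_diff[OF domain_sets g test_L2(2)[OF \<phi>(1)]]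
      by (simp add: dist_norm)
    also have "\<dots> < e" using \<phi>(2) by (simp add: dist_commute)
    finally show ?thesis using \<phi> by auto
  qed
  with uH show "u \<in> H10 \<Omega>" by (auto simp: H10_def)
qed

text \<open>Green's formula between H(div) and \<open>H10\<close>: the weak divergence is defined by
  test functions, and both sides are continuous on their closure.\<close>

lemma Hdiv_orthogonality:
  assumes \<tau>: "\<tau> \<in> L2 \<Omega>" "q \<in> L2 \<Omega>"
  shows "has_wdiv \<Omega> \<tau> q \<longleftrightarrow> (\<forall>p\<in>grad_graph. emb \<Omega> \<tau> \<bullet> snd p = - (emb \<Omega> q \<bullet> fst p))"
proof
  assume wd: "has_wdiv \<Omega> \<tau> q"
  define Z where "Z = {p :: ('d, real) l2 \<times> ('d, real^'d) l2. emb \<Omega> \<tau> \<bullet> snd p = - (emb \<Omega> q \<bullet> fst p)}"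
  have "closed Z" unfolding Z_def by (intro closed_Collect_eq continuous_intros)
  moreover have "test_graph \<subseteq> Z"
    using wd by (auto simp: test_graph_def Z_def emb_simps test_L2 \<tau> has_wdiv_def)
  ultimately have "grad_graph \<subseteq> Z" unfolding grad_graph_def by (intro closure_minimal)
  then show "\<forall>p\<in>grad_graph. emb \<Omega> \<tau> \<bullet> snd p = - (emb \<Omega> q \<bullet> fst p)" by (auto simp: Z_def)
next
  assume *: "\<forall>p\<in>grad_graph. emb \<Omega> \<tau> \<bullet> snd p = - (emb \<Omega> q \<bullet> fst p)"
  have "L2_inner \<Omega> \<tau> (cgrad \<phi>) = - L2_inner \<Omega> q \<phi>" if \<phi>: "\<phi> \<in> test_fun \<Omega>" for \<phi>
  proof -
    have "(emb \<Omega> \<phi>, emb \<Omega> (cgrad \<phi>)) \<in> grad_graph"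
      unfolding grad_graph_def by (rule closure_subset[THEN subsetD]) (use \<phi> in \<open>auto simp: test_graph_def\<close>)
    from *[rule_format, OF this] show ?thesis by (simp add: emb_simps test_L2[OF \<phi>] \<tau>)
  qed
  then show "has_wdiv \<Omega> \<tau> q" using \<tau> by (simp add: has_wdiv_def)
qed

end

section \<open>Bounded domains, where the gradient determines the function\<close>

locale bounded_domain = open_domain \<Omega> for \<Omega> :: "(real^'d::finite) set" +
  assumes bounded_domain: "bounded \<Omega>"
begin

lemma grad_graph_poincare: "\<exists>C>0. \<forall>p\<in>grad_graph. norm (fst p) \<le> C * norm (snd p)"
proof -
  obtain R where R: "0 < R" "\<And>x. x \<in> \<Omega> \<Longrightarrow> norm x \<le> R"
    using bounded_domain bounded_pos by metis
  define Z where "Z = {p :: ('d, real) l2 \<times> ('d, real^'d) l2. norm (fst p) \<le> 2 * R * norm (snd p)}"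
  have "closed Z" unfolding Z_def by (intro closed_Collect_le continuous_intros)
  moreover have "test_graph \<subseteq> Z"
    using test_fun_poincare[OF domain_sets _ R] by (auto simp: test_graph_def Z_def emb_simps test_L2)
  ultimately have "grad_graph \<subseteq> Z" unfolding grad_graph_def by (intro closure_minimal)
  then show ?thesis using R(1) by (intro exI[of _ "2 * R"]) (auto simp: Z_def)
qed

text \<open>By the Poincare inequality a pair with zero gradient is zero, so the choice in
  \<open>potential\<close> is forced.\<close>

lemma grad_graph_eq: "p \<in> grad_graph \<longleftrightarrow> snd p \<in> grads \<and> fst p = potential (snd p)"
proof -
  obtain C where C: "\<And>p. p \<in> grad_graph \<Longrightarrow> norm (fst p) \<le> C * norm (snd p)"
    using grad_graph_poincare by blast
  have uniq: "a = a'" if "(a, b) \<in> grad_graph" "(a', b) \<in> grad_graph" for a a' b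
    using C[OF subspace_diff[OF subspace_grad_graph that]] by simp
  have pot: "(potential b, b) \<in> grad_graph" if "b \<in> grads" for b
  proof -
    have "\<exists>a. (a, b) \<in> grad_graph" using that by (auto simp: grads_def)
    then show ?thesis unfolding potential_def by (rule someI_ex)
  qed
  show ?thesis
  proof
    assume p: "p \<in> grad_graph"
    then have b: "snd p \<in> grads" by (auto simp: grads_def)
    have "(fst p, snd p) \<in> grad_graph" using p by simp
    from uniq[OF this pot[OF b]] b show "snd p \<in> grads \<and> fst p = potential (snd p)" by blast
  next
    assume "snd p \<in> grads \<and> fst p = potential (snd p)"
    then have "(fst p, snd p) \<in> grad_graph" using pot[of "snd p"] by simp
    then show "p \<in> grad_graph" by simp
  qed
qed

lemma potential_graph: "b \<in> grads \<Longrightarrow> (potential b, b) \<in> grad_graph"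
  unfolding grad_graph_eq by simp

text \<open>Cauchy gradients have Cauchy potentials by Poincare, so their limit is again a pair in
  the closed graph.\<close>

lemma grads_space: "subspace grads" "complete grads"
proof -
  show "subspace grads" unfolding grads_def
    by (rule linear_subspace_image[OF linear_snd subspace_grad_graph])
  obtain C where C: "0 < C" "\<And>p. p \<in> grad_graph \<Longrightarrow> norm (fst p) \<le> C * norm (snd p)"
    using grad_graph_poincare by blast
  show "complete grads"
  proof (rule completeI)
    fix X :: "nat \<Rightarrow> ('d, real^'d) l2" assume X: "\<forall>n. X n \<in> grads" "Cauchy X"
    then have p: "(potential (X n), X n) \<in> grad_graph" for n by (simp add: potential_graph)
    have "Cauchy (\<lambda>n. potential (X n))"
    proof (rule CauchyI)
      fix e :: real assume "0 < e"
      then obtain M where M: "\<And>m n. m \<ge> M \<Longrightarrow> n \<ge> M \<Longrightarrow> norm (X m - X n) < e / C"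
        using CauchyD[OF X(2), of "e / C"] C(1) by auto
      have "norm (potential (X m) - potential (X n)) < e" if "m \<ge> M" "n \<ge> M" for m n
        using C(2)[OF subspace_diff[OF subspace_grad_graph p p], of m n] M[OF that] C(1)
        by (simp add: pos_less_divide_eq mult.commute)
      then show "\<exists>M. \<forall>m\<ge>M. \<forall>n\<ge>M. norm (potential (X m) - potential (X n)) < e" by blast
    qed
    then obtain a where "(\<lambda>n. potential (X n)) \<longlonglongrightarrow> a" using Cauchy_convergent convergent_def by blast
    moreover obtain b where b: "X \<longlonglongrightarrow> b" using X(2) Cauchy_convergent convergent_def by blast
    ultimately have "(\<lambda>n. (potential (X n), X n)) \<longlonglongrightarrow> (a, b)" by (rule tendsto_Pair)
    then have "(a, b) \<in> grad_graph" by (rule closed_sequentially[OF closed_grad_graph p])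
    then have "b \<in> grads" unfolding grads_def by (rule rev_image_eqI) simp
    then show "\<exists>b\<in>grads. X \<longlonglongrightarrow> b" using b by blast
  qed
qed

lemma potential_add: "x \<in> grads \<Longrightarrow> y \<in> grads \<Longrightarrow> potential (x + y) = potential x + potential y"
  using subspace_add[OF subspace_grad_graph potential_graph potential_graph, of x y] by (simp add: grad_graph_eq)

lemma potential_scaleR: "x \<in> grads \<Longrightarrow> potential (c *\<^sub>R x) = c *\<^sub>R potential x"
  using subspace_scale[OF subspace_grad_graph potential_graph, of x c] by (simp add: grad_graph_eq)

lemma potential_bound: "\<exists>C>0. \<forall>x\<in>grads. norm (potential x) \<le> C * norm x"
  using grad_graph_poincare potential_graph by fastforce

end

section \<open>Compactness from finite-dimensional approximation\<close>

lemma linear_on_adjoint: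
  fixes Ls :: "'a::real_inner \<Rightarrow> 'b::real_inner" and L :: "'b \<Rightarrow> 'a"
  assumes H: "subspace H" and Ls: "\<And>f. Ls f \<in> H" "\<And>f y. y \<in> H \<Longrightarrow> Ls f \<bullet> y = f \<bullet> L y"
  shows "linear Ls"
proof (rule linearI)
  have eq: "a = b" if "a \<in> H" "b \<in> H" "\<And>y. y \<in> H \<Longrightarrow> a \<bullet> y = b \<bullet> y" for a b
  proof -
    have "(a - b) \<bullet> (a - b) = 0" using that(3)[of "a - b"] that(1,2) H by (simp add: inner_diff_left subspace_diff)
    then show ?thesis by simp
  qed
  show "Ls (f + g) = Ls f + Ls g" for f g
    by (rule eq) (simp_all add: Ls subspace_add[OF H] inner_add_left)
  show "Ls (c *\<^sub>R f) = c *\<^sub>R Ls f" for c f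
    by (rule eq) (simp_all add: Ls subspace_scale[OF H])
qed

text \<open>The pointwise rate \<open>r\<close> is uniform on bounded sets by the Baire category theorem, so \<open>Ls\<close>
  is a uniform limit of maps of finite rank.\<close>
lemma uniform_approximation:
  fixes Ls :: "'a::{real_inner, complete_space} \<Rightarrow> 'b::real_inner"
  assumes lin: "linear Ls" and bd: "\<And>f. norm (Ls f) \<le> C * norm f"
    and V: "\<And>n. subspace (V n) \<and> complete (V n)" and r: "\<And>n. 0 \<le> r n"
    and approx: "\<And>f. \<exists>c. \<forall>n :: nat. infdist (Ls f) (V n) \<le> c * r n"
  shows "\<exists>K. \<forall>f n. infdist (Ls f) (V n) \<le> K * norm f * r n"
proof -
  define d where "d n f = norm (Ls f - proj (V n) (Ls f))" for n f
  have dV: "d n f = infdist (Ls f) (V n)" for n f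
    unfolding d_def by (rule proj_infdist) (use V in auto)
  have linP: "linear (\<lambda>f. Ls f - proj (V n) (Ls f))" for n
    using linear_compose_sub[OF lin linear_compose[OF lin linear_proj[of "V n"]]] V by (simp add: o_def)
  have dsub: "d n (f - g) \<le> d n f + d n g" for n f g
    unfolding d_def linear_diff[OF linP] by (rule norm_triangle_ineq4)
  have dscale: "d n (c *\<^sub>R f) = \<bar>c\<bar> * d n f" for n c f
    unfolding d_def linear_scale[OF linP] by simp
  have bl: "bounded_linear Ls"
    by (rule bounded_linear_intro[of _ C]) (use lin bd in \<open>auto simp: linear_add linear_scale mult.commute\<close>)
  \<comment> \<open>\<open>F k\<close> collects the f with rate constant at most k. These closed
    sets cover the space, so one of them contains a ball.\<close>
  define F where "F k = {f. \<forall>n. d n f \<le> real k * r n}" for k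
  have "closed (F k)" for k
  proof -
    have "F k = (\<Inter>n. {f. infdist (Ls f) (V n) \<le> real k * r n})" by (auto simp: F_def dV)
    moreover have "closed {f. infdist (Ls f) (V n) \<le> real k * r n}" for n
      by (intro closed_Collect_le continuous_on_infdist continuous_on_const
          linear_continuous_on[OF bl])
    ultimately show ?thesis by auto
  qed
  moreover have "(\<Union>k. F k) = UNIV"
  proof -
    have "f \<in> (\<Union>k. F k)" for f
    proof -
      obtain c where c: "\<And>n. d n f \<le> c * r n" using approx[of f] by (auto simp: dV)
      obtain k where k: "c \<le> real k" using real_arch_simple by blast
      have "d n f \<le> real k * r n" for n
        using c[of n] mult_right_mono[OF k r[of n]] by linarith
      then show ?thesis by (auto simp: F_def)
    qed
    then show ?thesis by blast
  qed
  ultimately have "\<exists>k. interior (F k) \<noteq> {}"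
  proof -
    assume cl: "\<And>k. closed (F k)" and un: "(\<Union>k. F k) = UNIV"
    show ?thesis
    proof (rule ccontr)
      assume "\<nexists>k. interior (F k) \<noteq> {}"
      then have "Met_TC.mtopology interior_of \<Union>(range F) = {}"
        using cl by (intro Met_TC.metric_Baire_category_alt) (auto simp: complete_UNIV)
      then show False using un by simp
    qed
  qed
  then obtain k f0 where "f0 \<in> interior (F k)" by auto
  then obtain \<epsilon> where \<epsilon>: "0 < \<epsilon>" "ball f0 \<epsilon> \<subseteq> F k" by (auto simp: mem_interior)
  have f0: "d n f0 \<le> real k * r n" for n using \<epsilon> by (auto simp: F_def subset_iff)
  have "d n f \<le> (4 * real k / \<epsilon>) * norm f * r n" for n f
  proof (cases "f = 0")
    case True
    then show ?thesis using linear_0[OF linP[of n]] by (simp add: d_def)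
  next
    case False
    \<comment> \<open>Norm \<epsilon> / 2 keeps f0 + g inside the open ball. Both f0 + g and f0 have
      constant k, so g has 2 k, and scaling back to f gives the factor 4 k / \<epsilon>.\<close>
    define g where "g = (\<epsilon> / 2 / norm f) *\<^sub>R f"
    have "norm g = \<epsilon> / 2" using False \<epsilon> by (simp add: g_def)
    then have "f0 + g \<in> ball f0 \<epsilon>" using \<epsilon>(1) by (simp add: dist_norm)
    then have "d n (f0 + g) \<le> real k * r n" using \<epsilon>(2) by (auto simp: F_def)
    then have "d n g \<le> 2 * (real k * r n)" using dsub[of n "f0 + g" f0] f0[of n] by simp
    moreover have "d n g = \<epsilon> / 2 / norm f * d n f" unfolding g_def dscale using \<epsilon>(1) by simp
    ultimately show ?thesis using \<epsilon>(1) False by (simp add: field_simps)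
  qed
  then show ?thesis unfolding dV by blast
qed

lemma totally_bounded_span_cball:
  fixes B :: "'a::real_inner set"
  assumes "finite B" "0 < e" shows "\<exists>k. finite k \<and> span B \<inter> cball 0 M \<subseteq> (\<Union>x\<in>k. ball x e)"
proof -
  have "seq_compact (span B \<inter> cball 0 M)"
    unfolding seq_compact_def
  proof (intro allI impI)
    fix X :: "nat \<Rightarrow> 'a" assume X: "\<forall>n. X n \<in> span B \<inter> cball 0 M"
    then have "bounded (range X)" by (auto simp: bounded_iff)
    from bounded_seq_subseq_span[OF assms(1) _ this] X
    obtain l r where l: "l \<in> span B" "strict_mono r" "(X \<circ> r) \<longlonglongrightarrow> l" by blast
    have "l \<in> cball 0 M" by (rule closed_sequentially[OF closed_cball _ l(3)]) (use X in auto)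
    then show "\<exists>l\<in>span B \<inter> cball 0 M. \<exists>r. strict_mono r \<and> (X \<circ> r) \<longlonglongrightarrow> l" using l by blast
  qed
  then have "compact (span B \<inter> cball 0 M)" by (simp add: compact_eq_seq_compact_metric)
  then show ?thesis using assms(2) by (simp add: compact_eq_totally_bounded)
qed

text \<open>\<open>Ls\<close> is the adjoint of L. The uniform rate puts the images of bounded
  sequences under it close to finite-dimensional subspaces, hence in a totally bounded set.
  Compactness passes back to L because the squared norm of L d is the inner product of
  \<open>Ls (L d)\<close> with d.\<close>

lemma compact_on_of_adjoint_approximation:
  fixes L :: "'b::real_inner \<Rightarrow> 'a::{real_inner, complete_space}" and Ls :: "'a \<Rightarrow> 'b"
  assumes H: "subspace H" "complete H"
    and Ladd: "\<And>x y. x \<in> H \<Longrightarrow> y \<in> H \<Longrightarrow> L (x + y) = L x + L y"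
    and Lscale: "\<And>c x. x \<in> H \<Longrightarrow> L (c *\<^sub>R x) = c *\<^sub>R L x"
    and C: "0 < C" "\<And>x. x \<in> H \<Longrightarrow> norm (L x) \<le> C * norm x"
    and Ls: "\<And>f. Ls f \<in> H" "\<And>f y. y \<in> H \<Longrightarrow> Ls f \<bullet> y = f \<bullet> L y"
    and V: "\<And>n. \<exists>B. finite B \<and> V n = span B" and r: "\<And>n. 0 \<le> r n" "r \<longlonglongrightarrow> 0"
    and approx: "\<And>f. \<exists>c. \<forall>n :: nat. infdist (Ls f) (V n) \<le> c * r n"
  shows "compact_on H L"
proof -
  have lin: "linear Ls" by (rule linear_on_adjoint[OF H(1) Ls])
  have bd: "norm (Ls f) \<le> C * norm f" for f
  proof -
    have "norm (Ls f) * norm (Ls f) \<le> norm f * norm (L (Ls f))"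
    proof -
      have "norm (Ls f) * norm (Ls f) = Ls f \<bullet> Ls f"
        by (simp only: power2_norm_eq_inner[symmetric] power2_eq_square)
      also have "\<dots> = f \<bullet> L (Ls f)" by (rule Ls(2)[OF Ls(1)])
      finally show ?thesis using norm_cauchy_schwarz[of f "L (Ls f)"] by simp
    qed
    also have "\<dots> \<le> norm f * (C * norm (Ls f))" by (intro mult_left_mono C Ls) auto
    finally have "norm (Ls f) * norm (Ls f) \<le> (C * norm f) * norm (Ls f)" by (simp only: mult_ac)
    then show ?thesis
    proof (cases "Ls f = 0")
      case False
      then have "0 < norm (Ls f)" by simp
      with \<open>norm (Ls f) * norm (Ls f) \<le> (C * norm f) * norm (Ls f)\<close> show ?thesis
        by (rule mult_right_le_imp_le)
    qed (use C(1) in simp)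
  qed
  have Vs: "subspace (V n) \<and> complete (V n)" for n
  proof -
    obtain B where "finite B" "V n = span B" using V by blast
    then show ?thesis by (simp add: complete_span_finite)
  qed
  obtain K0 where K0: "\<And>f n. infdist (Ls f) (V n) \<le> K0 * norm f * r n"
    using uniform_approximation[OF lin bd Vs r(1) approx] by blast
  have sub: "\<exists>r l. strict_mono r \<and> (\<lambda>n. L (X (r n))) \<longlonglongrightarrow> l"
    if X: "\<And>n. X n \<in> H" "bounded (range X)" for X :: "nat \<Rightarrow> 'b"
  proof -
    obtain M where M: "0 < M" "\<And>n. norm (X n) \<le> M" using X(2) by (auto simp: bounded_pos)
    define Y where "Y n = Ls (L (X n))" for n
    have LX: "norm (L (X n)) \<le> C * M" for n
      using C(2)[OF X(1), of n] mult_left_mono[OF M(2), of C n] C(1) by linarith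
    have YM: "norm (Y n) \<le> C * (C * M)" for n
      unfolding Y_def using bd[of "L (X n)"] mult_left_mono[OF LX, of C n] C(1) by linarith
    define T where "T = closure (range Y)"
    have TH: "T \<subseteq> H" unfolding T_def
      by (rule closure_minimal) (use Ls complete_imp_closed[OF H(2)] in \<open>auto simp: Y_def\<close>)
    have "\<exists>k. finite k \<and> T \<subseteq> (\<Union>x\<in>k. ball x e)" if e: "0 < e" for e
    proof -
      have "(\<lambda>n. \<bar>K0\<bar> * (C * M) * r n) \<longlonglongrightarrow> \<bar>K0\<bar> * (C * M) * 0" by (intro tendsto_intros r)
      then have "(\<lambda>n. \<bar>K0\<bar> * (C * M) * r n) \<longlonglongrightarrow> 0" by simp
      from order_tendstoD(2)[OF this, of "e / 3"] e obtain N where N: "\<bar>K0\<bar> * (C * M) * r N < e / 3"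
        by (auto simp: eventually_sequentially)
      obtain B where B: "finite B" "V N = span B" using V by blast
      have VN: "subspace (V N)" "complete (V N)" using Vs by auto
      obtain k where k: "finite k" "V N \<inter> cball 0 (C * (C * M)) \<subseteq> (\<Union>x\<in>k. ball x (e / 3))"
      proof -
        have "0 < e / 3" using e by simp
        from totally_bounded_span_cball[OF B(1) this, of "C * (C * M)"] that show ?thesis
          unfolding B(2) by blast
      qed
      \<comment> \<open>One third is the distance to \<open>V N\<close>, another the mesh of the net
        there. Closed balls of radius 2 e / 3 pass to the closure T and still fit into open balls of
        radius e.\<close>
      have "Y n \<in> (\<Union>x\<in>k. cball x (2 * e / 3))" for n
      proof -
        define p where "p = proj (V N) (Y n)"
        have "p \<in> V N \<inter> cball 0 (C * (C * M))"
          using proj_in[OF VN, of "Y n"] norm_proj_le[OF VN, of "Y n"] YM[of n] by (simp add: p_def)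
        then obtain x where x: "x \<in> k" "dist x p < e / 3" using k(2) by auto
        have "norm (Y n - p) = infdist (Y n) (V N)" unfolding p_def by (rule proj_infdist[OF VN])
        also have "\<dots> \<le> K0 * norm (L (X n)) * r N" unfolding Y_def by (rule K0)
        also have "\<dots> \<le> \<bar>K0\<bar> * (C * M) * r N"
          using LX[of n] r(1) by (intro mult_right_mono mult_mono) auto
        finally have "dist p (Y n) < e / 3" using N by (simp add: dist_norm norm_minus_commute)
        with x(2) have "dist x (Y n) < 2 * e / 3" using dist_triangle[of x "Y n" p] by linarith
        then show ?thesis using x(1) by (auto intro!: bexI[of _ x])
      qed
      then have "range Y \<subseteq> (\<Union>x\<in>k. cball x (2 * e / 3))" by blast
      then have "T \<subseteq> (\<Union>x\<in>k. cball x (2 * e / 3))" unfolding T_def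
        by (intro closure_minimal closed_UN k) auto
      moreover have "cball x (2 * e / 3) \<subseteq> ball x e" for x :: 'b using e by (auto simp: subset_iff)
      ultimately have "T \<subseteq> (\<Union>x\<in>k. ball x e)" by blast
      then show ?thesis using k(1) by blast
    qed
    moreover have "complete T"
      by (rule complete_closed_subset[OF _ TH H(2)]) (simp add: T_def)
    ultimately have "compact T" unfolding compact_eq_totally_bounded by blast
    then have sc: "seq_compact T" by (rule compact_imp_seq_compact)
    have YT: "Y n \<in> T" for n unfolding T_def using closure_subset[of "range Y"] by auto
    obtain l q where lq: "l \<in> T" "strict_mono q" "(Y \<circ> q) \<longlonglongrightarrow> l"
      by (rule seq_compactE[OF sc]) (use YT in auto)
    then have Yc: "Cauchy (\<lambda>n. Y (q n))" unfolding comp_def by (intro LIMSEQ_imp_Cauchy)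
    have key: "(norm (L (X m) - L (X n)))\<^sup>2 \<le> norm (Y m - Y n) * (2 * M)" for m n
    proof -
      have XH: "X m - X n \<in> H" by (intro subspace_diff H X)
      have Ld: "L (X m - X n) = L (X m) - L (X n)"
        using Ladd[OF X(1) subspace_scale[OF H(1) X(1)], of m "-1" n] Lscale[OF X(1), of "-1" n] by simp
      have "(norm (L (X m) - L (X n)))\<^sup>2 = Ls (L (X m) - L (X n)) \<bullet> (X m - X n)"
        unfolding Ls(2)[OF XH] Ld by (rule power2_norm_eq_inner)
      also have "\<dots> = (Y m - Y n) \<bullet> (X m - X n)" unfolding Y_def linear_diff[OF lin] ..
      also have "\<dots> \<le> norm (Y m - Y n) * norm (X m - X n)" by (rule norm_cauchy_schwarz)
      also have "\<dots> \<le> norm (Y m - Y n) * (2 * M)"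
        using norm_triangle_ineq4[of "X m" "X n"] M(2)[of m] M(2)[of n] by (intro mult_left_mono) auto
      finally show ?thesis .
    qed
    have "Cauchy (\<lambda>n. L (X (q n)))"
    proof (rule CauchyI)
      fix e :: real assume e: "0 < e"
      then have "0 < e\<^sup>2 / (2 * M)" using M(1) by simp
      from CauchyD[OF Yc this] obtain N where N: "\<And>m n. m \<ge> N \<Longrightarrow> n \<ge> N \<Longrightarrow> norm (Y (q m) - Y (q n)) < e\<^sup>2 / (2 * M)"
        by auto
      have "norm (L (X (q m)) - L (X (q n))) < e" if "m \<ge> N" "n \<ge> N" for m n
      proof (rule power2_less_imp_less)
        have "norm (Y (q m) - Y (q n)) * (2 * M) < e\<^sup>2" using N[OF that] M(1) by (simp add: pos_less_divide_eq)
        then show "(norm (L (X (q m)) - L (X (q n))))\<^sup>2 < e\<^sup>2" using key[of "q m" "q n"] by linarith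
      qed (use e in simp)
      then show "\<exists>N. \<forall>m\<ge>N. \<forall>n\<ge>N. norm (L (X (q m)) - L (X (q n))) < e" by blast
    qed
    then obtain a where "(\<lambda>n. L (X (q n))) \<longlonglongrightarrow> a" using Cauchy_convergent convergent_def by blast
    then show ?thesis using lq(2) by blast
  qed
  show ?thesis unfolding compact_on_def
  proof (intro conjI)
    show "\<forall>x\<in>H. \<forall>y\<in>H. L (x + y) = L x + L y" using Ladd by blast
    show "\<forall>c. \<forall>x\<in>H. L (c *\<^sub>R x) = c *\<^sub>R L x" using Lscale by blast
    show "\<exists>C. \<forall>x\<in>H. norm (L x) \<le> C * norm x" using C by blast
    show "\<forall>X :: nat \<Rightarrow> 'b. (\<forall>n. X n \<in> H) \<and> bounded (range X) \<longrightarrow>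
        (\<exists>r l. strict_mono r \<and> (\<lambda>n. L (X (r n))) \<longlonglongrightarrow> l)"
      using sub by blast
  qed
qed

subsection \<open>Passing to classes of functions\<close>

lemma ae_sum_L2:
  assumes "finite I" "\<And>k. k \<in> I \<Longrightarrow> f k \<in> L2 \<Omega>" shows "(\<lambda>x. \<Sum>k\<in>I. c k *\<^sub>R f k x) \<in> L2 \<Omega>"
  using assms
proof (induction I rule: finite_induct)
  case (insert k I)
  have "f k \<in> L2 \<Omega>" "(\<lambda>x. \<Sum>k\<in>I. c k *\<^sub>R f k x) \<in> L2 \<Omega>" using insert by auto
  then have "(\<lambda>x. c k *\<^sub>R f k x + (\<Sum>k\<in>I. c k *\<^sub>R f k x)) \<in> L2 \<Omega>" by (intro L2_add L2_scaleR)
  then show ?case using insert.hyps by simp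
qed (simp add: L2_zero)

text \<open>A discrete space is a span only up to null sets, but its image in a space of classes is
  a genuine span. The hypotheses on e are linearity on V and invariance under a.e. equality; e will
  be the field with its divergence, or the gradient.\<close>

lemma fin_dim_image_span:
  fixes e :: "(real^'d \<Rightarrow> 'b::euclidean_space) \<Rightarrow> 'c::real_vector"
  assumes fd: "fin_dim_subspace \<Omega> W V"
    and zero: "(\<lambda>x. 0) \<in> V" "e (\<lambda>x. 0) = 0"
    and comb: "\<And>c f g. f \<in> V \<Longrightarrow> g \<in> V \<Longrightarrow> (\<lambda>x. c *\<^sub>R f x + g x) \<in> V"
      "\<And>c f g. f \<in> V \<Longrightarrow> g \<in> V \<Longrightarrow> e (\<lambda>x. c *\<^sub>R f x + g x) = c *\<^sub>R e f + e g"
    and ae: "\<And>f g. f \<in> V \<Longrightarrow> g \<in> V \<Longrightarrow> AE x in lebesgue_on \<Omega>. f x = g x \<Longrightarrow> e f = e g"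
  shows "W \<subseteq> V" "(\<lambda>x. 0) \<in> W" "\<exists>B. finite B \<and> e ` W = span B"
proof -
  obtain B where B: "finite B" "B \<subseteq> V"
    and W: "W = {w \<in> V. \<exists>c. AE x in lebesgue_on \<Omega>. w x = (\<Sum>b\<in>B. c b *\<^sub>R b x)}"
    using fd by (auto simp: fin_dim_subspace_def)
  show "W \<subseteq> V" by (auto simp: W)
  show "(\<lambda>x. 0) \<in> W" unfolding W using zero(1) by (auto intro!: exI[of _ "\<lambda>_. 0"])
  have sum: "(\<lambda>x. \<Sum>b\<in>A. c b *\<^sub>R b x) \<in> V \<and> e (\<lambda>x. \<Sum>b\<in>A. c b *\<^sub>R b x) = (\<Sum>b\<in>A. c b *\<^sub>R e b)"
    if "finite A" "A \<subseteq> V" for A c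
    using that by (induction A rule: finite_induct) (auto simp: zero comb)
  have "e ` W = span (e ` B)"
  proof (intro equalityI subsetI)
    fix y assume "y \<in> e ` W"
    then obtain w c where w: "w \<in> V" "y = e w" "AE x in lebesgue_on \<Omega>. w x = (\<Sum>b\<in>B. c b *\<^sub>R b x)"
      by (auto simp: W)
    then have "y = (\<Sum>b\<in>B. c b *\<^sub>R e b)" using ae[OF w(1) _ w(3)] sum[OF B] by simp
    then show "y \<in> span (e ` B)" using sum_in_span_image[of c e B] by simp
  next
    fix y assume "y \<in> span (e ` B)"
    then obtain c where c: "y = (\<Sum>b\<in>B. c b *\<^sub>R e b)" using span_image_coeffs[OF B(1)] by blast
    have "(\<lambda>x. \<Sum>b\<in>B. c b *\<^sub>R b x) \<in> W" using sum[OF B] by (auto simp: W)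
    then show "y \<in> e ` W" using sum[OF B, of c] c by (intro rev_image_eqI) auto
  qed
  then show "\<exists>B. finite B \<and> e ` W = span B" using B(1) by blast
qed

text \<open>The Galerkin equations for classes: s is the flux paired with its divergence, and g is
  the gradient of the scalar unknown.\<close>

definition galerkin_eqs ::
  "('b::real_inner \<times> 'a::real_inner) set \<Rightarrow> 'b set \<Rightarrow> 'a \<Rightarrow> 'b \<times> 'a \<Rightarrow> 'b \<Rightarrow> bool" where
  "galerkin_eqs S U F s g \<longleftrightarrow> s \<in> S \<and> g \<in> U \<and>
     (\<forall>t\<in>S. s \<bullet> t - g \<bullet> fst t = - (F \<bullet> snd t)) \<and> (\<forall>y\<in>U. fst s \<bullet> y = g \<bullet> y)"

text \<open>The equations are the normal equations for the least squares functional
  \<open>(norm (fst s - g))\<^sup>2 + (norm (snd s + F))\<^sup>2\<close>.\<close>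
lemma galerkin_eqs_unique:
  assumes S: "subspace S" "S \<subseteq> div_graph H L" and U: "subspace U" "U \<subseteq> H"
    and 1: "galerkin_eqs S U F s g" and 2: "galerkin_eqs S U F s' g'"
  shows "g = g'"
proof -
  define \<delta> where "\<delta> = s - s'"
  define \<gamma> where "\<gamma> = g - g'"
  have \<delta>S: "\<delta> \<in> S" and \<gamma>U: "\<gamma> \<in> U"
    using 1 2 S U by (auto simp: \<delta>_def \<gamma>_def galerkin_eqs_def subspace_diff)
  have e1: "\<delta> \<bullet> \<delta> = \<gamma> \<bullet> fst \<delta>"
  proof -
    have "s \<bullet> \<delta> - g \<bullet> fst \<delta> = s' \<bullet> \<delta> - g' \<bullet> fst \<delta>" using 1 2 \<delta>S by (simp add: galerkin_eqs_def)
    then show ?thesis by (simp add: \<delta>_def \<gamma>_def inner_diff_left)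
  qed
  have e2: "fst \<delta> \<bullet> \<gamma> = \<gamma> \<bullet> \<gamma>"
  proof -
    have "fst s \<bullet> \<gamma> = g \<bullet> \<gamma>" "fst s' \<bullet> \<gamma> = g' \<bullet> \<gamma>" using 1 2 \<gamma>U by (auto simp: galerkin_eqs_def)
    then show ?thesis by (simp add: \<delta>_def \<gamma>_def inner_diff_left)
  qed
  have "(norm (fst \<delta> - \<gamma>))\<^sup>2 + (norm (snd \<delta>))\<^sup>2 = \<delta> \<bullet> \<delta> - 2 * (fst \<delta> \<bullet> \<gamma>) + \<gamma> \<bullet> \<gamma>"
    unfolding power2_norm_diff by (simp add: inner_prod_def power2_norm_eq_inner)
  also have "\<dots> = 0" using e1 e2 by (simp add: inner_commute)
  \<comment> \<open>The homogeneous functional vanishes, so the difference of fluxes is a gradient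
    with zero divergence; integration by parts makes it zero.\<close>
  finally have "snd \<delta> = 0" "fst \<delta> = \<gamma>" by (simp_all add: sum_power2_eq_zero_iff)
  moreover have "fst \<delta> \<bullet> \<gamma> = - (snd \<delta> \<bullet> L \<gamma>)" using \<delta>S \<gamma>U S(2) U(2) by (auto simp: div_graph_def)
  ultimately have "\<gamma> = 0" using e2 by simp
  then show ?thesis by (simp add: \<gamma>_def)
qed

text \<open>The least squares minimiser exists as the projection of (0, - F) on the image of J, the
  map from (s, g) to (fst s - g, snd s). The image is finite-dimensional, hence complete.\<close>

lemma galerkin_eqs_exists:
  fixes S :: "('b::real_inner \<times> 'a::real_inner) set"
  assumes S: "\<exists>B. finite B \<and> S = span B" and U: "\<exists>B. finite B \<and> U = span B"
  shows "\<exists>s g. galerkin_eqs S U F s g"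
proof -
  define J where "J p = (fst (fst p) - snd p, snd (fst p))" for p :: "('b \<times> 'a) \<times> 'b"
  have Jl: "linear J" by (rule linearI) (auto simp: J_def algebra_simps)
  obtain B1 B2 where B: "finite B1" "S = span B1" "finite B2" "U = span B2" using S U by blast
  have ss: "subspace S" "subspace U" by (auto simp: B)
  define W where "W = J ` (S \<times> U)"
  have "W = span (J ` ((\<lambda>b. (b, 0)) ` B1 \<union> Pair 0 ` B2))"
  proof -
    have l1: "linear (\<lambda>b :: 'b \<times> 'a. (b, 0 :: 'b))" and l2: "linear (Pair (0 :: 'b \<times> 'a) :: 'b \<Rightarrow> _)"
      by (auto intro!: linearI)
    have "span ((\<lambda>b. (b, 0)) ` B1 \<union> Pair 0 ` B2) = S \<times> U"
      unfolding span_Un linear_span_image[OF l1] linear_span_image[OF l2] B(2,4)[symmetric]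
    proof (intro equalityI subsetI)
      fix p assume "p \<in> {x + y |x y. x \<in> (\<lambda>b. (b, 0)) ` S \<and> y \<in> Pair 0 ` U}"
      then obtain s u where "s \<in> S" "u \<in> U" "p = (s, 0) + (0, u)" by blast
      then show "p \<in> S \<times> U" by simp
    next
      fix p assume "p \<in> S \<times> U"
      then obtain s u where su: "s \<in> S" "u \<in> U" "p = (s, u)" by blast
      then have "p = (s, 0) + (0, u)" by simp
      then show "p \<in> {x + y |x y. x \<in> (\<lambda>b. (b, 0)) ` S \<and> y \<in> Pair 0 ` U}" using su(1,2) by blast
    qed
    then show ?thesis unfolding W_def linear_span_image[OF Jl] by simp
  qed
  then have W: "subspace W" "complete W"
    using complete_span_finite[of "J ` ((\<lambda>b. (b, 0)) ` B1 \<union> Pair 0 ` B2)"] B by auto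
  obtain s g where sg: "s \<in> S" "g \<in> U" "proj W (0, - F) = J (s, g)"
    using proj_in[OF W, of "(0, - F)"] by (auto simp: W_def)
  have key: "J (s, g) \<bullet> J (t, y) = - (F \<bullet> snd t)" if "t \<in> S" "y \<in> U" for t y
  proof -
    have "J (t, y) \<in> W" using that by (auto simp: W_def)
    from proj_inner[OF W this, of "(0, - F)"] show ?thesis by (simp add: sg(3)) (simp add: J_def inner_prod_def)
  qed
  have "s \<bullet> t - g \<bullet> fst t = - (F \<bullet> snd t)" if "t \<in> S" for t
    using key[OF that subspace_0[OF ss(2)]] by (simp add: J_def inner_prod_def inner_diff_left)
  moreover have "fst s \<bullet> y = g \<bullet> y" if "y \<in> U" for y
    using key[OF subspace_0[OF ss(1)] that] by (simp add: J_def inner_prod_def inner_diff_left)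
  ultimately have "galerkin_eqs S U F s g" using sg unfolding galerkin_eqs_def by blast
  then show ?thesis by blast
qed

context ls_discretization
begin

text \<open>The first equation forces s to be 1 + \<mu> times the flux of g; the second is then the
  eigenvalue equation of \<open>flux\<close>. For \<mu> = 1 / \<lambda> the value \<mu> / (1 +
  \<mu>) is 1 / (1 + \<lambda>).\<close>

lemma galerkin_eqs_eigen:
  assumes \<mu>: "0 < \<mu>" and g: "g \<in> U"
  shows "(\<exists>s. galerkin_eqs S U (L g) s (\<mu> *\<^sub>R g)) \<longleftrightarrow> g \<in> eigvec (flux S) U (\<mu> / (1 + \<mu>))"
proof -
  have div: "snd t \<bullet> L g = - (fst t \<bullet> g)" if "t \<in> S" for t
  proof -
    have "fst t \<bullet> g = - (snd t \<bullet> L g)" using that g S(2) U(2) by (auto simp: div_graph_def)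
    then show ?thesis by simp
  qed
  have first: "(\<forall>t\<in>S. s \<bullet> t - (\<mu> *\<^sub>R g) \<bullet> fst t = - (L g \<bullet> snd t)) \<longleftrightarrow> s = (1 + \<mu>) *\<^sub>R flux S g"
    if s: "s \<in> S" for s
  proof -
    have "(\<forall>t\<in>S. s \<bullet> t - (\<mu> *\<^sub>R g) \<bullet> fst t = - (L g \<bullet> snd t)) \<longleftrightarrow> (\<forall>t\<in>S. (s - (1 + \<mu>) *\<^sub>R flux S g) \<bullet> t = 0)"
    proof (intro ball_cong refl)
      fix t assume t: "t \<in> S"
      have "L g \<bullet> snd t = - (g \<bullet> fst t)" using div[OF t] unfolding inner_commute[of "L g"] inner_commute[of g] .
      moreover have "(s - (1 + \<mu>) *\<^sub>R flux S g) \<bullet> t = s \<bullet> t - (1 + \<mu>) * (g \<bullet> fst t)"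
        by (simp add: inner_diff_left flux_inner[OF t])
      ultimately show "(s \<bullet> t - (\<mu> *\<^sub>R g) \<bullet> fst t = - (L g \<bullet> snd t)) \<longleftrightarrow> ((s - (1 + \<mu>) *\<^sub>R flux S g) \<bullet> t = 0)"
        unfolding distrib_right inner_scaleR_left by auto
    qed
    also have "\<dots> \<longleftrightarrow> s = (1 + \<mu>) *\<^sub>R flux S g"
    proof
      assume *: "\<forall>t\<in>S. (s - (1 + \<mu>) *\<^sub>R flux S g) \<bullet> t = 0"
      have "s - (1 + \<mu>) *\<^sub>R flux S g \<in> S" using s flux_in S_space by (simp add: subspace_diff subspace_scale)
      from *[rule_format, OF this] show "s = (1 + \<mu>) *\<^sub>R flux S g" by simp
    qed simp
    finally show ?thesis .
  qed
  have second: "fst ((1 + \<mu>) *\<^sub>R flux S g) \<bullet> y = (\<mu> *\<^sub>R g) \<bullet> y \<longleftrightarrow> flux S g \<bullet> flux S y = \<mu> / (1 + \<mu>) * (g \<bullet> y)" for y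
  proof -
    have "flux S g \<bullet> flux S y = fst (flux S g) \<bullet> y"
      using flux_inner[OF flux_in, of y g] by (simp add: inner_commute)
    moreover have "fst ((1 + \<mu>) *\<^sub>R flux S g) \<bullet> y = (1 + \<mu>) * (fst (flux S g) \<bullet> y)"
      unfolding fst_scaleR inner_scaleR_left ..
    ultimately show ?thesis using \<mu> by (simp add: field_simps)
  qed
  have "(1 + \<mu>) *\<^sub>R flux S g \<in> S" using flux_in S_space by (simp add: subspace_scale)
  moreover have "\<mu> *\<^sub>R g \<in> U" using g U_space by (simp add: subspace_scale)
  ultimately have "(\<exists>s. galerkin_eqs S U (L g) s (\<mu> *\<^sub>R g)) \<longleftrightarrow>
      (\<forall>y\<in>U. fst ((1 + \<mu>) *\<^sub>R flux S g) \<bullet> y = (\<mu> *\<^sub>R g) \<bullet> y)"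
    unfolding galerkin_eqs_def using first by metis
  then show ?thesis unfolding second using g by (simp add: eigvec_def)
qed

end

section \<open>Translation between Sobolev functions and their classes\<close>

context bounded_domain
begin

abbreviation (input) e_div :: "(real^'d \<Rightarrow> real^'d) \<Rightarrow> ('d, real^'d) l2 \<times> ('d, real) l2" where
  "e_div \<tau> \<equiv> (emb \<Omega> \<tau>, emb \<Omega> (wdiv \<Omega> \<tau>))"

abbreviation (input) e_grad :: "(real^'d \<Rightarrow> real) \<Rightarrow> ('d, real^'d) l2" where
  "e_grad u \<equiv> emb \<Omega> (wgrad \<Omega> u)"

lemma Hdiv_L2: "\<tau> \<in> Hdiv \<Omega> \<Longrightarrow> \<tau> \<in> L2 \<Omega>" and H10_L2: "u \<in> H10 \<Omega> \<Longrightarrow> u \<in> L2 \<Omega>"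
  by (auto simp: Hdiv_def H10_def H1_def)

lemma wdiv_L2: "\<tau> \<in> Hdiv \<Omega> \<Longrightarrow> wdiv \<Omega> \<tau> \<in> L2 \<Omega>"
  by (rule has_wdiv_L2[OF Hdiv_has_wdiv])

lemma H10_has_wgrad: "u \<in> H10 \<Omega> \<Longrightarrow> has_wgrad \<Omega> u (wgrad \<Omega> u)"
  by (rule H1_has_wgrad) (simp add: H10_def)

lemma wgrad_L2: "u \<in> H10 \<Omega> \<Longrightarrow> wgrad \<Omega> u \<in> L2 \<Omega>"
  by (rule has_wgrad_L2[OF H10_has_wgrad])

lemma e_grad_in: "u \<in> H10 \<Omega> \<Longrightarrow> e_grad u \<in> grads"
  and potential_e_grad: "u \<in> H10 \<Omega> \<Longrightarrow> potential (e_grad u) = emb \<Omega> u"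
  using H10_imp_graph[of u] by (auto simp: grad_graph_eq)

text \<open>The way back from classes: a function whose class is the potential of g belongs to
  \<open>H10\<close>, and its gradient class is g.\<close>

lemma H10_of_potential:
  assumes w: "w \<in> L2 \<Omega>" and g: "g \<in> grads" "emb \<Omega> w = potential g"
  shows "w \<in> H10 \<Omega>" "e_grad w = g"
proof -
  have gr: "(emb \<Omega> w, g) \<in> grad_graph" using g by (simp add: grad_graph_eq)
  then have r: "emb \<Omega> (rep_l2 g) = g" by (rule grad_graph_rep)
  then have "(emb \<Omega> w, emb \<Omega> (rep_l2 g)) \<in> grad_graph" using gr by simp
  note G = graph_imp_H10[OF this w rep_l2_L2[OF domain_sets]]
  show "w \<in> H10 \<Omega>" by (rule G(2))
  show "e_grad w = g" using emb_wgrad[OF G(1)] r by simp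
qed

lemma H10_rep_potential:
  assumes "g \<in> grads"
  shows "rep_l2 (potential g) \<in> H10 \<Omega>" "e_grad (rep_l2 (potential g)) = g"
    "emb \<Omega> (rep_l2 (potential g)) = potential g"
proof -
  show e: "emb \<Omega> (rep_l2 (potential g)) = potential g"
    by (rule grad_graph_rep(1)[OF potential_graph[OF assms]])
  show "rep_l2 (potential g) \<in> H10 \<Omega>" "e_grad (rep_l2 (potential g)) = g"
    using H10_of_potential[OF rep_l2_L2[OF domain_sets] assms e] by auto
qed

lemma e_div_in:
  assumes "\<tau> \<in> Hdiv \<Omega>" shows "e_div \<tau> \<in> div_graph grads potential"
proof -
  have "\<forall>p\<in>grad_graph. emb \<Omega> \<tau> \<bullet> snd p = - (emb \<Omega> (wdiv \<Omega> \<tau>) \<bullet> fst p)"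
    using Hdiv_orthogonality[OF Hdiv_L2[OF assms] wdiv_L2[OF assms]] Hdiv_has_wdiv[OF assms] by blast
  then show ?thesis using potential_graph by (force simp: div_graph_def)
qed

lemma Hdiv_of_div_graph:
  assumes \<tau>: "\<tau> \<in> L2 \<Omega>" "q \<in> L2 \<Omega>" and "(emb \<Omega> \<tau>, emb \<Omega> q) \<in> div_graph grads potential"
  shows "has_wdiv \<Omega> \<tau> q" "\<tau> \<in> Hdiv \<Omega>" "e_div \<tau> = (emb \<Omega> \<tau>, emb \<Omega> q)"
proof -
  show w: "has_wdiv \<Omega> \<tau> q"
    unfolding Hdiv_orthogonality[OF \<tau>] using assms(3) by (auto simp: div_graph_def grad_graph_eq)
  then show "\<tau> \<in> Hdiv \<Omega>" using \<tau> by (auto simp: Hdiv_def)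
  show "e_div \<tau> = (emb \<Omega> \<tau>, emb \<Omega> q)" by (simp add: emb_wdiv[OF w])
qed

lemma emb_zero: "emb \<Omega> (\<lambda>x. 0) = 0"
  using emb_scaleR[OF domain_sets L2_zero, of 0] by simp

lemma Hdiv_comb:
  assumes "\<tau> \<in> Hdiv \<Omega>" "\<rho> \<in> Hdiv \<Omega>"
  shows "(\<lambda>x. c *\<^sub>R \<tau> x + \<rho> x) \<in> Hdiv \<Omega>" "e_div (\<lambda>x. c *\<^sub>R \<tau> x + \<rho> x) = c *\<^sub>R e_div \<tau> + e_div \<rho>"
proof -
  note w = has_wdiv_comb[OF Hdiv_L2[OF assms(1)] Hdiv_has_wdiv[OF assms(1)] Hdiv_L2[OF assms(2)] Hdiv_has_wdiv[OF assms(2)], of c]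
  show "(\<lambda>x. c *\<^sub>R \<tau> x + \<rho> x) \<in> Hdiv \<Omega>"
    using w L2_add[OF L2_scaleR[OF Hdiv_L2[OF assms(1)]] Hdiv_L2[OF assms(2)]] by (auto simp: Hdiv_def)
  show "e_div (\<lambda>x. c *\<^sub>R \<tau> x + \<rho> x) = c *\<^sub>R e_div \<tau> + e_div \<rho>"
    using emb_wdiv[OF w] emb_scaled_sum[OF domain_sets Hdiv_L2[OF assms(1)] Hdiv_L2[OF assms(2)], of c]
      emb_scaled_sum[OF domain_sets wdiv_L2[OF assms(1)] wdiv_L2[OF assms(2)], of c] by simp
qed

lemma H10_comb:
  assumes "u \<in> H10 \<Omega>" "v \<in> H10 \<Omega>"
  shows "(\<lambda>x. c *\<^sub>R u x + v x) \<in> H10 \<Omega>" "e_grad (\<lambda>x. c *\<^sub>R u x + v x) = c *\<^sub>R e_grad u + e_grad v"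
proof -
  have L: "(\<lambda>x. c *\<^sub>R u x + v x) \<in> L2 \<Omega>" by (intro L2_add L2_scaleR H10_L2 assms)
  have g: "c *\<^sub>R e_grad u + e_grad v \<in> grads"
    by (intro subspace_add subspace_scale grads_space e_grad_in assms)
  have "emb \<Omega> (\<lambda>x. c *\<^sub>R u x + v x) = c *\<^sub>R emb \<Omega> u + emb \<Omega> v"
    by (rule emb_scaled_sum[OF domain_sets H10_L2[OF assms(1)] H10_L2[OF assms(2)]])
  also have "\<dots> = potential (c *\<^sub>R e_grad u + e_grad v)"
    using assms by (simp add: potential_add potential_scaleR e_grad_in potential_e_grad subspace_scale[OF grads_space(1)])
  finally have p: "emb \<Omega> (\<lambda>x. c *\<^sub>R u x + v x) = potential (c *\<^sub>R e_grad u + e_grad v)" .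
  show "(\<lambda>x. c *\<^sub>R u x + v x) \<in> H10 \<Omega>" "e_grad (\<lambda>x. c *\<^sub>R u x + v x) = c *\<^sub>R e_grad u + e_grad v"
    using H10_of_potential[OF L g p] by auto
qed

lemma zero_H10: "(\<lambda>x. 0) \<in> H10 \<Omega>" "e_grad (\<lambda>x. 0) = 0"
proof -
  have 0: "0 \<in> grads" by (rule subspace_0[OF grads_space(1)])
  have "emb \<Omega> (\<lambda>x. 0) = potential 0" using potential_scaleR[OF 0, of 0] by (simp add: emb_zero)
  from H10_of_potential[OF L2_zero 0 this] show "(\<lambda>x. 0) \<in> H10 \<Omega>" "e_grad (\<lambda>x. 0) = 0" by auto
qed

lemma zero_Hdiv: "(\<lambda>x. 0) \<in> Hdiv \<Omega>" "e_div (\<lambda>x. 0) = 0"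
proof -
  have "(emb \<Omega> (\<lambda>x. 0 :: real^'d), emb \<Omega> (\<lambda>x. 0)) \<in> div_graph grads potential"
    by (simp add: emb_zero div_graph_def)
  from Hdiv_of_div_graph[OF L2_zero L2_zero this]
  show "(\<lambda>x. 0) \<in> Hdiv \<Omega>" "e_div (\<lambda>x. 0) = 0" by (auto simp: emb_zero zero_prod_def)
qed

lemma Hdiv_ae_eq:
  assumes "\<tau> \<in> Hdiv \<Omega>" "\<rho> \<in> Hdiv \<Omega>" "AE x in lebesgue_on \<Omega>. \<tau> x = \<rho> x" shows "e_div \<tau> = e_div \<rho>"
proof -
  have e: "emb \<Omega> \<tau> = emb \<Omega> \<rho>" using assms emb_eq_iff[OF domain_sets Hdiv_L2 Hdiv_L2] by blast
  have "(emb \<Omega> \<tau>, emb \<Omega> (wdiv \<Omega> \<rho>)) \<in> div_graph grads potential"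
    using e_div_in[OF assms(2)] e by simp
  from Hdiv_of_div_graph(3)[OF Hdiv_L2[OF assms(1)] wdiv_L2[OF assms(2)] this] e show ?thesis by simp
qed

lemma H10_ae_eq:
  assumes "u \<in> H10 \<Omega>" "v \<in> H10 \<Omega>" "AE x in lebesgue_on \<Omega>. u x = v x" shows "e_grad u = e_grad v"
proof -
  have "emb \<Omega> u = potential (e_grad v)"
    using assms emb_eq_iff[OF domain_sets H10_L2 H10_L2] by (simp add: potential_e_grad)
  from H10_of_potential(2)[OF H10_L2[OF assms(1)] e_grad_in[OF assms(2)] this] show ?thesis .
qed

lemma fin_dim_Hdiv:
  assumes "fin_dim_subspace \<Omega> S (Hdiv \<Omega>)"
  shows "S \<subseteq> Hdiv \<Omega>" "(\<lambda>x. 0) \<in> S" "\<exists>B. finite B \<and> (\<lambda>\<tau>. e_div \<tau>) ` S = span B"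
  by (rule fin_dim_image_span[where e = "\<lambda>\<tau>. e_div \<tau>", OF assms];
      (rule zero_Hdiv Hdiv_comb Hdiv_ae_eq; assumption))+

lemma fin_dim_H10:
  assumes "fin_dim_subspace \<Omega> U (H10 \<Omega>)"
  shows "U \<subseteq> H10 \<Omega>" "(\<lambda>x. 0) \<in> U" "\<exists>B. finite B \<and> (\<lambda>u. e_grad u) ` U = span B"
  by (rule fin_dim_image_span[where e = "\<lambda>u. e_grad u", OF assms];
      (rule zero_H10 H10_comb H10_ae_eq; assumption))+

lemma galerkin_sol_iff:
  assumes S: "S \<subseteq> Hdiv \<Omega>" and U: "U \<subseteq> H10 \<Omega>" and f: "f \<in> L2 \<Omega>" and \<sigma>: "\<sigma> \<in> S" and u: "u \<in> U"
  shows "galerkin_sol \<Omega> S U f \<sigma> u \<longleftrightarrow>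
    galerkin_eqs ((\<lambda>\<tau>. e_div \<tau>) ` S) ((\<lambda>u. e_grad u) ` U) (emb \<Omega> f) (e_div \<sigma>) (e_grad u)"
proof -
  have d: "\<tau> \<in> L2 \<Omega>" "wdiv \<Omega> \<tau> \<in> L2 \<Omega>" if "\<tau> \<in> S" for \<tau> using that S Hdiv_L2 wdiv_L2 by auto
  have g: "wgrad \<Omega> v \<in> L2 \<Omega>" if "v \<in> U" for v using that U wgrad_L2 by auto
  have 1: "L2_inner \<Omega> \<sigma> \<tau> + L2_inner \<Omega> (wdiv \<Omega> \<sigma>) (wdiv \<Omega> \<tau>) - L2_inner \<Omega> (wgrad \<Omega> u) \<tau>
        = - L2_inner \<Omega> f (wdiv \<Omega> \<tau>)
      \<longleftrightarrow> e_div \<sigma> \<bullet> e_div \<tau> - e_grad u \<bullet> fst (e_div \<tau>) = - (emb \<Omega> f \<bullet> snd (e_div \<tau>))" if "\<tau> \<in> S" for \<tau>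
    using d[OF that] d[OF \<sigma>] g[OF u] f by (simp add: inner_prod_def emb_simps)
  have 2: "- L2_inner \<Omega> \<sigma> (wgrad \<Omega> v) + L2_inner \<Omega> (wgrad \<Omega> u) (wgrad \<Omega> v) = 0
      \<longleftrightarrow> fst (e_div \<sigma>) \<bullet> e_grad v = e_grad u \<bullet> e_grad v" if "v \<in> U" for v
    using d(1)[OF \<sigma>] g[OF u] g[OF that] by (auto simp: emb_simps)
  show ?thesis
    unfolding galerkin_sol_def galerkin_eqs_def ball_simps(9)
    using 1 2 \<sigma> u by (intro conj_cong ball_cong refl) auto
qed

end

subsection \<open>The solution operators\<close>

context bounded_domain
begin

text \<open>The gradient of the weak Poisson solution with data F, as a Riesz representative; it is
  also the adjoint of \<open>potential\<close> on \<open>grads\<close>.\<close>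

definition grad_sol :: "('d, real) l2 \<Rightarrow> ('d, real^'d) l2" where
  "grad_sol F = (SOME z. z \<in> grads \<and> (\<forall>y\<in>grads. z \<bullet> y = F \<bullet> potential y))"

lemma grad_sol_in: "grad_sol F \<in> grads"
  and grad_sol_inner: "y \<in> grads \<Longrightarrow> grad_sol F \<bullet> y = F \<bullet> potential y"
proof -
  obtain C where C: "0 < C" "\<And>x. x \<in> grads \<Longrightarrow> norm (potential x) \<le> C * norm x"
    using potential_bound by blast
  have "\<exists>z\<in>grads. \<forall>y\<in>grads. F \<bullet> potential y = z \<bullet> y"
  proof (rule riesz_representation[OF grads_space, where C = "norm F * C"])
    fix x assume x: "x \<in> grads"
    have "\<bar>F \<bullet> potential x\<bar> \<le> norm F * norm (potential x)" by (rule Cauchy_Schwarz_ineq2)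
    also have "\<dots> \<le> norm F * (C * norm x)" by (intro mult_left_mono C x) auto
    finally show "\<bar>F \<bullet> potential x\<bar> \<le> norm F * C * norm x" by simp
  qed (simp_all add: potential_add potential_scaleR inner_add_right)
  then have "\<exists>z. z \<in> grads \<and> (\<forall>y\<in>grads. z \<bullet> y = F \<bullet> potential y)" by auto
  from someI_ex[OF this] show "grad_sol F \<in> grads" "y \<in> grads \<Longrightarrow> grad_sol F \<bullet> y = F \<bullet> potential y"
    unfolding grad_sol_def by auto
qed

lemma grad_sol_eqI:
  assumes "z \<in> grads" "\<And>y. y \<in> grads \<Longrightarrow> z \<bullet> y = F \<bullet> potential y" shows "grad_sol F = z"
proof -
  have "grad_sol F - z \<in> grads" by (intro subspace_diff grads_space grad_sol_in assms)
  from grad_sol_inner[OF this, of F] assms(2)[OF this] have "(grad_sol F - z) \<bullet> (grad_sol F - z) = 0"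
    by (simp add: inner_diff_left)
  then show ?thesis by simp
qed

lemma poisson_solI:
  assumes f: "f \<in> L2 \<Omega>" and w: "w \<in> H10 \<Omega>" "e_grad w = grad_sol (emb \<Omega> f)"
  shows "poisson_sol \<Omega> f w"
  unfolding poisson_sol_def
proof (intro conjI ballI w)
  fix v assume v: "v \<in> H10 \<Omega>"
  have "L2_inner \<Omega> (wgrad \<Omega> w) (wgrad \<Omega> v) = grad_sol (emb \<Omega> f) \<bullet> e_grad v"
    using w(2) by (simp add: emb_simps wgrad_L2 w(1) v flip: w(2))
  also have "\<dots> = emb \<Omega> f \<bullet> emb \<Omega> v" using v by (simp add: grad_sol_inner e_grad_in potential_e_grad)
  also have "\<dots> = L2_inner \<Omega> f v" by (rule emb_inner[OF domain_sets f H10_L2[OF v]])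
  finally show "L2_inner \<Omega> (wgrad \<Omega> w) (wgrad \<Omega> v) = L2_inner \<Omega> f v" .
qed

lemma wdiv_wgrad:
  assumes f: "f \<in> L2 \<Omega>" and w: "w \<in> H10 \<Omega>" "e_grad w = grad_sol (emb \<Omega> f)"
  shows "wgrad \<Omega> w \<in> Hdiv \<Omega>" "e_div (wgrad \<Omega> w) = (e_grad w, - emb \<Omega> f)"
proof -
  have mf: "emb \<Omega> (\<lambda>x. - f x) = - emb \<Omega> f" using emb_scaleR[OF domain_sets f, of "-1"] by simp
  have "(e_grad w, emb \<Omega> (\<lambda>x. - f x)) \<in> div_graph grads potential"
    unfolding div_graph_def mf w(2) by (simp add: grad_sol_inner)
  from Hdiv_of_div_graph[OF wgrad_L2[OF w(1)] L2_uminus[OF f] this] mf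
  show "wgrad \<Omega> w \<in> Hdiv \<Omega>" "e_div (wgrad \<Omega> w) = (e_grad w, - emb \<Omega> f)" by auto
qed

lemma subspace_e_div: "subspace ((\<lambda>\<tau>. e_div \<tau>) ` Hdiv \<Omega>)"
proof (rule subspaceI)
  show "0 \<in> (\<lambda>\<tau>. e_div \<tau>) ` Hdiv \<Omega>" using zero_Hdiv by (intro rev_image_eqI[of "\<lambda>x. 0"]) auto
next
  fix x y assume "x \<in> (\<lambda>\<tau>. e_div \<tau>) ` Hdiv \<Omega>" "y \<in> (\<lambda>\<tau>. e_div \<tau>) ` Hdiv \<Omega>"
  then obtain \<tau> \<rho> where t: "\<tau> \<in> Hdiv \<Omega>" "\<rho> \<in> Hdiv \<Omega>" and xy: "x = e_div \<tau>" "y = e_div \<rho>" by blast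
  have "x + y = e_div (\<lambda>x. 1 *\<^sub>R \<tau> x + \<rho> x)" unfolding Hdiv_comb(2)[OF t] xy by simp
  then show "x + y \<in> (\<lambda>\<tau>. e_div \<tau>) ` Hdiv \<Omega>" using Hdiv_comb(1)[OF t] by (rule rev_image_eqI[rotated])
next
  fix c x assume "x \<in> (\<lambda>\<tau>. e_div \<tau>) ` Hdiv \<Omega>"
  then obtain \<tau> where t: "\<tau> \<in> Hdiv \<Omega>" and x: "x = e_div \<tau>" by blast
  have "c *\<^sub>R x = e_div (\<lambda>x. c *\<^sub>R \<tau> x + 0)" unfolding Hdiv_comb(2)[OF t zero_Hdiv(1)] x zero_Hdiv(2) by simp
  then show "c *\<^sub>R x \<in> (\<lambda>\<tau>. e_div \<tau>) ` Hdiv \<Omega>"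
    using Hdiv_comb(1)[OF t zero_Hdiv(1)] by (rule rev_image_eqI[rotated])
qed

lemma e_grad_H10: "(\<lambda>u. e_grad u) ` H10 \<Omega> = grads"
proof (intro equalityI subsetI)
  fix g assume g: "g \<in> grads"
  show "g \<in> (\<lambda>u. e_grad u) ` H10 \<Omega>"
    using H10_rep_potential(1,2)[OF g] by (intro rev_image_eqI[of "rep_l2 (potential g)"]) auto
qed (auto intro: e_grad_in)

text \<open>\<open>galerkin_op\<close> is a choice among solutions. Uniqueness of the gradient class
  determines the chosen function up to null sets.\<close>

lemma galerkin_op_eqs:
  assumes S: "S \<subseteq> Hdiv \<Omega>" "subspace ((\<lambda>\<tau>. e_div \<tau>) ` S)"
    and U: "U \<subseteq> H10 \<Omega>" "subspace ((\<lambda>u. e_grad u) ` U)" and f: "f \<in> L2 \<Omega>"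
    and sg: "galerkin_eqs ((\<lambda>\<tau>. e_div \<tau>) ` S) ((\<lambda>u. e_grad u) ` U) (emb \<Omega> f) s g"
  shows "galerkin_op \<Omega> S U f \<in> H10 \<Omega>" "emb \<Omega> (galerkin_op \<Omega> S U f) = potential g"
proof -
  obtain \<sigma> u where \<sigma>: "\<sigma> \<in> S" "s = e_div \<sigma>" and u: "u \<in> U" "g = e_grad u"
    using sg by (auto simp: galerkin_eqs_def)
  have "\<exists>u \<sigma>. galerkin_sol \<Omega> S U f \<sigma> u"
    using galerkin_sol_iff[OF S(1) U(1) f \<sigma>(1) u(1)] sg \<sigma> u by blast
  then have "\<exists>\<sigma>. galerkin_sol \<Omega> S U f \<sigma> (galerkin_op \<Omega> S U f)"
    unfolding galerkin_op_def by (rule someI_ex)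
  then obtain \<sigma>' where sol: "galerkin_sol \<Omega> S U f \<sigma>' (galerkin_op \<Omega> S U f)" by blast
  then have in': "\<sigma>' \<in> S" "galerkin_op \<Omega> S U f \<in> U" by (auto simp: galerkin_sol_def)
  show H: "galerkin_op \<Omega> S U f \<in> H10 \<Omega>" using in'(2) U(1) by blast
  have sub: "(\<lambda>\<tau>. e_div \<tau>) ` S \<subseteq> div_graph grads potential" "(\<lambda>u. e_grad u) ` U \<subseteq> grads"
    using S(1) U(1) e_div_in e_grad_in by blast+
  have "e_grad (galerkin_op \<Omega> S U f) = g"
    using galerkin_eqs_unique[OF S(2) sub(1) U(2) sub(2) _ sg]
      galerkin_sol_iff[OF S(1) U(1) f in'] sol by blast
  then show "emb \<Omega> (galerkin_op \<Omega> S U f) = potential g" using potential_e_grad[OF H] by simp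
qed

text \<open>If w solves the Poisson problem with data f, the flux grad w has divergence - f and
  makes both least squares residuals vanish. So \<open>T_F1\<close> is the Poisson solution
  operator.\<close>

lemma T_F1_emb:
  assumes f: "f \<in> L2 \<Omega>"
  shows "T_F1 \<Omega> f \<in> H10 \<Omega>" "emb \<Omega> (T_F1 \<Omega> f) = potential (grad_sol (emb \<Omega> f))"
proof -
  define z where "z = grad_sol (emb \<Omega> f)"
  define w where "w = rep_l2 (potential z)"
  have w: "w \<in> H10 \<Omega>" "e_grad w = z"
    using H10_rep_potential[OF grad_sol_in[of "emb \<Omega> f"]] by (auto simp: w_def z_def)
  note d = wdiv_wgrad[OF f w[unfolded z_def]]
  have "galerkin_eqs ((\<lambda>\<tau>. e_div \<tau>) ` Hdiv \<Omega>) ((\<lambda>u. e_grad u) ` H10 \<Omega>) (emb \<Omega> f) (e_div (wgrad \<Omega> w)) (e_grad w)"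
    unfolding galerkin_eqs_def
  proof (intro conjI ballI)
    show "e_div (wgrad \<Omega> w) \<in> (\<lambda>\<tau>. e_div \<tau>) ` Hdiv \<Omega>" "e_grad w \<in> (\<lambda>u. e_grad u) ` H10 \<Omega>"
      using d(1) w(1) by blast+
    show "e_div (wgrad \<Omega> w) \<bullet> t - e_grad w \<bullet> fst t = - (emb \<Omega> f \<bullet> snd t)" for t
      unfolding d(2) by (simp add: inner_prod_def)
  qed simp
  from galerkin_op_eqs[OF subset_refl subspace_e_div subset_refl _ f this] w(2)
  show "T_F1 \<Omega> f \<in> H10 \<Omega>" "emb \<Omega> (T_F1 \<Omega> f) = potential (grad_sol (emb \<Omega> f))"
    unfolding T_F1_def e_grad_H10 z_def by (auto simp: grads_space)
qed

lemma in_eigenspace_iff: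
  assumes "w \<in> L2 \<Omega>" "T w \<in> L2 \<Omega>"
  shows "w \<in> eigenspace \<Omega> T \<mu> \<longleftrightarrow> emb \<Omega> (T w) = \<mu> *\<^sub>R emb \<Omega> w"
proof -
  have "emb \<Omega> (T w) = emb \<Omega> (\<lambda>x. \<mu> *\<^sub>R w x) \<longleftrightarrow> (AE x in lebesgue_on \<Omega>. T w x = \<mu> *\<^sub>R w x)"
    by (rule emb_eq_iff[OF domain_sets assms(2) L2_scaleR[OF assms(1)]])
  then show ?thesis using assms(1) emb_scaleR[OF domain_sets assms(1), of \<mu>] by (simp add: eigenspace_def)
qed

text \<open>The Poisson operator is \<open>potential\<close> composed with its adjoint, while
  \<open>eigvec potential\<close> describes the opposite composition on gradients. Both have the
  same eigenvalues, and g is the gradient of w.\<close>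

lemma continuous_eigenspace:
  assumes w: "w \<in> L2 \<Omega>" and \<mu>: "0 < \<mu>"
  shows "w \<in> eigenspace \<Omega> (T_F1 \<Omega>) \<mu> \<longleftrightarrow> (\<exists>g\<in>eigvec potential grads \<mu>. emb \<Omega> w = potential g)"
proof -
  note T = T_F1_emb[OF w]
  have iff: "w \<in> eigenspace \<Omega> (T_F1 \<Omega>) \<mu> \<longleftrightarrow> potential (grad_sol (emb \<Omega> w)) = \<mu> *\<^sub>R emb \<Omega> w"
    using in_eigenspace_iff[where T = "T_F1 \<Omega>", OF w H10_L2[OF T(1)]] T(2) by simp
  show ?thesis unfolding iff
  proof
    assume e: "potential (grad_sol (emb \<Omega> w)) = \<mu> *\<^sub>R emb \<Omega> w"
    define g where "g = (1 / \<mu>) *\<^sub>R grad_sol (emb \<Omega> w)"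
    have p: "potential g = emb \<Omega> w" using e \<mu> by (simp add: g_def potential_scaleR grad_sol_in)
    have gG: "g \<in> grads" by (simp add: g_def subspace_scale grads_space grad_sol_in)
    have "potential g \<bullet> potential y = \<mu> * (g \<bullet> y)" if "y \<in> grads" for y
      unfolding p using \<mu> by (simp add: g_def grad_sol_inner that)
    then show "\<exists>g\<in>eigvec potential grads \<mu>. emb \<Omega> w = potential g"
      using gG p by (auto simp: eigvec_def intro!: bexI[of _ g])
  next
    assume "\<exists>g\<in>eigvec potential grads \<mu>. emb \<Omega> w = potential g"
    then obtain g where g: "g \<in> grads" "\<And>y. y \<in> grads \<Longrightarrow> potential g \<bullet> potential y = \<mu> * (g \<bullet> y)"
      "emb \<Omega> w = potential g" by (auto simp: eigvec_def)
    have "grad_sol (emb \<Omega> w) = \<mu> *\<^sub>R g"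
      by (rule grad_sol_eqI) (simp_all add: g subspace_scale grads_space)
    then show "potential (grad_sol (emb \<Omega> w)) = \<mu> *\<^sub>R emb \<Omega> w" using g by (simp add: potential_scaleR)
  qed
qed

lemma ls_discretizationI:
  assumes "compact_on grads potential" "fin_dim_subspace \<Omega> S (Hdiv \<Omega>)" "fin_dim_subspace \<Omega> U (H10 \<Omega>)"
  shows "ls_discretization grads potential ((\<lambda>\<tau>. e_div \<tau>) ` S) ((\<lambda>u. e_grad u) ` U)"
proof
  show "compact_on grads potential" by fact
  show "\<exists>B. finite B \<and> (\<lambda>\<tau>. e_div \<tau>) ` S = span B" by (rule fin_dim_Hdiv(3)[OF assms(2)])
  show "\<exists>B. finite B \<and> (\<lambda>u. e_grad u) ` U = span B" by (rule fin_dim_H10(3)[OF assms(3)])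
  show "(\<lambda>\<tau>. e_div \<tau>) ` S \<subseteq> div_graph grads potential"
    using fin_dim_Hdiv(1)[OF assms(2)] e_div_in by blast
  show "(\<lambda>u. e_grad u) ` U \<subseteq> grads" using fin_dim_H10(1)[OF assms(3)] e_grad_in by blast
qed

text \<open>An eigenfunction of the solution operator is proportional to the solution with itself as
  data, so it is the potential of a discrete gradient to which \<open>galerkin_eqs_eigen\<close>
  applies.\<close>

lemma discrete_eigenspace:
  assumes c: "compact_on grads potential" and fS: "fin_dim_subspace \<Omega> S (Hdiv \<Omega>)"
    and fU: "fin_dim_subspace \<Omega> U (H10 \<Omega>)" and w: "w \<in> L2 \<Omega>" and \<mu>: "0 < \<mu>"
  shows "w \<in> eigenspace \<Omega> (galerkin_op \<Omega> S U) \<mu> \<longleftrightarrow>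
    (\<exists>g\<in>eigvec (flux ((\<lambda>\<tau>. e_div \<tau>) ` S)) ((\<lambda>u. e_grad u) ` U) (\<mu> / (1 + \<mu>)). emb \<Omega> w = potential g)"
proof -
  define S' where "S' = (\<lambda>\<tau>. e_div \<tau>) ` S"
  define U' where "U' = (\<lambda>u. e_grad u) ` U"
  interpret ls_discretization grads potential S' U'
    unfolding S'_def U'_def by (rule ls_discretizationI[OF c fS fU])
  have SU: "S \<subseteq> Hdiv \<Omega>" "U \<subseteq> H10 \<Omega>" "\<exists>B. finite B \<and> S' = span B" "\<exists>B. finite B \<and> U' = span B"
    using fin_dim_Hdiv[OF fS] fin_dim_H10[OF fU] unfolding S'_def U'_def by blast+
  note op = galerkin_op_eqs[OF SU(1) S_space(1)[unfolded S'_def] SU(2) U_space(1)[unfolded U'_def] w,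
      folded S'_def U'_def]
  obtain s0 g0 where sg: "galerkin_eqs S' U' (emb \<Omega> w) s0 g0" using galerkin_eqs_exists[OF SU(3,4)] by blast
  have g0: "g0 \<in> U'" "g0 \<in> grads" using sg U(2) by (auto simp: galerkin_eqs_def)
  have iff: "w \<in> eigenspace \<Omega> (galerkin_op \<Omega> S U) \<mu> \<longleftrightarrow> potential g0 = \<mu> *\<^sub>R emb \<Omega> w"
    using in_eigenspace_iff[where T = "galerkin_op \<Omega> S U", OF w H10_L2[OF op(1)[OF sg]]] op(2)[OF sg] by simp
  show ?thesis unfolding iff S'_def[symmetric] U'_def[symmetric]
  proof
    assume e: "potential g0 = \<mu> *\<^sub>R emb \<Omega> w"
    define g where "g = (1 / \<mu>) *\<^sub>R g0"
    have gU: "g \<in> U'" using g0(1) U_space by (simp add: g_def subspace_scale)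
    have p: "potential g = emb \<Omega> w" using e \<mu> g0 by (simp add: g_def potential_scaleR)
    have "galerkin_eqs S' U' (potential g) s0 (\<mu> *\<^sub>R g)" unfolding p using sg \<mu> by (simp add: g_def)
    then have "g \<in> eigvec (flux S') U' (\<mu> / (1 + \<mu>))" using galerkin_eqs_eigen[OF \<mu> gU] by blast
    then show "\<exists>g\<in>eigvec (flux S') U' (\<mu> / (1 + \<mu>)). emb \<Omega> w = potential g" using p by force
  next
    assume "\<exists>g\<in>eigvec (flux S') U' (\<mu> / (1 + \<mu>)). emb \<Omega> w = potential g"
    then obtain g where g: "g \<in> eigvec (flux S') U' (\<mu> / (1 + \<mu>))" "emb \<Omega> w = potential g" by blast
    then have gU: "g \<in> U'" by (simp add: eigvec_def)
    then have gG: "g \<in> grads" using U(2) by blast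
    obtain s where "galerkin_eqs S' U' (emb \<Omega> w) s (\<mu> *\<^sub>R g)"
      using galerkin_eqs_eigen[OF \<mu> gU] g by auto
    from op(2)[OF this] op(2)[OF sg] show "potential g0 = \<mu> *\<^sub>R emb \<Omega> w"
      using gG g(2) by (simp add: potential_scaleR)
  qed
qed

lemma emb_sum:
  assumes "finite I" "\<And>k. k \<in> I \<Longrightarrow> f k \<in> L2 \<Omega>"
  shows "emb \<Omega> (\<lambda>x. \<Sum>k\<in>I. c k *\<^sub>R f k x) = (\<Sum>k\<in>I. c k *\<^sub>R emb \<Omega> (f k))"
  using assms
proof (induction I rule: finite_induct)
  case (insert k I)
  have fL: "f l \<in> L2 \<Omega>" if "l \<in> insert k I" for l using insert.prems that by blast
  have "emb \<Omega> (\<lambda>x. c k *\<^sub>R f k x + (\<Sum>k\<in>I. c k *\<^sub>R f k x)) = c k *\<^sub>R emb \<Omega> (f k) + emb \<Omega> (\<lambda>x. \<Sum>k\<in>I. c k *\<^sub>R f k x)"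
    by (rule emb_scaled_sum[OF domain_sets fL ae_sum_L2[OF insert.hyps(1) fL]]) auto
  also have "emb \<Omega> (\<lambda>x. \<Sum>k\<in>I. c k *\<^sub>R f k x) = (\<Sum>k\<in>I. c k *\<^sub>R emb \<Omega> (f k))"
    by (rule insert.IH) (rule fL, simp)
  finally show ?case by (simp only: sum.insert[OF insert.hyps])
qed (simp add: emb_zero)

lemma potential_sum:
  assumes "finite I" "\<And>k. k \<in> I \<Longrightarrow> g k \<in> grads"
  shows "potential (\<Sum>k\<in>I. c k *\<^sub>R g k) = (\<Sum>k\<in>I. c k *\<^sub>R potential (g k))"
  using assms
proof (induction I rule: finite_induct)
  case empty
  show ?case using potential_scaleR[OF subspace_0[OF grads_space(1)], of 0] by simp
next
  case (insert k I)
  have gG: "g l \<in> grads" if "l \<in> insert k I" for l using insert.prems that by blast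
  have sG: "(\<Sum>k\<in>I. c k *\<^sub>R g k) \<in> grads"
    by (intro subspace_sum subspace_scale grads_space gG) auto
  have "potential (c k *\<^sub>R g k + (\<Sum>k\<in>I. c k *\<^sub>R g k)) = c k *\<^sub>R potential (g k) + potential (\<Sum>k\<in>I. c k *\<^sub>R g k)"
    using gG[of k] by (simp only: potential_add[OF subspace_scale[OF grads_space(1)] sG] potential_scaleR insertI1)
  also have "potential (\<Sum>k\<in>I. c k *\<^sub>R g k) = (\<Sum>k\<in>I. c k *\<^sub>R potential (g k))"
    by (rule insert.IH) (rule gG, simp)
  finally show ?case by (simp only: sum.insert[OF insert.hyps])
qed

lemma potential_inj:
  assumes "g \<in> grads" "g' \<in> grads" "potential g = potential g'" shows "g = g'"
  using H10_rep_potential(2)[OF assms(1)] H10_rep_potential(2)[OF assms(2)] unfolding assms(3) by simp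

text \<open>Carries the listing of eigenfunctions over to their gradients. The map \<nu> will be 1 /
  l for the continuous and 1 / (1 + l) for the discrete problem. The listing says nothing about
  values \<mu> outside the range of \<nu>; \<open>surj\<close> ensures that no eigenvectors hide
  there.\<close>

lemma eigen_system_transfer:
  assumes enum: "eigen_enum \<Omega> T K l w"
    and Z: "subspace Z" "complete Z" "compact_on Z A" "Z \<subseteq> grads"
    and eig: "\<And>l v. 0 < l \<Longrightarrow> v \<in> L2 \<Omega> \<Longrightarrow> v \<in> eigenspace \<Omega> T (1 / l) \<longleftrightarrow>
        (\<exists>g\<in>eigvec A Z (\<nu> l). emb \<Omega> v = potential g)"
    and \<nu>: "\<And>l. 0 < l \<Longrightarrow> 0 < \<nu> l" "\<And>l l'. 0 < l \<Longrightarrow> l \<le> l' \<Longrightarrow> \<nu> l' \<le> \<nu> l"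
      "\<And>l l'. 0 < l \<Longrightarrow> 0 < l' \<Longrightarrow> \<nu> l = \<nu> l' \<Longrightarrow> l = l'"
    and surj: "\<And>\<mu>. 0 < \<mu> \<Longrightarrow> (\<exists>l>0. \<nu> l = \<mu>) \<or> eigvec A Z \<mu> \<subseteq> {0}"
  shows "eigen_system A Z K (\<lambda>k. \<nu> (l k)) (\<lambda>k. e_grad (w k))"
    and "\<And>k. k \<in> K \<Longrightarrow> w k \<in> H10 \<Omega>"
proof -
  have lpos: "0 < l k" if "k \<in> K" for k using enum that by (auto simp: eigen_enum_def)
  have basis: "ae_basis \<Omega> {k \<in> K. 1 / l k = \<mu>} w (eigenspace \<Omega> T \<mu>)" if "\<mu> \<noteq> 0" for \<mu>
    using enum that by (auto simp: eigen_enum_def)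
  have wE: "w k \<in> eigenspace \<Omega> T (1 / l k)" if "k \<in> K" for k
    using basis[of "1 / l k"] lpos[OF that] that by (auto simp: ae_basis_def)
  have wL: "w k \<in> L2 \<Omega>" if "k \<in> K" for k using wE[OF that] by (simp add: eigenspace_def)
  have wg: "w k \<in> H10 \<Omega> \<and> e_grad (w k) \<in> eigvec A Z (\<nu> (l k)) \<and> emb \<Omega> (w k) = potential (e_grad (w k))"
    if k: "k \<in> K" for k
  proof -
    obtain g where g: "g \<in> eigvec A Z (\<nu> (l k))" "emb \<Omega> (w k) = potential g"
      using eig[OF lpos[OF k] wL[OF k]] wE[OF k] by blast
    then have "g \<in> grads" using Z(4) by (auto simp: eigvec_def)
    from H10_of_potential[OF wL[OF k] this g(2)] g show ?thesis by simp
  qed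
  show "w k \<in> H10 \<Omega>" if "k \<in> K" for k using wg[OF that] by blast
  have gG: "e_grad (w k) \<in> grads" if "k \<in> K" for k using wg[OF that] by (intro e_grad_in) blast
  show "eigen_system A Z K (\<lambda>k. \<nu> (l k)) (\<lambda>k. e_grad (w k))"
    unfolding eigen_system_def
  proof (intro conjI)
    show "\<forall>k\<in>K. 0 < \<nu> (l k) \<and> e_grad (w k) \<in> eigvec A Z (\<nu> (l k))" using wg lpos \<nu>(1) by blast
    show "\<forall>j\<in>K. \<forall>k\<in>K. j \<le> k \<longrightarrow> \<nu> (l k) \<le> \<nu> (l j)"
      using enum lpos \<nu>(2) by (auto simp: eigen_enum_def)
    show "\<forall>\<mu>>0. finite {k \<in> K. \<nu> (l k) = \<mu>} \<and>
        eigvec A Z \<mu> \<subseteq> span ((\<lambda>k. e_grad (w k)) ` {k \<in> K. \<nu> (l k) = \<mu>}) \<and>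
        (\<forall>c. (\<Sum>k | k \<in> K \<and> \<nu> (l k) = \<mu>. c k *\<^sub>R e_grad (w k)) = 0 \<longrightarrow> (\<forall>k\<in>K. \<nu> (l k) = \<mu> \<longrightarrow> c k = 0))"
    proof (intro allI impI)
      fix \<mu> :: real assume \<mu>: "0 < \<mu>"
      define I where "I = {k \<in> K. \<nu> (l k) = \<mu>}"
      have "finite I \<and> eigvec A Z \<mu> \<subseteq> span ((\<lambda>k. e_grad (w k)) ` I) \<and>
        (\<forall>c. (\<Sum>k\<in>I. c k *\<^sub>R e_grad (w k)) = 0 \<longrightarrow> (\<forall>k\<in>I. c k = 0))"
      proof (cases "\<exists>l>0. \<nu> l = \<mu>")
        case False
        then have "I = {}" using lpos by (auto simp: I_def)
        then show ?thesis using surj[OF \<mu>] False by auto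
      next
        case True
        then obtain \<kappa> where \<kappa>: "0 < \<kappa>" "\<nu> \<kappa> = \<mu>" by blast
        have I: "I = {k \<in> K. 1 / l k = 1 / \<kappa>}"
          using \<kappa> \<nu>(3) lpos by (force simp: I_def)
        have b: "ae_basis \<Omega> I w (eigenspace \<Omega> T (1 / \<kappa>))" unfolding I using \<kappa> by (intro basis) simp
        then have fin: "finite I" by (simp add: ae_basis_def)
        have IK: "I \<subseteq> K" by (auto simp: I_def)
        have embs: "emb \<Omega> (\<lambda>x. \<Sum>k\<in>I. c k * w k x) = potential (\<Sum>k\<in>I. c k *\<^sub>R e_grad (w k))" for c
        proof -
          have "emb \<Omega> (\<lambda>x. \<Sum>k\<in>I. c k * w k x) = (\<Sum>k\<in>I. c k *\<^sub>R emb \<Omega> (w k))"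
            using emb_sum[OF fin, of w c] wL IK by auto
          also have "\<dots> = (\<Sum>k\<in>I. c k *\<^sub>R potential (e_grad (w k)))"
            by (intro sum.cong refl arg_cong[of _ _ "scaleR _"]) (use wg IK in blast)
          also have "\<dots> = potential (\<Sum>k\<in>I. c k *\<^sub>R e_grad (w k))"
            by (rule potential_sum[OF fin, symmetric]) (use gG IK in blast)
          finally show ?thesis .
        qed
        have sL: "(\<lambda>x. \<Sum>k\<in>I. c k * w k x) \<in> L2 \<Omega>" for c
          using ae_sum_L2[OF fin, of w \<Omega> c] wL IK by auto
        have sG: "(\<Sum>k\<in>I. c k *\<^sub>R e_grad (w k)) \<in> grads" for c
          using gG IK by (intro subspace_sum subspace_scale grads_space) auto
        have "\<forall>k\<in>I. c k = 0" if 0: "(\<Sum>k\<in>I. c k *\<^sub>R e_grad (w k)) = 0" for c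
        proof -
          have "emb \<Omega> (\<lambda>x. \<Sum>k\<in>I. c k * w k x) = emb \<Omega> (\<lambda>x. 0)"
            unfolding embs 0 emb_zero using potential_scaleR[OF subspace_0[OF grads_space(1)], of 0] by simp
          then have "AE x in lebesgue_on \<Omega>. (\<Sum>k\<in>I. c k * w k x) = 0"
            unfolding emb_eq_iff[OF domain_sets sL L2_zero] .
          then show ?thesis using b unfolding ae_basis_def by blast
        qed
        moreover have "x \<in> span ((\<lambda>k. e_grad (w k)) ` I)" if x: "x \<in> eigvec A Z \<mu>" for x
        proof -
          have xG: "x \<in> grads" using x Z(4) by (auto simp: eigvec_def)
          note r = H10_rep_potential[OF xG]
          have vL: "rep_l2 (potential x) \<in> L2 \<Omega>" by (rule H10_L2[OF r(1)])
          have "rep_l2 (potential x) \<in> eigenspace \<Omega> T (1 / \<kappa>)"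
            unfolding eig[OF \<kappa>(1) vL] \<kappa>(2) using x r(3) by blast
          then obtain c where "AE y in lebesgue_on \<Omega>. rep_l2 (potential x) y = (\<Sum>k\<in>I. c k * w k y)"
            using b unfolding ae_basis_def by blast
          then have "potential x = potential (\<Sum>k\<in>I. c k *\<^sub>R e_grad (w k))"
            using emb_eq_iff[OF domain_sets vL sL] embs r(3) by simp
          from potential_inj[OF xG sG this] show ?thesis
            using sum_in_span_image[of c "\<lambda>k. e_grad (w k)" I] by simp
        qed
        ultimately show ?thesis using fin by blast
      qed
      then show "finite {k \<in> K. \<nu> (l k) = \<mu>} \<and>
        eigvec A Z \<mu> \<subseteq> span ((\<lambda>k. e_grad (w k)) ` {k \<in> K. \<nu> (l k) = \<mu>}) \<and>
        (\<forall>c. (\<Sum>k | k \<in> K \<and> \<nu> (l k) = \<mu>. c k *\<^sub>R e_grad (w k)) = 0 \<longrightarrow> (\<forall>k\<in>K. \<nu> (l k) = \<mu> \<longrightarrow> c k = 0))"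
        by (simp add: I_def)
    qed
  qed (use Z in auto)
qed

end

section \<open>Approximation rates, regularity and the error quantity\<close>

lemma powr_tendsto_0_at_right: "0 < s \<Longrightarrow> ((\<lambda>h :: real. h powr s) \<longlongrightarrow> 0) (at_right 0)"
  by (rule tendsto_zero_powrI[where b = s])
    (auto simp: eventually_at_right_field intro!: exI[of _ 1] tendsto_intros)

context bounded_domain
begin

lemma H10_diff:
  assumes "u \<in> H10 \<Omega>" "v \<in> H10 \<Omega>"
  shows "(\<lambda>x. u x - v x) \<in> H10 \<Omega>" "e_grad (\<lambda>x. u x - v x) = e_grad u - e_grad v"
  using H10_comb[OF assms(2,1), of "-1"] by simp_all

lemma Hdiv_diff:
  assumes "\<rho> \<in> Hdiv \<Omega>" "\<tau> \<in> Hdiv \<Omega>"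
  shows "(\<lambda>x. \<rho> x - \<tau> x) \<in> Hdiv \<Omega>" "e_div (\<lambda>x. \<rho> x - \<tau> x) = e_div \<rho> - e_div \<tau>"
  using Hdiv_comb[OF assms(2,1), of "-1"] by simp_all

lemma H1_norm_e_grad:
  assumes "u \<in> H10 \<Omega>" shows "H1_norm \<Omega> u = norm (emb \<Omega> u, e_grad u)"
  unfolding H1_norm_def norm_Pair emb_norm[OF domain_sets H10_L2[OF assms]] emb_norm[OF domain_sets wgrad_L2[OF assms]] ..

lemma Hdiv_norm_e_div:
  assumes "\<tau> \<in> Hdiv \<Omega>" shows "Hdiv_norm \<Omega> \<tau> = norm (e_div \<tau>)"
  unfolding Hdiv_norm_def norm_Pair emb_norm[OF domain_sets Hdiv_L2[OF assms]] emb_norm[OF domain_sets wdiv_L2[OF assms]] ..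

lemma H1_dist_ge:
  assumes "p \<in> H10 \<Omega>" "U \<subseteq> H10 \<Omega>" "v \<in> U"
  shows "infdist (e_grad p) ((\<lambda>u. e_grad u) ` U) \<le> H1_norm \<Omega> (\<lambda>x. p x - v x)"
proof -
  have v: "v \<in> H10 \<Omega>" using assms by blast
  have "infdist (e_grad p) ((\<lambda>u. e_grad u) ` U) \<le> dist (e_grad p) (e_grad v)"
    using assms(3) by (intro infdist_le imageI)
  also have "\<dots> = norm (e_grad (\<lambda>x. p x - v x))" by (simp only: H10_diff(2)[OF assms(1) v] dist_norm)
  also have "\<dots> \<le> norm (emb \<Omega> (\<lambda>x. p x - v x), e_grad (\<lambda>x. p x - v x))"
    by (simp only: norm_snd_le)
  also have "\<dots> = H1_norm \<Omega> (\<lambda>x. p x - v x)"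
    by (rule H1_norm_e_grad[OF H10_diff(1)[OF assms(1) v], symmetric])
  finally show ?thesis .
qed

lemma Hdiv_dist_ge:
  assumes "\<rho> \<in> Hdiv \<Omega>" "S \<subseteq> Hdiv \<Omega>" "\<tau> \<in> S"
  shows "infdist (e_div \<rho>) ((\<lambda>\<tau>. e_div \<tau>) ` S) \<le> Hdiv_norm \<Omega> (\<lambda>x. \<rho> x - \<tau> x)"
proof -
  have t: "\<tau> \<in> Hdiv \<Omega>" using assms by blast
  have "infdist (e_div \<rho>) ((\<lambda>\<tau>. e_div \<tau>) ` S) \<le> dist (e_div \<rho>) (e_div \<tau>)"
    using assms(3) by (intro infdist_le imageI)
  also have "\<dots> = norm (e_div (\<lambda>x. \<rho> x - \<tau> x))" by (simp only: Hdiv_diff(2)[OF assms(1) t] dist_norm)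
  also have "\<dots> = Hdiv_norm \<Omega> (\<lambda>x. \<rho> x - \<tau> x)"
    by (rule Hdiv_norm_e_div[OF Hdiv_diff(1)[OF assms(1) t], symmetric])
  finally show ?thesis .
qed

text \<open>The factor c contains the \<open>H1s_norm\<close> of the Poisson solution and hence
  depends on F; this is the pointwise rate handed to the Baire argument.\<close>

lemma infdist_grad_le:
  assumes reg: "\<forall>f\<in>L2 \<Omega>. \<forall>w. poisson_sol \<Omega> f w \<longrightarrow> w \<in> H1s \<Omega> s"
    and U: "\<forall>h>0. fin_dim_subspace \<Omega> (U h) (H10 \<Omega>)"
    and approx: "\<And>h p. 0 < h \<Longrightarrow> p \<in> H1s \<Omega> s \<inter> H10 \<Omega> \<Longrightarrow>
        (INF v \<in> U h. H1_norm \<Omega> (\<lambda>x. p x - v x)) \<le> C * h powr s * H1s_norm \<Omega> s p"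
  shows "\<exists>c. \<forall>h>0. infdist (grad_sol F) ((\<lambda>u. e_grad u) ` U h) \<le> c * h powr s"
proof -
  define p where "p = rep_l2 (potential (grad_sol F))"
  note r = H10_rep_potential[OF grad_sol_in[of F], folded p_def]
  have fL: "rep_l2 F \<in> L2 \<Omega>" by (rule rep_l2_L2[OF domain_sets])
  \<comment> \<open>F may be nonzero outside \<Omega>, but it is only paired with potentials, which
    vanish there.\<close>
  have "grad_sol (emb \<Omega> (rep_l2 F)) = grad_sol F"
  proof (rule grad_sol_eqI[OF grad_sol_in])
    fix y assume y: "y \<in> grads"
    note ry = H10_rep_potential[OF y]
    have "grad_sol F \<bullet> y = emb \<Omega> (rep_l2 (potential y)) \<bullet> F"
      unfolding ry(3) grad_sol_inner[OF y] by (rule inner_commute)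
    also have "\<dots> = L2_inner \<Omega> (rep_l2 (potential y)) (rep_l2 F)"
      by (rule emb_rep_inner[OF domain_sets H10_L2[OF ry(1)]])
    also have "\<dots> = emb \<Omega> (rep_l2 F) \<bullet> potential y"
      using emb_inner[OF domain_sets fL H10_L2[OF ry(1)]] ry(3) by (simp add: L2_inner_commute)
    finally show "grad_sol F \<bullet> y = emb \<Omega> (rep_l2 F) \<bullet> potential y" .
  qed
  then have "poisson_sol \<Omega> (rep_l2 F) p" by (intro poisson_solI fL r(1)) (simp add: r(2))
  then have p: "p \<in> H1s \<Omega> s \<inter> H10 \<Omega>" using reg fL r(1) by blast
  have "infdist (grad_sol F) ((\<lambda>u. e_grad u) ` U h) \<le> C * H1s_norm \<Omega> s p * h powr s" if h: "0 < h" for h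
  proof -
    note fd = fin_dim_H10[OF U[rule_format, OF h]]
    have "infdist (grad_sol F) ((\<lambda>u. e_grad u) ` U h) \<le> (INF v \<in> U h. H1_norm \<Omega> (\<lambda>x. p x - v x))"
      using fd(2) H1_dist_ge[OF r(1) fd(1)] by (intro cINF_greatest) (auto simp: r(2))
    also have "\<dots> \<le> C * h powr s * H1s_norm \<Omega> s p" by (rule approx[OF h p])
    finally show ?thesis by (simp add: mult_ac)
  qed
  then show ?thesis by blast
qed

lemma compact_potential:
  assumes s: "0 < s" and reg: "\<forall>f\<in>L2 \<Omega>. \<forall>w. poisson_sol \<Omega> f w \<longrightarrow> w \<in> H1s \<Omega> s"
    and U: "\<forall>h>0. fin_dim_subspace \<Omega> (U h) (H10 \<Omega>)"
    and approx: "\<And>h p. 0 < h \<Longrightarrow> p \<in> H1s \<Omega> s \<inter> H10 \<Omega> \<Longrightarrow>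
        (INF v \<in> U h. H1_norm \<Omega> (\<lambda>x. p x - v x)) \<le> C * h powr s * H1s_norm \<Omega> s p"
  shows "compact_on grads potential"
proof -
  obtain K where K: "0 < K" "\<And>x. x \<in> grads \<Longrightarrow> norm (potential x) \<le> K * norm x"
    using potential_bound by blast
  define h where "h = (\<lambda>n. inverse (real (Suc n)))"
  have h0: "0 < h n" for n by (simp add: h_def)
  have "filterlim h (at_right 0) sequentially"
    unfolding filterlim_at using LIMSEQ_inverse_real_of_nat by (auto simp: h_def)
  then have r: "(\<lambda>n. h n powr s) \<longlonglongrightarrow> 0" by (rule filterlim_compose[OF powr_tendsto_0_at_right[OF s]])
  show ?thesis
  proof (rule compact_on_of_adjoint_approximation[OF grads_space potential_add potential_scaleR K grad_sol_in grad_sol_inner _ _ r])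
    show "\<exists>B. finite B \<and> (\<lambda>u. e_grad u) ` U (h n) = span B" for n
      by (rule fin_dim_H10(3)[OF U[rule_format, OF h0]])
    show "\<exists>c. \<forall>n. infdist (grad_sol f) ((\<lambda>u. e_grad u) ` U (h n)) \<le> c * h n powr s" for f
      using infdist_grad_le[OF reg U approx, of f] h0 by meson
  qed simp_all
qed

text \<open>\<open>wdiv \<Omega> (wgrad \<Omega> v)\<close> is only a.e. equal to \<open>- ev * v\<close>; that it lies in \<open>H1s\<close> is seen from
  its being a Poisson solution itself.\<close>
lemma eigenfunction_regularity:
  assumes reg: "\<forall>f\<in>L2 \<Omega>. \<forall>w. poisson_sol \<Omega> f w \<longrightarrow> w \<in> H1s \<Omega> s"
    and ev: "0 < ev" and x: "x \<in> eigvec potential grads (1 / ev)"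
    and v: "v \<in> H10 \<Omega>" "e_grad v = x"
  shows "v \<in> H1s \<Omega> s" "wgrad \<Omega> v \<in> Hs_vec \<Omega> s \<inter> Hdiv \<Omega>" "wdiv \<Omega> (wgrad \<Omega> v) \<in> H1s \<Omega> s"
    "e_div (wgrad \<Omega> v) = (x, - ev *\<^sub>R potential x)"
proof -
  have xG: "x \<in> grads" using x by (simp add: eigvec_def)
  have vL: "v \<in> L2 \<Omega>" by (rule H10_L2[OF v(1)])
  have ve: "emb \<Omega> v = potential x" using potential_e_grad[OF v(1)] v(2) by simp
  have gs: "grad_sol ((c * ev) *\<^sub>R potential x) = c *\<^sub>R x" for c
    using x ev by (intro grad_sol_eqI) (auto simp: eigvec_def subspace_scale grads_space)
  have fL: "(\<lambda>y. ev *\<^sub>R v y) \<in> L2 \<Omega>" by (rule L2_scaleR[OF vL])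
  have fe: "emb \<Omega> (\<lambda>y. ev *\<^sub>R v y) = ev *\<^sub>R potential x"
    using emb_scaleR[OF domain_sets vL, of ev] unfolding ve .
  have gv: "e_grad v = grad_sol (emb \<Omega> (\<lambda>y. ev *\<^sub>R v y))" unfolding fe using gs[of 1] v(2) by simp
  show H: "v \<in> H1s \<Omega> s" using reg poisson_solI[OF fL v(1) gv] fL by blast
  note d = wdiv_wgrad[OF fL v(1) gv]
  show e: "e_div (wgrad \<Omega> v) = (x, - ev *\<^sub>R potential x)" using d(2) fe v(2) by simp
  show "wgrad \<Omega> v \<in> Hs_vec \<Omega> s \<inter> Hdiv \<Omega>" using H d(1) by (simp add: H1s_def)
  define q where "q = wdiv \<Omega> (wgrad \<Omega> v)"
  have qL: "q \<in> L2 \<Omega>" unfolding q_def by (rule wdiv_L2[OF d(1)])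
  have "emb \<Omega> q = snd (e_div (wgrad \<Omega> v))" by (simp only: q_def snd_conv)
  also have "\<dots> = - ev *\<^sub>R potential x" unfolding e by (simp only: snd_conv)
  also have "\<dots> = potential ((- ev) *\<^sub>R x)" by (rule potential_scaleR[OF xG, symmetric])
  finally have "emb \<Omega> q = potential ((- ev) *\<^sub>R x)" .
  from H10_of_potential[OF qL subspace_scale[OF grads_space(1) xG] this]
  have q: "q \<in> H10 \<Omega>" "e_grad q = (- ev) *\<^sub>R x" by auto
  have f2L: "(\<lambda>y. (- ev * ev) *\<^sub>R v y) \<in> L2 \<Omega>" by (rule L2_scaleR[OF vL])
  have f2e: "emb \<Omega> (\<lambda>y. (- ev * ev) *\<^sub>R v y) = (- ev * ev) *\<^sub>R potential x"
    using emb_scaleR[OF domain_sets vL, of "- ev * ev"] unfolding ve .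
  have "e_grad q = grad_sol (emb \<Omega> (\<lambda>y. (- ev * ev) *\<^sub>R v y))" unfolding f2e gs q(2) ..
  from poisson_solI[OF f2L q(1) this] show "wdiv \<Omega> (wgrad \<Omega> v) \<in> H1s \<Omega> s"
    using reg f2L unfolding q_def by blast
qed

text \<open>Each distance is below the infimum over pairs, as the other norm is nonnegative and the
  H1 norm dominates the gradient. A real-valued \<open>SUP\<close> dominates its members only when
  it is bounded above, which \<open>qle\<close> provides.\<close>

lemma approx_err_ge:
  assumes S: "fin_dim_subspace \<Omega> S (Hdiv \<Omega>)" and U: "fin_dim_subspace \<Omega> U (H10 \<Omega>)"
    and ev: "0 < ev"
    and E: "\<And>v. v \<in> E \<Longrightarrow> v \<in> H10 \<Omega> \<and> e_grad v \<in> eigvec potential grads (1 / ev) \<and> wgrad \<Omega> v \<in> Hdiv \<Omega> \<and>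
      e_div (wgrad \<Omega> v) = (e_grad v, - ev *\<^sub>R potential (e_grad v))"
    and v: "v \<in> E" "L2_norm \<Omega> v = 1"
  shows "infdist (e_grad v) ((\<lambda>u. e_grad u) ` U) \<le> approx_err \<Omega> S U E"
    "infdist (e_div (wgrad \<Omega> v)) ((\<lambda>\<tau>. e_div \<tau>) ` S) \<le> approx_err \<Omega> S U E"
proof -
  note fS = fin_dim_Hdiv[OF S] and fU = fin_dim_H10[OF U]
  define q where "q u = (INF (\<tau>, v) \<in> S \<times> U. Hdiv_norm \<Omega> (\<lambda>x. wgrad \<Omega> u x - \<tau> x) + H1_norm \<Omega> (\<lambda>x. u x - v x))" for u
  have nn: "0 \<le> Hdiv_norm \<Omega> \<tau>" "0 \<le> H1_norm \<Omega> p" for \<tau> p by (auto simp: Hdiv_norm_def H1_norm_def)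
  have bb: "bdd_below ((\<lambda>(\<tau>, v). Hdiv_norm \<Omega> (\<lambda>x. wgrad \<Omega> u x - \<tau> x) + H1_norm \<Omega> (\<lambda>x. u x - v x)) ` (S \<times> U))" for u
    by (rule bdd_belowI2[where m = 0]) (auto intro!: add_nonneg_nonneg nn)
  \<comment> \<open>The value at the pair of zero functions, using that the squared gradient norm of
    a normalised eigenfunction is ev.\<close>
  have qle: "q u \<le> sqrt (ev + ev\<^sup>2) + sqrt (1 + ev)" if u: "u \<in> E" "L2_norm \<Omega> u = 1" for u
  proof -
    note Eu = E[OF u(1)]
    have n1: "norm (potential (e_grad u)) = 1"
      using potential_e_grad u Eu emb_norm[OF domain_sets H10_L2] by simp
    have n2: "(norm (e_grad u))\<^sup>2 = ev"
    proof -
      have "potential (e_grad u) \<bullet> potential (e_grad u) = 1 / ev * (e_grad u \<bullet> e_grad u)"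
        using Eu by (auto simp: eigvec_def)
      then show ?thesis using n1 ev by (simp add: power2_norm_eq_inner[symmetric])
    qed
    have "q u \<le> Hdiv_norm \<Omega> (\<lambda>x. wgrad \<Omega> u x - 0) + H1_norm \<Omega> (\<lambda>x. u x - 0)"
      unfolding q_def using fS(2) fU(2) by (intro cINF_lower2[OF bb, of "(\<lambda>x. 0, \<lambda>x. 0)"]) auto
    also have "\<dots> = norm (e_div (wgrad \<Omega> u)) + norm (emb \<Omega> u, e_grad u)"
      using Hdiv_norm_e_div[of "wgrad \<Omega> u"] H1_norm_e_grad[of u] Eu by simp
    also have "emb \<Omega> u = potential (e_grad u)" using potential_e_grad Eu by simp
    also have "e_div (wgrad \<Omega> u) = (e_grad u, - ev *\<^sub>R potential (e_grad u))" using Eu by blast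
    finally show ?thesis by (simp add: norm_Pair n1 n2)
  qed
  have "q v \<le> approx_err \<Omega> S U E"
    unfolding approx_err_def q_def[symmetric]
    using v qle by (intro cSUP_upper bdd_aboveI2) auto
  moreover have "infdist (e_grad v) ((\<lambda>u. e_grad u) ` U) \<le> q v"
    unfolding q_def
  proof (rule cINF_greatest)
    show "S \<times> U \<noteq> {}" using fS(2) fU(2) by blast
    fix p assume "p \<in> S \<times> U"
    then obtain \<tau> y where p: "p = (\<tau>, y)" "\<tau> \<in> S" "y \<in> U" by blast
    have "v \<in> H10 \<Omega>" using E[OF v(1)] by blast
    from H1_dist_ge[OF this fU(1) p(3)] nn(1)
    have "infdist (e_grad v) ((\<lambda>u. e_grad u) ` U) \<le> Hdiv_norm \<Omega> (\<lambda>x. wgrad \<Omega> v x - \<tau> x) + H1_norm \<Omega> (\<lambda>x. v x - y x)"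
      by (intro add_increasing)
    then show "infdist (e_grad v) ((\<lambda>u. e_grad u) ` U) \<le>
      (case p of (\<tau>, y) \<Rightarrow> Hdiv_norm \<Omega> (\<lambda>x. wgrad \<Omega> v x - \<tau> x) + H1_norm \<Omega> (\<lambda>x. v x - y x))"
      unfolding p(1) prod.case .
  qed
  moreover have "infdist (e_div (wgrad \<Omega> v)) ((\<lambda>\<tau>. e_div \<tau>) ` S) \<le> q v"
    unfolding q_def
  proof (rule cINF_greatest)
    show "S \<times> U \<noteq> {}" using fS(2) fU(2) by blast
    fix p assume "p \<in> S \<times> U"
    then obtain \<tau> y where p: "p = (\<tau>, y)" "\<tau> \<in> S" "y \<in> U" by blast
    have "wgrad \<Omega> v \<in> Hdiv \<Omega>" using E[OF v(1)] by blast
    from Hdiv_dist_ge[OF this fS(1) p(2)] nn(2)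
    have "infdist (e_div (wgrad \<Omega> v)) ((\<lambda>\<tau>. e_div \<tau>) ` S)
        \<le> Hdiv_norm \<Omega> (\<lambda>x. wgrad \<Omega> v x - \<tau> x) + H1_norm \<Omega> (\<lambda>x. v x - y x)"
      by (intro add_increasing2)
    then show "infdist (e_div (wgrad \<Omega> v)) ((\<lambda>\<tau>. e_div \<tau>) ` S) \<le>
      (case p of (\<tau>, y) \<Rightarrow> Hdiv_norm \<Omega> (\<lambda>x. wgrad \<Omega> v x - \<tau> x) + H1_norm \<Omega> (\<lambda>x. v x - y x))"
      unfolding p(1) prod.case .
  qed
  ultimately show "infdist (e_grad v) ((\<lambda>u. e_grad u) ` U) \<le> approx_err \<Omega> S U E"
    "infdist (e_div (wgrad \<Omega> v)) ((\<lambda>\<tau>. e_div \<tau>) ` S) \<le> approx_err \<Omega> S U E" by linarith+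
qed

end

section \<open>The estimate for the least squares finite element method\<close>

theorem theorem13:
  fixes \<Omega> :: "(real^'d) set"
    and s :: real
    and S :: "real \<Rightarrow> (real^'d \<Rightarrow> real^'d) set"
    and U :: "real \<Rightarrow> (real^'d \<Rightarrow> real) set"
    and lam :: "nat \<Rightarrow> real"
    and u :: "nat \<Rightarrow> real^'d \<Rightarrow> real"
    and N :: "real \<Rightarrow> nat"
    and lamh :: "real \<Rightarrow> nat \<Rightarrow> real"
    and ev :: real
    and i m :: nat
  assumes dim: "CARD('d) = 2 \<or> CARD('d) = 3"
    and dom: "lipschitz_polyhedron \<Omega>"
    and s: "1/2 < s" "s \<le> 1"
    and regularity: "\<forall>f\<in>L2 \<Omega>. \<forall>w. poisson_sol \<Omega> f w \<longrightarrow> w \<in> H1s \<Omega> s"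
    and S: "\<forall>h>0. fin_dim_subspace \<Omega> (S h) (Hdiv \<Omega>)"
    and U: "\<forall>h>0. fin_dim_subspace \<Omega> (U h) (H10 \<Omega>)"
    and approx_S: "\<exists>C. \<forall>h>0. \<forall>\<rho> \<in> Hs_vec \<Omega> s \<inter> Hdiv \<Omega>. wdiv \<Omega> \<rho> \<in> H1s \<Omega> s \<longrightarrow>
        (INF \<tau> \<in> S h. Hdiv_norm \<Omega> (\<lambda>x. \<rho> x - \<tau> x))
          \<le> C * h powr s * (Hs_vec_norm \<Omega> s \<rho> + H1s_norm \<Omega> s (wdiv \<Omega> \<rho>))"
    and approx_U: "\<exists>C. \<forall>h>0. \<forall>p \<in> H1s \<Omega> s \<inter> H10 \<Omega>.
        (INF v \<in> U h. H1_norm \<Omega> (\<lambda>x. p x - v x)) \<le> C * h powr s * H1s_norm \<Omega> s p"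
    and eigenvalues: "eigen_enum \<Omega> (T_F1 \<Omega>) {1..} lam u"
    and normalized: "\<forall>k\<ge>1. L2_norm \<Omega> (u k) = 1"
    and discrete_eigenvalues:
      "\<forall>h>0. \<exists>w. eigen_enum \<Omega> (galerkin_op \<Omega> (S h) (U h)) {1..N h} (lamh h) w"
    and multiplicity: "1 \<le> i" "1 \<le> m" "{k. 1 \<le> k \<and> lam k = ev} = {i..<i + m}"
  shows "\<exists>C. \<exists>h0>0. \<forall>h. 0 < h \<and> h < h0 \<longrightarrow>
           (\<forall>j\<in>{i..<i + m}. j \<le> N h \<and>
              \<bar>ev - lamh h j\<bar> \<le> C * (approx_err \<Omega> (S h) (U h) (fun_span {i..<i + m} u))\<^sup>2)"
proof -
  interpret bounded_domain \<Omega>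
    using dom by unfold_locales (auto simp: lipschitz_polyhedron_def)
  have s0: "0 < s" using s by simp
  obtain CS where CS: "\<And>h \<rho>. 0 < h \<Longrightarrow> \<rho> \<in> Hs_vec \<Omega> s \<inter> Hdiv \<Omega> \<Longrightarrow> wdiv \<Omega> \<rho> \<in> H1s \<Omega> s \<Longrightarrow>
      (INF \<tau> \<in> S h. Hdiv_norm \<Omega> (\<lambda>x. \<rho> x - \<tau> x))
        \<le> CS * h powr s * (Hs_vec_norm \<Omega> s \<rho> + H1s_norm \<Omega> s (wdiv \<Omega> \<rho>))"
    using approx_S by blast
  obtain CU where CU: "\<And>h p. 0 < h \<Longrightarrow> p \<in> H1s \<Omega> s \<inter> H10 \<Omega> \<Longrightarrow>
      (INF v \<in> U h. H1_norm \<Omega> (\<lambda>x. p x - v x)) \<le> CU * h powr s * H1s_norm \<Omega> s p"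
    using approx_U by blast
  have S': "fin_dim_subspace \<Omega> (S h) (Hdiv \<Omega>)" and U': "fin_dim_subspace \<Omega> (U h) (H10 \<Omega>)" if "0 < h" for h
    using S U that by auto
  have cP: "compact_on grads potential" by (rule compact_potential[OF s0 regularity U CU])
  define Sh where "Sh h = (\<lambda>\<tau>. e_div \<tau>) ` S h" for h
  define Uh where "Uh h = (\<lambda>v. e_grad v) ` U h" for h
  define g where "g k = e_grad (u k)" for k
  have disc: "ls_discretization grads potential (Sh h) (Uh h)" if "0 < h" for h
    unfolding Sh_def Uh_def using S U that by (intro ls_discretizationI cP) auto
  note cont_transfer = eigen_system_transfer[OF eigenvalues grads_space cP subset_refl, of "\<lambda>l. 1 / l"]
  have surj: "(\<exists>l>0. 1 / l = \<mu>) \<or> eigvec potential grads \<mu> \<subseteq> {0}" if "0 < \<mu>" for \<mu> :: real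
    using that by (intro disjI1 exI[of _ "1 / \<mu>"]) auto
  have cont: "eigen_system potential grads {1..} (\<lambda>k. 1 / lam k) g"
    unfolding g_def
    by (rule cont_transfer(1)[OF _ _ _ _ surj]) (auto simp: continuous_eigenspace intro: divide_left_mono)
  have uH: "u k \<in> H10 \<Omega>" if "1 \<le> k" for k
    by (rule cont_transfer(2)[OF _ _ _ _ surj])
      (use that in \<open>auto simp: continuous_eigenspace intro: divide_left_mono\<close>)
  have "\<exists>w. eigen_system (flux (Sh h)) (Uh h) {1..N h} (\<lambda>k. 1 / (1 + lamh h k)) w" if h: "0 < h" for h
  proof -
    interpret ls_discretization grads potential "Sh h" "Uh h" by (rule disc[OF h])
    obtain w where w: "eigen_enum \<Omega> (galerkin_op \<Omega> (S h) (U h)) {1..N h} (lamh h) w"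
      using discrete_eigenvalues h by blast
    have "eigen_system (flux (Sh h)) (Uh h) {1..N h} (\<lambda>k. 1 / (1 + lamh h k)) (\<lambda>k. e_grad (w k))"
    proof (rule eigen_system_transfer(1)[OF w U_space compact_on_flux U(2), of "\<lambda>l. 1 / (1 + l)"])
      fix l :: real and v :: "real^'d \<Rightarrow> real" assume l: "0 < l" and v: "v \<in> L2 \<Omega>"
      have "1 / l / (1 + 1 / l) = 1 / (1 + l)" using l by (simp add: field_simps)
      then show "v \<in> eigenspace \<Omega> (galerkin_op \<Omega> (S h) (U h)) (1 / l) \<longleftrightarrow>
          (\<exists>g\<in>eigvec (flux (Sh h)) (Uh h) (1 / (1 + l)). emb \<Omega> v = potential g)"
        using discrete_eigenspace[OF cP S'[OF h] U'[OF h] v, of "1 / l"] l by (simp add: Sh_def Uh_def)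
    next
      fix \<mu> :: real assume \<mu>: "0 < \<mu>"
      show "(\<exists>l>0. 1 / (1 + l) = \<mu>) \<or> eigvec (flux (Sh h)) (Uh h) \<mu> \<subseteq> {0}"
      proof (cases "\<mu> < 1")
        case True
        \<comment> \<open>The witness inverts l to 1 / (1 + l); it is positive exactly because \<mu>
          is below 1.\<close>
        then show ?thesis using \<mu> by (intro disjI1 exI[of _ "1 / \<mu> - 1"]) auto
      next
        case False
        then show ?thesis using flux_eigenvalue_less_one by blast
      qed
    qed (auto intro: divide_left_mono)
    then show ?thesis by blast
  qed
  then obtain w where w: "\<And>h. 0 < h \<Longrightarrow>
      eigen_system (flux (Sh h)) (Uh h) {1..N h} (\<lambda>k. 1 / (1 + lamh h k)) (w h)"
    by metis
  have powr0: "((\<lambda>h. c * h powr s) \<longlongrightarrow> 0) (at_right 0)" for c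
    using tendsto_mult[OF tendsto_const powr_tendsto_0_at_right[OF s0], of c] by simp
  have conv: "((\<lambda>h. infdist x (Uh h)) \<longlongrightarrow> 0) (at_right 0) \<and>
      ((\<lambda>h. infdist (x, - l *\<^sub>R potential x) (Sh h)) \<longlongrightarrow> 0) (at_right 0)"
    if l: "0 < l" and x: "x \<in> eigvec potential grads (1 / l)" for l x
  proof -
    have xG: "x \<in> grads" using x by (simp add: eigvec_def)
    define v where "v = rep_l2 (potential x)"
    note r = H10_rep_potential[OF xG, folded v_def]
    note reg = eigenfunction_regularity[OF regularity l x r(1,2)]
    have b1: "infdist x (Uh h) \<le> CU * H1s_norm \<Omega> s v * h powr s" if h: "0 < h" for h
    proof -
      note fd = fin_dim_H10[OF U'[OF h]]
      have "infdist x (Uh h) \<le> (INF y \<in> U h. H1_norm \<Omega> (\<lambda>z. v z - y z))"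
        unfolding Uh_def using fd(2) H1_dist_ge[OF r(1) fd(1)] by (intro cINF_greatest) (auto simp: r(2))
      also have "\<dots> \<le> CU * h powr s * H1s_norm \<Omega> s v" using reg(1) r(1) by (intro CU h) blast
      finally show ?thesis by (simp add: mult_ac)
    qed
    have b2: "infdist (x, - l *\<^sub>R potential x) (Sh h)
        \<le> CS * (Hs_vec_norm \<Omega> s (wgrad \<Omega> v) + H1s_norm \<Omega> s (wdiv \<Omega> (wgrad \<Omega> v))) * h powr s" if h: "0 < h" for h
    proof -
      note fd = fin_dim_Hdiv[OF S'[OF h]]
      have "wgrad \<Omega> v \<in> Hdiv \<Omega>" using reg(2) by blast
      from Hdiv_dist_ge[OF this fd(1)]
      have "infdist (x, - l *\<^sub>R potential x) (Sh h) \<le> (INF \<tau> \<in> S h. Hdiv_norm \<Omega> (\<lambda>z. wgrad \<Omega> v z - \<tau> z))"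
        unfolding Sh_def reg(4) using fd(2) by (intro cINF_greatest) auto
      also have "\<dots> \<le> CS * h powr s * (Hs_vec_norm \<Omega> s (wgrad \<Omega> v) + H1s_norm \<Omega> s (wdiv \<Omega> (wgrad \<Omega> v)))"
        by (rule CS[OF h reg(2,3)])
      finally show ?thesis by (simp add: mult_ac)
    qed
    have pos: "eventually (\<lambda>h. 0 < h) (at_right (0::real))" by (rule eventually_at_right_less)
    have "((\<lambda>h. infdist x (Uh h)) \<longlongrightarrow> 0) (at_right 0)"
    proof (rule Lim_null_comparison[OF _ powr0])
      show "\<forall>\<^sub>F h in at_right 0. norm (infdist x (Uh h)) \<le> (CU * H1s_norm \<Omega> s v) * h powr s"
        using pos by eventually_elim (simp add: infdist_nonneg b1)
    qed
    moreover have "((\<lambda>h. infdist (x, - l *\<^sub>R potential x) (Sh h)) \<longlongrightarrow> 0) (at_right 0)"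
    proof (rule Lim_null_comparison[OF _ powr0])
      show "\<forall>\<^sub>F h in at_right 0. norm (infdist (x, - l *\<^sub>R potential x) (Sh h))
          \<le> (CS * (Hs_vec_norm \<Omega> s (wgrad \<Omega> v) + H1s_norm \<Omega> s (wdiv \<Omega> (wgrad \<Omega> v)))) * h powr s"
        using pos
      proof eventually_elim
        case (elim h)
        then show ?case using b2[OF elim] by (simp only: real_norm_def abs_of_nonneg[OF infdist_nonneg])
      qed
    qed
    ultimately show ?thesis by blast
  qed
  interpret ls_eigenproblem_family grads potential Sh Uh lam g N lamh w
  proof (rule ls_eigenproblem_family.intro)
    show "ls_eigenproblem grads potential (Sh h) (Uh h) lam g (N h) (lamh h) (w h)" if "0 < h" for h
      by (intro ls_eigenproblem.intro ls_eigenproblem_axioms.intro disc[OF that] cont w[OF that])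
  qed (use conv in blast)+
  define E where "E = fun_span {i..<i + m} u"
  have "i \<in> {i..<i + m}" using multiplicity(2) by simp
  then have i: "1 \<le> i" "lam i = ev" unfolding multiplicity(3)[symmetric] by auto
  have ev: "0 < ev" using lam_pos[OF i(1)] i(2) by simp
  have ge: "g k \<in> eigvec potential grads (1 / ev)" if "k \<in> {i..<i + m}" for k
  proof -
    have "1 \<le> k \<and> lam k = ev" using that multiplicity(3) by blast
    then show ?thesis using eigen_system_in[OF cont, of k] eigen_system_eq[OF cont, of k] by (auto simp: eigvec_def)
  qed
  obtain C where C: "eventually (\<lambda>h. \<forall>j\<in>{i..<i + m}. j \<le> N h \<and>
      (\<forall>e. err_bound ev h e \<longrightarrow> \<bar>ev - lamh h j\<bar> \<le> C * e\<^sup>2)) (at_right 0)"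
    using eigenvalue_estimate[OF multiplicity(3,1,2)] by blast
  then obtain h0 where h0: "0 < h0" "\<And>h j e. 0 < h \<Longrightarrow> h < h0 \<Longrightarrow> j \<in> {i..<i + m} \<Longrightarrow>
      j \<le> N h \<and> (err_bound ev h e \<longrightarrow> \<bar>ev - lamh h j\<bar> \<le> C * e\<^sup>2)"
    unfolding eventually_at_right_field by blast
  \<comment> \<open>E contains only literal combinations of the u k and is not closed under a.e.
    equality, so the member of E must be built from coefficients of x.\<close>
  have L_E: "\<exists>v\<in>E. e_grad v = x" if "x \<in> eigvec potential grads (1 / ev)" for x
  proof -
    have "{k \<in> {1..}. 1 / lam k = 1 / ev} = {i..<i + m}" using multiplicity(3) by auto
    then have "x \<in> span (g ` {i..<i + m})" using eigen_system_span[OF cont, of "1 / ev"] ev that by auto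
    then obtain c where c: "x = (\<Sum>k\<in>{i..<i + m}. c k *\<^sub>R g k)" using span_image_coeffs by blast
    have gG: "g k \<in> grads" if "k \<in> {i..<i + m}" for k using ge[OF that] by (simp add: eigvec_def)
    have uk: "u k \<in> H10 \<Omega>" if "k \<in> {i..<i + m}" for k using uH[of k] that i(1) by auto
    have xG: "x \<in> grads" unfolding c by (intro subspace_sum subspace_scale grads_space gG)
    have "emb \<Omega> (\<lambda>y. \<Sum>k\<in>{i..<i + m}. c k *\<^sub>R u k y) = (\<Sum>k\<in>{i..<i + m}. c k *\<^sub>R emb \<Omega> (u k))"
      by (rule emb_sum[OF finite_atLeastLessThan H10_L2[OF uk]])
    also have "\<dots> = (\<Sum>k\<in>{i..<i + m}. c k *\<^sub>R potential (g k))"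
      by (intro sum.cong refl) (simp add: g_def potential_e_grad uk)
    also have "\<dots> = potential x" unfolding c by (rule potential_sum[OF finite_atLeastLessThan gG, symmetric])
    finally have e: "emb \<Omega> (\<lambda>y. \<Sum>k\<in>{i..<i + m}. c k *\<^sub>R u k y) = potential x" .
    have "e_grad (\<lambda>y. \<Sum>k\<in>{i..<i + m}. c k *\<^sub>R u k y) = x"
      by (rule H10_of_potential(2)[OF ae_sum_L2[OF finite_atLeastLessThan H10_L2[OF uk]] xG e])
    moreover have "(\<lambda>y. \<Sum>k\<in>{i..<i + m}. c k *\<^sub>R u k y) \<in> E"
      by (auto simp: E_def fun_span_def)
    ultimately show ?thesis by blast
  qed
  have E: "v \<in> H10 \<Omega> \<and> e_grad v \<in> eigvec potential grads (1 / ev) \<and> wgrad \<Omega> v \<in> Hdiv \<Omega> \<and>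
      e_div (wgrad \<Omega> v) = (e_grad v, - ev *\<^sub>R potential (e_grad v))" if v: "v \<in> E" for v
  proof -
    obtain c where c: "v = (\<lambda>y. \<Sum>k\<in>{i..<i + m}. c k *\<^sub>R u k y)" using v by (auto simp: E_def fun_span_def)
    define x where "x = (\<Sum>k\<in>{i..<i + m}. c k *\<^sub>R g k)"
    have gG: "g k \<in> grads" if "k \<in> {i..<i + m}" for k using ge[OF that] by (simp add: eigvec_def)
    have uk: "u k \<in> H10 \<Omega>" if "k \<in> {i..<i + m}" for k using uH[of k] that i(1) by auto
    have xG: "x \<in> grads" unfolding x_def by (intro subspace_sum subspace_scale grads_space gG)
    have px: "potential x = (\<Sum>k\<in>{i..<i + m}. c k *\<^sub>R potential (g k))"
      unfolding x_def by (rule potential_sum[OF finite_atLeastLessThan gG])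
    have "emb \<Omega> v = (\<Sum>k\<in>{i..<i + m}. c k *\<^sub>R emb \<Omega> (u k))"
      unfolding c by (rule emb_sum[OF finite_atLeastLessThan H10_L2[OF uk]])
    also have "\<dots> = potential x" unfolding px
      by (intro sum.cong refl) (simp add: g_def potential_e_grad uk)
    finally have e: "emb \<Omega> v = potential x" .
    have vL: "v \<in> L2 \<Omega>" unfolding c by (rule ae_sum_L2[OF finite_atLeastLessThan H10_L2[OF uk]])
    note H = H10_of_potential[OF vL xG e]
    have "x \<in> eigvec potential grads (1 / ev)"
      unfolding eigvec_def
    proof (intro CollectI conjI ballI xG)
      fix y assume y: "y \<in> grads"
      have "potential (g k) \<bullet> potential y = 1 / ev * (g k \<bullet> y)" if "k \<in> {i..<i + m}" for k
        using ge[OF that] y by (simp add: eigvec_def)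
      then show "potential x \<bullet> potential y = 1 / ev * (x \<bullet> y)"
        unfolding px unfolding x_def by (simp add: inner_sum_left sum_divide_distrib)
    qed
    moreover from eigenfunction_regularity(2,4)[OF regularity ev this H]
    have "wgrad \<Omega> v \<in> Hdiv \<Omega>" "e_div (wgrad \<Omega> v) = (x, - ev *\<^sub>R potential x)" by blast+
    ultimately show ?thesis using H by simp
  qed
  \<comment> \<open>\<open>approx_err\<close> normalises eigenfunctions in L2,
    \<open>err_bound\<close> measures by the gradient. On the eigenspace the two norms differ by the
    factor sqrt ev.\<close>
  have err: "err_bound ev h (approx_err \<Omega> (S h) (U h) E / sqrt ev)" if h: "0 < h" for h
  proof -
    let ?a = "approx_err \<Omega> (S h) (U h) E"
    have unit: "infdist x (Uh h) \<le> ?a \<and> infdist (x, - ev *\<^sub>R potential x) (Sh h) \<le> ?a"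
      if x: "x \<in> eigvec potential grads (1 / ev)" "norm (potential x) = 1" for x
    proof -
      obtain v where v: "v \<in> E" "e_grad v = x" using L_E[OF x(1)] by blast
      have vH: "v \<in> H10 \<Omega>" and ed: "e_div (wgrad \<Omega> v) = (e_grad v, - ev *\<^sub>R potential (e_grad v))"
        using E[OF v(1)] by blast+
      have "L2_norm \<Omega> v = norm (potential x)"
        unfolding v(2)[symmetric] potential_e_grad[OF vH] by (rule emb_norm[OF domain_sets H10_L2[OF vH], symmetric])
      then have "L2_norm \<Omega> v = 1" using x(2) by simp
      note ge = approx_err_ge[OF S'[OF h] U'[OF h] ev E v(1) this]
      show ?thesis using ge[unfolded ed, unfolded v(2)] unfolding Sh_def Uh_def by blast
    qed
    interpret ls_discretization grads potential "Sh h" "Uh h" by (rule disc[OF h])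
    have hom: "infdist x (Uh h) \<le> ?a / sqrt ev * norm x \<and>
        infdist (x, - ev *\<^sub>R potential x) (Sh h) \<le> ?a / sqrt ev * norm x"
      if x: "x \<in> eigvec potential grads (1 / ev)" "x \<noteq> 0" for x
    proof -
      have xG: "x \<in> grads" using x by (simp add: eigvec_def)
      define t where "t = norm (potential x)"
      have "(norm (potential x))\<^sup>2 = 1 / ev * (norm x)\<^sup>2"
        using x(1) xG by (simp add: eigvec_def power2_norm_eq_inner)
      then have "t = sqrt (1 / ev * (norm x)\<^sup>2)" unfolding t_def by (metis norm_ge_zero real_sqrt_unique)
      then have t: "t = norm x / sqrt ev" by (simp add: real_sqrt_mult real_sqrt_divide)
      have t0: "0 < t" using x(2) ev by (simp add: t)
      define y where "y = (1 / t) *\<^sub>R x"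
      have yx: "x = t *\<^sub>R y" using t0 by (simp add: y_def)
      have py: "potential y = (1 / t) *\<^sub>R potential x" unfolding y_def by (rule potential_scaleR[OF xG])
      have yE: "y \<in> eigvec potential grads (1 / ev)"
        using x(1) py by (auto simp: eigvec_def y_def subspace_scale grads_space)
      have "norm (potential y) = 1" using t0 unfolding py by (simp add: t_def)
      note un = unit[OF yE this]
      have "infdist x (Uh h) \<le> \<bar>t\<bar> * infdist y (Uh h)"
        unfolding yx by (rule infdist_scaleR_le[OF U_space])
      moreover have pair: "(x, - ev *\<^sub>R potential x) = t *\<^sub>R (y, - ev *\<^sub>R potential y)"
        using t0 by (simp add: yx py[unfolded yx])
      have "infdist (x, - ev *\<^sub>R potential x) (Sh h) \<le> \<bar>t\<bar> * infdist (y, - ev *\<^sub>R potential y) (Sh h)"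
        unfolding pair by (rule infdist_scaleR_le[OF S_space])
      moreover have "\<bar>t\<bar> * infdist y (Uh h) \<le> \<bar>t\<bar> * ?a" "\<bar>t\<bar> * infdist (y, - ev *\<^sub>R potential y) (Sh h) \<le> \<bar>t\<bar> * ?a"
        using un by (simp_all add: mult_left_mono)
      moreover have "\<bar>t\<bar> * ?a = ?a / sqrt ev * norm x" unfolding abs_of_pos[OF t0] by (simp add: t)
      ultimately show ?thesis by linarith
    qed
    have gi: "g i \<in> eigvec potential grads (1 / ev)" using multiplicity(2) by (intro ge) simp
    have "g i \<noteq> 0"
      using eigen_system_independent[OF cont, of "{i}" "\<lambda>_. 1" i] i(1) by auto
    from hom[OF gi this] have "0 \<le> ?a / sqrt ev * norm (g i)"
      using infdist_nonneg[of "g i" "Uh h"] by linarith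
    then have "0 * norm (g i) \<le> ?a / sqrt ev * norm (g i)" by simp
    \<comment> \<open>The sign of the supremum is read off from the nonzero eigenvector
      \<open>g i\<close>, whose distance is nonnegative.\<close>
    then have a0: "0 \<le> ?a / sqrt ev" by (rule mult_right_le_imp_le) (use \<open>g i \<noteq> 0\<close> in simp)
    have "infdist x (Uh h) \<le> ?a / sqrt ev * norm x \<and>
        infdist (x, - ev *\<^sub>R potential x) (Sh h) \<le> ?a / sqrt ev * norm x"
      if x: "x \<in> eigvec potential grads (1 / ev)" for x
    proof (cases "x = 0")
      case True
      have "potential 0 = 0" using potential_scaleR[OF subspace_0[OF grads_space(1)], of 0] by simp
      moreover have "(0, 0) \<in> Sh h" using subspace_0[OF S_space(1)] by (simp add: zero_prod_def)
      ultimately show ?thesis using True subspace_0[OF U_space(1)] by simp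
    qed (use hom[OF x] in blast)
    then show ?thesis using a0 unfolding err_bound_def by blast
  qed
  have "\<bar>ev - lamh h j\<bar> \<le> (C / ev) * (approx_err \<Omega> (S h) (U h) E)\<^sup>2"
    if "0 < h" "h < h0" "j \<in> {i..<i + m}" for h j
  proof -
    have "\<bar>ev - lamh h j\<bar> \<le> C * (approx_err \<Omega> (S h) (U h) E / sqrt ev)\<^sup>2"
      using h0(2)[OF that] err[OF that(1)] by blast
    also have "\<dots> = (C / ev) * (approx_err \<Omega> (S h) (U h) E)\<^sup>2" using ev by (simp add: power_divide)
    finally show ?thesis .
  qed
  then show ?thesis using h0 unfolding E_def by blast
qed

end
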